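(* Let $B^H$ be fractional Brownian motion on $[0,T]$ with Hurst parameter $H\in(0,1)$, let $p=1/H$ and $m_p:=\mathbb E|Z|^p$ with $Z\sim N(0,1)$. There exists an event $\Omega_H$ of probability one such that, for every sample path on $\Omega_H$, $$\lim_{\delta\downarrow0}\ \sup_{0<\ell\le\delta}\ \sup_{0\le a<\ell}\ \sup_{t\in[0,T]}\left|\mathsf V^p_{\Pi(\ell,a)}(B^H;t)-m_pt\right|=0.$$ Consequently, $B^H\in\mathscr R_p([0,T])$ almost surely, and almost surely $[B^H]^p_{\mathbb T}(t)=m_pt$ for all $t\in[0,T]$.
   Context: $B^H$ is the centered Gaussian process with continuous paths, $B^H_0=0$, normalized by $\mathbb E[(B^H_t-B^H_s)^2]=|t-s|^{2H}$. Stopped $p$-energy: for a finite partition $\lambda=\{0=u_0<\dots<u_N=T\}$ and $t\in[0,T]$, $\mathsf V^p_\lambda(x;t):=\sum_{i=0}^{N-1}|x(u_{i+1}\wedge t)-x(u_i\wedge t)|^p$. Shifted uniform grids: for $0<\ell\le T$, $0\le a<\ell$, $\Pi(\ell,a):=\{0,T\}\cup\{a+k\ell: k\in\mathbb Z,\ 0<a+k\ell<T\}$. $\mathscr R_p([0,T])$ is the class of $p$-rough paths: $x\in C([0,T];\mathbb R)$ for which there is a continuous nondecreasing $A:[0,T]\to[0,\infty)$ with $A(T)>A(0)=0$ such that $\sup_{0<\ell\le\delta}\sup_{0\le a<\ell}\sup_{t\in[0,T]}|\mathsf V^p_{\Pi(\ell,a)}(x;t)-A(t)|\to0$ as $\delta\downarrow0$.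 $\mathbb T=(\mathbb T_m)_m$ is the dyadic sequence $\mathbb T_m:=\{jT2^{-m}:0\le j\le2^m\}$. For a partition sequence $\lambda=(\lambda_n)$, $\lambda_n=\{0=u^n_0<\dots<u^n_{N(\lambda_n)}=T\}$, with vanishing mesh, $[x]^p_\lambda(t):=\mu^{p,x}_\lambda([0,t])$, where $\mu^{p,x}_\lambda$ is the finite nonatomic weak limit (when it exists) of the measures $\sum_i|x(u^n_{i+1})-x(u^n_i)|^p\delta_{u_i^n}$. *)

theory Defs
  imports "HOL-Probability.Probability"
begin

section \<open>Gaussian processes and fractional Brownian motion\<close>

text \<open>Normal laws of variance zero (constants) count as Gaussian; the library's
  \<^const>\<open>normal_density\<close> only covers positive variance.\<close>

definition gaussian_rv :: "'a measure \<Rightarrow> ('a \<Rightarrow> real) \<Rightarrow> bool" where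
  "gaussian_rv M X \<longleftrightarrow> X \<in> borel_measurable M \<and>
     ((\<exists>\<mu> \<sigma>. 0 < \<sigma> \<and> distributed M lborel X (normal_density \<mu> \<sigma>)) \<or>
      (\<exists>\<mu>. AE \<omega> in M. X \<omega> = \<mu>))"

definition gaussian_process_on ::
    "'a measure \<Rightarrow> 'i set \<Rightarrow> ('i \<Rightarrow> 'a \<Rightarrow> real) \<Rightarrow> bool" where
  "gaussian_process_on M I X \<longleftrightarrow>
     (\<forall>J c. finite J \<and> J \<subseteq> I \<longrightarrow> gaussian_rv M (\<lambda>\<omega>. \<Sum>t\<in>J. c t * X t \<omega>))"

definition fractional_brownian_motion_on ::
    "'a measure \<Rightarrow> real \<Rightarrow> real \<Rightarrow> (real \<Rightarrow> 'a \<Rightarrow> real) \<Rightarrow> bool" where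
  "fractional_brownian_motion_on M T H B \<longleftrightarrow>
     gaussian_process_on M {0..T} B \<and>
     (\<forall>t\<in>{0..T}. (\<integral>\<omega>. B t \<omega> \<partial>M) = 0) \<and>
     (\<forall>\<omega>\<in>space M. continuous_on {0..T} (\<lambda>t. B t \<omega>)) \<and>
     (\<forall>\<omega>\<in>space M. B 0 \<omega> = 0) \<and>
     (\<forall>s\<in>{0..T}. \<forall>t\<in>{0..T}. (\<integral>\<omega>. (B t \<omega> - B s \<omega>)\<^sup>2 \<partial>M) = \<bar>t - s\<bar> powr (2 * H))"

definition normal_abs_moment :: "real \<Rightarrow> real" where
  "normal_abs_moment p = (\<integral>z. \<bar>z\<bar> powr p \<partial>density lborel std_normal_density)"


section \<open>Partitions and stopped energy\<close>

text \<open>A partition of \<open>[0,T]\<close> is represented by the finite set of its points.\<close>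

definition is_partition :: "real \<Rightarrow> real set \<Rightarrow> bool" where
  "is_partition T P \<longleftrightarrow> finite P \<and> {0, T} \<subseteq> P \<and> P \<subseteq> {0..T}"

definition node :: "real set \<Rightarrow> nat \<Rightarrow> real" where
  "node P i = sorted_list_of_set P ! i"

definition mesh :: "real set \<Rightarrow> real" where
  "mesh P = (MAX i\<in>{..<card P - 1}. node P (Suc i) - node P i)"

definition is_partition_sequence :: "real \<Rightarrow> (nat \<Rightarrow> real set) \<Rightarrow> bool" where
  "is_partition_sequence T Ps \<longleftrightarrow> (\<forall>n. is_partition T (Ps n)) \<and> (\<lambda>n. mesh (Ps n)) \<longlonglongrightarrow> 0"

definition stopped_energy :: "real \<Rightarrow> real set \<Rightarrow> (real \<Rightarrow> real) \<Rightarrow> real \<Rightarrow> real" where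
  "stopped_energy p P x t =
     (\<Sum>i<card P - 1. \<bar>x (min (node P (Suc i)) t) - x (min (node P i) t)\<bar> powr p)"

definition shifted_grid :: "real \<Rightarrow> real \<Rightarrow> real \<Rightarrow> real set" where
  "shifted_grid T l a =
     {0, T} \<union> {a + of_int k * l | k :: int. 0 < a + of_int k * l \<and> a + of_int k * l < T}"

text \<open>The suprema are taken in \<^typ>\<open>ennreal\<close>: for a given \<open>\<delta>\<close> they may be infinite,
  since the number of grid points is unbounded as the step \<open>l\<close> tends to \<open>0\<close>.\<close>

definition grid_deviation ::
    "real \<Rightarrow> real \<Rightarrow> (real \<Rightarrow> real) \<Rightarrow> (real \<Rightarrow> real) \<Rightarrow> real \<Rightarrow> ennreal" where
  "grid_deviation p T x A \<delta> =
     (SUP l\<in>{l. 0 < l \<and> l \<le> \<delta> \<and> l \<le> T}. SUP a\<in>{0..<l}. SUP t\<in>{0..T}.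
        ennreal \<bar>stopped_energy p (shifted_grid T l a) x t - A t\<bar>)"

definition rough_paths :: "real \<Rightarrow> real \<Rightarrow> (real \<Rightarrow> real) set" where
  "rough_paths p T = {x. continuous_on {0..T} x \<and>
     (\<exists>A. continuous_on {0..T} A \<and> mono_on {0..T} A \<and> (\<forall>t\<in>{0..T}. 0 \<le> A t) \<and>
          A 0 = 0 \<and> 0 < A T \<and>
          (grid_deviation p T x A \<longlongrightarrow> 0) (at_right 0))}"


section \<open>\<open>p\<close>-variation along a sequence of partitions\<close>

text \<open>The measure \<open>\<Sum>\<^sub>i \<bar>x(u\<^sub>i\<^sub>+\<^sub>1) - x(u\<^sub>i)\<bar>\<^sup>p \<delta>\<^bsub>u\<^sub>i\<^esub>\<close> on \<open>[0,T]\<close>, as the image under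
  \<open>i \<mapsto> u\<^sub>i\<close> of the corresponding weights on the indices.\<close>

definition energy_measure :: "real \<Rightarrow> real \<Rightarrow> real set \<Rightarrow> (real \<Rightarrow> real) \<Rightarrow> real measure" where
  "energy_measure p T P x =
     distr (point_measure {..<card P - 1} (\<lambda>i. ennreal (\<bar>x (node P (Suc i)) - x (node P i)\<bar> powr p)))
           (restrict_space borel {0..T}) (node P)"

definition weak_limit_on :: "real \<Rightarrow> (nat \<Rightarrow> real measure) \<Rightarrow> real measure \<Rightarrow> bool" where
  "weak_limit_on T \<nu> \<mu> \<longleftrightarrow>
     (\<forall>f :: real \<Rightarrow> real. continuous_on {0..T} f \<longrightarrow>
        (\<lambda>n. \<integral>s. f s \<partial>\<nu> n) \<longlonglongrightarrow> (\<integral>s. f s \<partial>\<mu>))"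

definition has_variation_measure ::
    "real \<Rightarrow> real \<Rightarrow> (nat \<Rightarrow> real set) \<Rightarrow> (real \<Rightarrow> real) \<Rightarrow> real measure \<Rightarrow> bool" where
  "has_variation_measure p T Ps x \<mu> \<longleftrightarrow>
     sets \<mu> = sets (restrict_space borel {0..T}) \<and> finite_measure \<mu> \<and>
     (\<forall>t\<in>{0..T}. emeasure \<mu> {t} = 0) \<and>
     weak_limit_on T (\<lambda>n. energy_measure p T (Ps n) x) \<mu>"

definition variation_measure ::
    "real \<Rightarrow> real \<Rightarrow> (nat \<Rightarrow> real set) \<Rightarrow> (real \<Rightarrow> real) \<Rightarrow> real measure" where
  "variation_measure p T Ps x = (THE \<mu>. has_variation_measure p T Ps x \<mu>)"

definition variation ::
    "real \<Rightarrow> real \<Rightarrow> (nat \<Rightarrow> real set) \<Rightarrow> (real \<Rightarrow> real) \<Rightarrow> real \<Rightarrow> real" where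
  "variation p T Ps x t = measure (variation_measure p T Ps x) {0..t}"

definition dyadic_partition :: "real \<Rightarrow> nat \<Rightarrow> real set" where
  "dyadic_partition T m = (\<lambda>j. real j * T / 2 ^ m) ` {0..2 ^ m}"


section \<open>The grids are partitions; the dyadic sequence has vanishing mesh\<close>

lemma is_partition_shifted_grid:
  assumes "0 < T" "0 < l"
  shows "is_partition T (shifted_grid T l a)"
proof -
  let ?K = "{\<lfloor>(- a) / l\<rfloor>..\<lceil>(T - a) / l\<rceil>}"
  have "{a + of_int k * l | k :: int. 0 < a + of_int k * l \<and> a + of_int k * l < T}
          \<subseteq> (\<lambda>k. a + of_int k * l) ` ?K"
  proof clarify
    fix k :: int
    assume k: "0 < a + of_int k * l" "a + of_int k * l < T"
    have "(- a) / l \<le> of_int k" "of_int k \<le> (T - a) / l"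
      using k assms by (simp_all add: field_simps)
    then have "k \<in> ?K" by (simp add: floor_le_iff le_ceiling_iff)
    then show "a + of_int k * l \<in> (\<lambda>k. a + of_int k * l) ` ?K" by blast
  qed
  then have "finite {a + of_int k * l | k :: int. 0 < a + of_int k * l \<and> a + of_int k * l < T}"
    by (rule finite_subset) simp
  then show ?thesis
    using assms unfolding is_partition_def shifted_grid_def by auto
qed

lemma sorted_list_of_dyadic_partition:
  assumes "0 < T"
  shows "sorted_list_of_set (dyadic_partition T m) =
    map (\<lambda>j. real j * T / 2 ^ m) [0..<Suc (2 ^ m)]" (is "_ = ?xs")
proof -
  have "strict_mono (\<lambda>j. real j * T / 2 ^ m)"
    using assms by (intro strict_monoI) (simp add: divide_strict_right_mono)
  then have "sorted_wrt (<) ?xs"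
    unfolding sorted_wrt_map using strict_mono_less
    by (metis (no_types, lifting) sorted_wrt_mono_rel sorted_wrt_upt)
  moreover have "set ?xs = dyadic_partition T m"
    unfolding dyadic_partition_def set_map set_upt atLeastLessThanSuc_atLeastAtMost ..
  ultimately show ?thesis
    by (metis sorted_list_of_set.idem_if_sorted_distinct strict_sorted_iff)
qed

lemma card_dyadic_partition:
  assumes "0 < T"
  shows "card (dyadic_partition T m) = Suc (2 ^ m)"
  using arg_cong[OF sorted_list_of_dyadic_partition[OF assms, of m], of length]
  by simp

lemma node_dyadic_partition:
  assumes "0 < T" "i \<le> 2 ^ m"
  shows "node (dyadic_partition T m) i = real i * T / 2 ^ m"
  using assms unfolding node_def
  by (simp add: sorted_list_of_dyadic_partition nth_append del: upt_Suc)

lemma dyadic_is_partition_sequence: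
  assumes "0 < T"
  shows "is_partition_sequence T (dyadic_partition T)"
proof -
  have "is_partition T (dyadic_partition T m)" for m
  proof -
    have "0 \<in> dyadic_partition T m"
      unfolding dyadic_partition_def by (rule image_eqI[where x = 0]) simp_all
    moreover have "T \<in> dyadic_partition T m"
      unfolding dyadic_partition_def by (rule image_eqI[where x = "2 ^ m"]) simp_all
    moreover have "real j * T / 2 ^ m \<le> T" if "j \<le> 2 ^ m" for j
    proof -
      have "real j \<le> 2 ^ m" using that by (metis of_nat_le_iff of_nat_numeral of_nat_power)
      then show ?thesis using assms by (simp add: field_simps)
    qed
    ultimately show ?thesis
      using assms unfolding is_partition_def by (auto simp: dyadic_partition_def)
  qed
  moreover have "mesh (dyadic_partition T m) = T * (1 / 2) ^ m" for m
  proof -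
    have "(\<lambda>i. node (dyadic_partition T m) (Suc i) - node (dyadic_partition T m) i) ` {..<2 ^ m}
        = (\<lambda>i::nat. T * (1 / 2) ^ m) ` {..<2 ^ m}"
      using assms by (intro image_cong) (auto simp: node_dyadic_partition field_simps)
    also have "\<dots> = {T * (1 / 2) ^ m}"
      by (simp add: image_constant_conv lessThan_empty_iff)
    finally show ?thesis
      using assms by (simp add: mesh_def card_dyadic_partition)
  qed
  moreover have "(\<lambda>m. T * (1 / 2) ^ m) \<longlonglongrightarrow> 0"
    by (intro tendsto_mult_right_zero LIMSEQ_power_zero) simp
  ultimately show ?thesis
    unfolding is_partition_sequence_def by simp
qed

end

theory Submission
  imports Defs
begin

text \<open>For every partition of \<open>[0,T]\<close> and every stopping level the expectation of the energy is exactly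
  \<open>m\<^sub>p t\<close>, because \<open>p H = 1\<close>. The fluctuations are estimated in \<open>L\<^sup>2\<^sup>r\<close> by the argument of Maurey and
  Pisier: an independent copy of the increments is rotated into the original ones, and conditionally
  on the position the velocity of this rotation is a centred Gaussian whose variance is controlled
  by the row sums of the covariance matrix. Covariances of disjoint increments have one sign, so
  these row sums collapse to single covariances of order \<open>l\<^sup>H\<close>. The \<open>2r\<close>-th moment of the fluctuation
  at mesh \<open>l\<close> is then of order \<open>l\<close> to the power \<open>(1 - H) r\<close>, which beats any net of polynomial size in
  the parameters \<open>(l, a, t)\<close> when \<open>r\<close> is large; the Hoelder continuity of the paths extends the
  convergence from a sufficiently fine such net to all parameters.\<close>

section \<open>Centred Gaussian random variables\<close>

text \<open>The exponent (1 - H) r counts three factors: row sums of order l^H, about 1/l cells, and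
  squared weights |X|^(2 (p - 1)) of order l^(2 - 2 H), which multiply to l^(1 - H). A variance
  bound, r = 1, does not suffice, because the size N^(3 Q) of the net is dictated by the paths: the
  Hoelder error has to beat the number of cells, so Q is chosen first, depending on H only, and r
  afterwards. Any positive Hoelder exponent would serve; H/2 comes out of a single moment. The steps
  are sorted into scales T/(N + 1) < l \<le> T/N, on each of which N + 2 clamped cells exhaust every
  grid, so that a grid and its neighbour in the net can be compared term by term. Degenerate vectors
  do occur, since clamped grid points coincide and give zero increments; joint laws are therefore
  identified by characteristic functions and not by densities.\<close>

lemma prob_space_std_normal: "prob_space std_normal_distribution"
  by (intro prob_space_normal_density) simp

lemma (in prob_space) integrable_gaussian_rv_power:
  assumes "gaussian_rv M X"
  shows "integrable M (\<lambda>\<omega>. X \<omega> ^ k)"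
proof -
  have X[measurable]: "X \<in> borel_measurable M"
    using assms by (simp add: gaussian_rv_def)
  from assms consider (nondeg) \<mu> \<sigma> where "0 < \<sigma>" "distributed M lborel X (normal_density \<mu> \<sigma>)"
    | (const) \<mu> where "AE \<omega> in M. X \<omega> = \<mu>"
    unfolding gaussian_rv_def by blast
  then show ?thesis
  proof cases
    case nondeg
    then have Z: "distributed M lborel (\<lambda>\<omega>. (X \<omega> - \<mu>) / \<sigma>) std_normal_density"
      using normal_standard_normal_convert by blast
    have int: "integrable lborel (\<lambda>x. std_normal_density x * (\<mu> + \<sigma> * x) ^ k)"
    proof -
      have "std_normal_density x * (\<mu> + \<sigma> * x) ^ k =
          (\<Sum>i\<le>k. (of_nat (k choose i) * \<mu> ^ i * \<sigma> ^ (k - i)) * (std_normal_density x * x ^ (k - i)))" for x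
        unfolding binomial_ring sum_distrib_left
        by (intro sum.cong refl) (simp add: power_mult_distrib)
      then show ?thesis
        by (simp only:) (intro Bochner_Integration.integrable_sum integrable_mult_right
          integrable_std_normal_moment)
    qed
    have "integrable M (\<lambda>\<omega>. (\<mu> + \<sigma> * ((X \<omega> - \<mu>) / \<sigma>)) ^ k)"
      using int by (subst (asm) distributed_integrable[OF Z]) auto
    then show ?thesis using nondeg by simp
  next
    case const
    have "integrable M (\<lambda>\<omega>. \<mu> ^ k)" by simp
    then show ?thesis
      by (subst integrable_cong_AE[where g = "\<lambda>_. \<mu> ^ k"]) (use const in auto)
  qed
qed

text \<open>Scaling a standard normal by the standard deviation also covers the degenerate law, with
  factor 0, so the formulas derived from it need no split into the two cases of
  \<open>gaussian_rv\<close>.\<close>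

lemma (in prob_space) gaussian_rv_distr:
  assumes "gaussian_rv M X" and mean: "expectation X = 0"
  shows "distr M borel X =
    distr std_normal_distribution borel (\<lambda>z. sqrt (expectation (\<lambda>\<omega>. (X \<omega>)\<^sup>2)) * z)"
proof -
  have X[measurable]: "X \<in> borel_measurable M"
    using assms by (simp add: gaussian_rv_def)
  from assms(1) consider (nondeg) \<mu> \<sigma> where "0 < \<sigma>" "distributed M lborel X (normal_density \<mu> \<sigma>)"
    | (const) \<mu> where "AE \<omega> in M. X \<omega> = \<mu>"
    unfolding gaussian_rv_def by blast
  then show ?thesis
  proof cases
    case nondeg
    then have \<mu>: "\<mu> = 0"
      using normal_distributed_expectation mean by metis
    have \<sigma>: "expectation (\<lambda>\<omega>. (X \<omega>)\<^sup>2) = \<sigma>\<^sup>2"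
      using normal_distributed_variance[OF nondeg] mean by simp
    have "distributed M lborel (\<lambda>\<omega>. X \<omega> / \<sigma>) std_normal_density"
      using normal_standard_normal_convert[OF nondeg(1), of X \<mu>] nondeg(2) \<mu> by simp
    then have "distr M borel (\<lambda>\<omega>. X \<omega> / \<sigma>) = std_normal_distribution"
      by (simp add: distributed_def cong: distr_cong)
    then have "distr std_normal_distribution borel (\<lambda>z. \<sigma> * z)
        = distr (distr M borel (\<lambda>\<omega>. X \<omega> / \<sigma>)) borel (\<lambda>z. \<sigma> * z)"
      by simp
    also have "\<dots> = distr M borel X"
      using nondeg by (subst distr_distr) (auto simp: comp_def)
    finally show ?thesis
      using \<sigma> nondeg(1) by simp
  next
    case const
    then have "expectation X = \<mu>"
      by (subst integral_cong_AE[where g = "\<lambda>_. \<mu>"]) (auto simp: prob_space)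
    with mean const have AE0: "AE \<omega> in M. X \<omega> = 0" by simp
    then have "expectation (\<lambda>\<omega>. (X \<omega>)\<^sup>2) = 0"
      by (subst integral_cong_AE[where g = "\<lambda>_. 0"]) auto
    moreover have "distr M borel X = distr M borel (\<lambda>_. 0)"
      using AE0 by (intro distr_cong_AE) auto
    moreover have "distr M borel (\<lambda>_. 0 :: real) = distr std_normal_distribution borel (\<lambda>_. 0)"
      by (rule measure_eqI)
        (use prob_space.emeasure_space_1[OF prob_space_std_normal] in
          \<open>auto simp: emeasure_distr emeasure_space_1 vimage_def\<close>)
    ultimately show ?thesis by simp
  qed
qed

lemma (in prob_space) gaussian_rv_nn_integral:
  assumes "gaussian_rv M X" "expectation X = 0"
    and [measurable]: "f \<in> borel_measurable borel"
  shows "(\<integral>\<^sup>+\<omega>. f (X \<omega>) \<partial>M) =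
    (\<integral>\<^sup>+z. f (sqrt (expectation (\<lambda>\<omega>. (X \<omega>)\<^sup>2)) * z) \<partial>std_normal_distribution)"
proof -
  have X[measurable]: "X \<in> borel_measurable M"
    using assms by (simp add: gaussian_rv_def)
  have "(\<integral>\<^sup>+\<omega>. f (X \<omega>) \<partial>M) = (\<integral>\<^sup>+x. f x \<partial>distr M borel X)"
    by (simp add: nn_integral_distr)
  also have "\<dots> = (\<integral>\<^sup>+z. f (sqrt (expectation (\<lambda>\<omega>. (X \<omega>)\<^sup>2)) * z) \<partial>std_normal_distribution)"
    unfolding gaussian_rv_distr[OF assms(1,2)] by (simp add: nn_integral_distr)
  finally show ?thesis .
qed

text \<open>For centred variables the variance alone determines this value. Applied to linear forms,
  it reduces an equality of joint laws to an equality of variances.\<close>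

lemma (in prob_space) gaussian_rv_char:
  assumes "gaussian_rv M X" "expectation X = 0"
  shows "(CLINT \<omega>|M. iexp (X \<omega>)) = exp (- complex_of_real (expectation (\<lambda>\<omega>. (X \<omega>)\<^sup>2)) / 2)"
proof -
  let ?v = "expectation (\<lambda>\<omega>. (X \<omega>)\<^sup>2)"
  have X[measurable]: "X \<in> borel_measurable M"
    using assms by (simp add: gaussian_rv_def)
  have "(CLINT \<omega>|M. iexp (X \<omega>)) = (CLINT x|distr M borel X. iexp x)"
    by (subst integral_distr) auto
  also have "\<dots> = char std_normal_distribution (sqrt ?v)"
    unfolding gaussian_rv_distr[OF assms(1,2)] char_def by (subst integral_distr) auto
  also have "\<dots> = exp (- complex_of_real ?v / 2)"
    by (simp add: char_std_normal_distribution flip: exp_of_real of_real_power)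
  finally show ?thesis .
qed

lemma integrable_std_normal_abs_powr:
  assumes "0 \<le> a"
  shows "integrable std_normal_distribution (\<lambda>z. \<bar>z\<bar> powr a)"
proof -
  let ?k = "nat \<lceil>a\<rceil>"
  have "integrable std_normal_distribution (\<lambda>z. 1 + \<bar>z ^ ?k\<bar>)"
    using prob_space.finite_measure[OF prob_space_std_normal]
    by (intro Bochner_Integration.integrable_add integrable_abs integrable_std_normal_distribution_moment)
      (auto intro: finite_measure.integrable_const)
  then show ?thesis
  proof (rule Bochner_Integration.integrable_bound)
    have "\<bar>z\<bar> powr a \<le> 1 + \<bar>z ^ ?k\<bar>" for z :: real
    proof (cases "\<bar>z\<bar> \<le> 1")
      case True
      then have "\<bar>z\<bar> powr a \<le> 1" using assms by (simp add: powr_le1)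
      then show ?thesis by (simp add: add_increasing2)
    next
      case False
      then have "\<bar>z\<bar> powr a \<le> \<bar>z\<bar> powr real ?k"
        using assms by (intro powr_mono) linarith+
      also have "\<dots> = \<bar>z ^ ?k\<bar>" using False by (simp add: powr_realpow power_abs)
      finally show ?thesis by simp
    qed
    then show "AE z in std_normal_distribution. norm (\<bar>z\<bar> powr a) \<le> norm (1 + \<bar>z ^ ?k\<bar>)"
      by (intro always_eventually allI) (auto intro: order_trans)
  qed simp
qed

lemma normal_abs_moment_nonneg: "0 \<le> normal_abs_moment a"
  unfolding normal_abs_moment_def by (intro integral_nonneg_AE) simp

text \<open>Strict positivity is what gives \<open>0 < A T\<close> in \<open>rough_paths\<close> for
  the linear limit.\<close>

lemma normal_abs_moment_pos:
  assumes "0 \<le> a"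
  shows "0 < normal_abs_moment a"
proof (rule ccontr)
  interpret N: prob_space std_normal_distribution by (rule prob_space_std_normal)
  assume "\<not> 0 < normal_abs_moment a"
  then have "normal_abs_moment a = 0" using normal_abs_moment_nonneg[of a] by simp
  then have "AE z in std_normal_distribution. \<bar>z\<bar> powr a = 0"
    unfolding normal_abs_moment_def
    by (subst (asm) integral_nonneg_eq_0_iff_AE) (auto intro: integrable_std_normal_abs_powr assms)
  then have "AE z in std_normal_distribution. z = 0" by simp
  then have "AE z in lborel. z = (0::real)"
    by (subst (asm) AE_density) (auto simp: normal_density_pos elim: eventually_mono)
  moreover have "AE z in lborel. z \<noteq> (0::real)" by (rule AE_lborel_singleton)
  ultimately have "AE z in (lborel :: real measure). False" by eventually_elim simp
  then show False by (simp add: AE_iff_null null_sets_def)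
qed

lemma (in prob_space) gaussian_rv_abs_powr:
  assumes "gaussian_rv M X" "expectation X = 0" "0 \<le> a"
  shows "(\<integral>\<^sup>+\<omega>. ennreal (\<bar>X \<omega>\<bar> powr a) \<partial>M) =
      ennreal (expectation (\<lambda>\<omega>. (X \<omega>)\<^sup>2) powr (a / 2) * normal_abs_moment a)"
    and "integrable M (\<lambda>\<omega>. \<bar>X \<omega>\<bar> powr a)"
    and "expectation (\<lambda>\<omega>. \<bar>X \<omega>\<bar> powr a) =
      expectation (\<lambda>\<omega>. (X \<omega>)\<^sup>2) powr (a / 2) * normal_abs_moment a"
proof -
  let ?v = "expectation (\<lambda>\<omega>. (X \<omega>)\<^sup>2)"
  have X[measurable]: "X \<in> borel_measurable M"
    using assms by (simp add: gaussian_rv_def)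
  have "0 \<le> ?v" by simp
  then have *: "\<bar>sqrt ?v * z\<bar> powr a = ?v powr (a / 2) * \<bar>z\<bar> powr a" for z
    by (simp add: abs_mult powr_mult powr_half_sqrt[symmetric] powr_powr)
  show 1: "(\<integral>\<^sup>+\<omega>. ennreal (\<bar>X \<omega>\<bar> powr a) \<partial>M) = ennreal (?v powr (a / 2) * normal_abs_moment a)"
    by (subst gaussian_rv_nn_integral[OF assms(1,2), of "\<lambda>x. ennreal (\<bar>x\<bar> powr a)"])
      (auto simp: * normal_abs_moment_def integrable_std_normal_abs_powr[OF assms(3)]
        nn_integral_eq_integral)
  show "integrable M (\<lambda>\<omega>. \<bar>X \<omega>\<bar> powr a)"
    by (rule integrableI_nonneg) (auto simp: 1)
  show "expectation (\<lambda>\<omega>. \<bar>X \<omega>\<bar> powr a) = ?v powr (a / 2) * normal_abs_moment a"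
    by (subst integral_eq_nn_integral) (auto simp: 1 normal_abs_moment_nonneg)
qed

section \<open>Laws of finite families and characteristic functions\<close>

text \<open>Divided by their common mass, which is read off at t = 0, the weights become probability
  densities, and Levy's uniqueness theorem applies to the image laws. If the mass is 0, the weights
  vanish almost everywhere.\<close>

lemma weighted_char_unique:
  fixes X :: "'a \<Rightarrow> real" and X' :: "'b \<Rightarrow> real" and w :: "'a \<Rightarrow> real" and w' :: "'b \<Rightarrow> real"
  assumes M: "prob_space M" and N: "prob_space N"
    and [measurable]: "X \<in> borel_measurable M" "X' \<in> borel_measurable N"
      "w \<in> borel_measurable M" "w' \<in> borel_measurable N"
    and w: "\<And>\<omega>. 0 \<le> w \<omega>" "\<And>\<omega>. w \<omega> \<le> C" and w': "\<And>\<omega>. 0 \<le> w' \<omega>" "\<And>\<omega>. w' \<omega> \<le> C"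
    and eq: "\<And>t. (CLINT \<omega>|M. w \<omega> *\<^sub>R iexp (t * X \<omega>)) = (CLINT \<omega>|N. w' \<omega> *\<^sub>R iexp (t * X' \<omega>))"
    and A[measurable]: "A \<in> sets borel"
  shows "(\<integral>\<omega>. w \<omega> * indicator A (X \<omega>) \<partial>M) = (\<integral>\<omega>. w' \<omega> * indicator A (X' \<omega>) \<partial>N)"
proof -
  interpret M: prob_space M by fact
  interpret N: prob_space N by fact
  have int: "integrable M w" "integrable N w'"
    using w w' by (auto intro!: M.integrable_const_bound[where B = C] N.integrable_const_bound[where B = C])
  define m where "m = (\<integral>\<omega>. w \<omega> \<partial>M)"
  have m': "m = (\<integral>\<omega>. w' \<omega> \<partial>N)"
    using eq[of 0] by (simp add: m_def scaleR_conv_of_real)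
  have "0 \<le> m" unfolding m_def using w by simp
  then consider "m = 0" | "0 < m" by linarith
  then show ?thesis
  proof cases
    case 1
    then have "AE \<omega> in M. w \<omega> = 0" "AE \<omega> in N. w' \<omega> = 0"
      using integral_nonneg_eq_0_iff_AE[OF int(1)] integral_nonneg_eq_0_iff_AE[OF int(2)] m' w w' 1
      by (auto simp: m_def)
    then have "(\<integral>\<omega>. w \<omega> * indicator A (X \<omega>) \<partial>M) = 0" "(\<integral>\<omega>. w' \<omega> * indicator A (X' \<omega>) \<partial>N) = 0"
      by (auto intro!: integral_eq_zero_AE)
    then show ?thesis by simp
  next
    case 2
    define P where "P = distr (density M (\<lambda>\<omega>. ennreal (w \<omega> / m))) borel X"
    define Q where "Q = distr (density N (\<lambda>\<omega>. ennreal (w' \<omega> / m))) borel X'"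
    have P0: "(\<integral>\<^sup>+\<omega>. ennreal (w \<omega> / m) \<partial>M) = 1"
      using int 2 w by (subst nn_integral_eq_integral) (auto simp: m_def)
    have Q0: "(\<integral>\<^sup>+\<omega>. ennreal (w' \<omega> / m) \<partial>N) = 1"
      using int 2 w' by (subst nn_integral_eq_integral) (auto simp: m')
    have dP: "prob_space (density M (\<lambda>\<omega>. ennreal (w \<omega> / m)))"
      by (rule prob_spaceI) (simp add: emeasure_density P0 cong: nn_integral_cong)
    have dQ: "prob_space (density N (\<lambda>\<omega>. ennreal (w' \<omega> / m)))"
      by (rule prob_spaceI) (simp add: emeasure_density Q0 cong: nn_integral_cong)
    have rP: "real_distribution P" unfolding P_def
      by (rule prob_space.real_distribution_distr[OF dP]) simp
    have rQ: "real_distribution Q" unfolding Q_def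
      by (rule prob_space.real_distribution_distr[OF dQ]) simp
    have "char P t = char Q t" for t
    proof -
      have "char P t = (CLINT \<omega>|M. (w \<omega> / m) *\<^sub>R iexp (t * X \<omega>))"
        unfolding P_def char_def using w 2
        by (subst integral_distr) (auto simp: integral_density)
      also have "\<dots> = (1 / m) *\<^sub>R (CLINT \<omega>|M. w \<omega> *\<^sub>R iexp (t * X \<omega>))"
        by (subst integral_scaleR_right[symmetric]) (simp add: divide_inverse mult.commute)
      also have "\<dots> = (1 / m) *\<^sub>R (CLINT \<omega>|N. w' \<omega> *\<^sub>R iexp (t * X' \<omega>))"
        by (simp only: eq)
      also have "\<dots> = (CLINT \<omega>|N. (w' \<omega> / m) *\<^sub>R iexp (t * X' \<omega>))"
        by (subst integral_scaleR_right[symmetric]) (simp add: divide_inverse mult.commute)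
      also have "\<dots> = char Q t"
        unfolding Q_def char_def using w' 2
        by (subst integral_distr) (auto simp: integral_density)
      finally show ?thesis .
    qed
    then have PQ: "P = Q" by (intro Levy_uniqueness rP rQ ext)
    have "(\<integral>x. indicator A x \<partial>P) = (\<integral>\<omega>. (w \<omega> / m) * indicator A (X \<omega>) \<partial>M)"
      unfolding P_def using w 2 by (subst integral_distr) (auto simp: integral_density)
    moreover have "(\<integral>x. indicator A x \<partial>Q) = (\<integral>\<omega>. (w' \<omega> / m) * indicator A (X' \<omega>) \<partial>N)"
      unfolding Q_def using w' 2 by (subst integral_distr) (auto simp: integral_density)
    ultimately have "(\<integral>\<omega>. (w \<omega> / m) * indicator A (X \<omega>) \<partial>M) = (\<integral>\<omega>. (w' \<omega> / m) * indicator A (X' \<omega>) \<partial>N)"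
      using PQ by simp
    then show ?thesis using 2 by (simp add: divide_inverse mult.assoc mult.left_commute)
  qed
qed

lemma (in prob_space) integrable_weighted_iexp:
  fixes w S :: "'a \<Rightarrow> real"
  assumes [measurable]: "w \<in> borel_measurable M" "S \<in> borel_measurable M"
    and "\<And>\<omega>. 0 \<le> w \<omega>" "\<And>\<omega>. w \<omega> \<le> C"
  shows "integrable M (\<lambda>\<omega>. w \<omega> *\<^sub>R iexp (S \<omega>))"
  by (rule integrable_const_bound[where B = C]) (use assms in auto)

text \<open>One coordinate at a time is moved from the exponential into the weight. The weight has to be
  nonnegative, whence the detour through \<open>1 + cos S\<close> and \<open>1 + sin S\<close>.\<close>

lemma weighted_char_indicator:
  fixes X S :: "'a \<Rightarrow> real" and X' S' :: "'b \<Rightarrow> real" and w :: "'a \<Rightarrow> real" and w' :: "'b \<Rightarrow> real"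
  assumes M: "prob_space M" and N: "prob_space N"
    and [measurable]: "X \<in> borel_measurable M" "X' \<in> borel_measurable N"
      "w \<in> borel_measurable M" "w' \<in> borel_measurable N"
      "S \<in> borel_measurable M" "S' \<in> borel_measurable N"
    and w: "\<And>\<omega>. 0 \<le> w \<omega>" "\<And>\<omega>. w \<omega> \<le> 1" and w': "\<And>\<omega>. 0 \<le> w' \<omega>" "\<And>\<omega>. w' \<omega> \<le> 1"
    and eq: "\<And>s t. (CLINT \<omega>|M. w \<omega> *\<^sub>R iexp (s * S \<omega> + t * X \<omega>)) =
                   (CLINT \<omega>|N. w' \<omega> *\<^sub>R iexp (s * S' \<omega> + t * X' \<omega>))"
    and A[measurable]: "A \<in> sets borel"
  shows "(CLINT \<omega>|M. (w \<omega> * indicator A (X \<omega>)) *\<^sub>R iexp (S \<omega>)) =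
         (CLINT \<omega>|N. (w' \<omega> * indicator A (X' \<omega>)) *\<^sub>R iexp (S' \<omega>))"
proof -
  interpret M: prob_space M by fact
  interpret N: prob_space N by fact
  \<comment> \<open>Euler's formulas: multiplying by a cos x + b sin x shifts the frequency by 1 and
    by -1. The new weight therefore needs the hypothesis at s = 0, 1, -1 only, and the factors 0, 1,
    -1 are left unsimplified to match it.\<close>
  have trig: "(v * (1 + (a * cos x + b * sin x))) *\<^sub>R iexp y =
      v *\<^sub>R iexp (0 * x + y) + ((complex_of_real a - \<i> * complex_of_real b) / 2) * (v *\<^sub>R iexp (1 * x + y))
        + ((complex_of_real a + \<i> * complex_of_real b) / 2) * (v *\<^sub>R iexp ((-1) * x + y))" for v x y a b :: real
    by (simp add: complex_eq_iff Re_exp Im_exp cos_add sin_add cos_diff sin_diff) (simp add: field_simps)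
  have key: "(\<integral>\<omega>. (w \<omega> * (1 + (a * cos (S \<omega>) + b * sin (S \<omega>)))) * indicator A (X \<omega>) \<partial>M) =
     (\<integral>\<omega>. (w' \<omega> * (1 + (a * cos (S' \<omega>) + b * sin (S' \<omega>)))) * indicator A (X' \<omega>) \<partial>N)"
    if ab: "\<And>x. \<bar>a * cos x + b * sin x\<bar> \<le> 1" for a b
  proof (rule weighted_char_unique[OF M N, where C = 2])
    have ab': "0 \<le> 1 + (a * cos x + b * sin x)" "1 + (a * cos x + b * sin x) \<le> 2" for x
      using ab[of x] by linarith+
    show "0 \<le> w \<omega> * (1 + (a * cos (S \<omega>) + b * sin (S \<omega>)))" for \<omega>
      using w ab' by (intro mult_nonneg_nonneg)
    show "0 \<le> w' \<omega> * (1 + (a * cos (S' \<omega>) + b * sin (S' \<omega>)))" for \<omega>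
      using w' ab' by (intro mult_nonneg_nonneg)
    show "w \<omega> * (1 + (a * cos (S \<omega>) + b * sin (S \<omega>))) \<le> 2" for \<omega>
      using mult_mono[of "w \<omega>" 1 _ 2] w ab' by fastforce
    show "w' \<omega> * (1 + (a * cos (S' \<omega>) + b * sin (S' \<omega>))) \<le> 2" for \<omega>
      using mult_mono[of "w' \<omega>" 1 _ 2] w' ab' by fastforce
    fix t
    have iM: "integrable M (\<lambda>\<omega>. w \<omega> *\<^sub>R iexp (s * S \<omega> + t * X \<omega>))" for s
      using w by (intro M.integrable_weighted_iexp[where C = 1]) auto
    have iN: "integrable N (\<lambda>\<omega>. w' \<omega> *\<^sub>R iexp (s * S' \<omega> + t * X' \<omega>))" for s
      using w' by (intro N.integrable_weighted_iexp[where C = 1]) auto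
    show "(CLINT \<omega>|M. (w \<omega> * (1 + (a * cos (S \<omega>) + b * sin (S \<omega>)))) *\<^sub>R iexp (t * X \<omega>)) =
        (CLINT \<omega>|N. (w' \<omega> * (1 + (a * cos (S' \<omega>) + b * sin (S' \<omega>)))) *\<^sub>R iexp (t * X' \<omega>))"
      unfolding trig
      by (simp only: Bochner_Integration.integral_add integral_mult_right_zero iM iN eq
          Bochner_Integration.integrable_add integrable_mult_right)
  qed (measurable)
  have i: "integrable M (\<lambda>\<omega>. w \<omega> * f (S \<omega>) * indicator A (X \<omega>))"
      "integrable N (\<lambda>\<omega>. w' \<omega> * f (S' \<omega>) * indicator A (X' \<omega>))"
    if [measurable]: "f \<in> borel_measurable borel" and "\<And>x. \<bar>f x\<bar> \<le> 1" for f :: "real \<Rightarrow> real"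
    using that(2) w w' mult_mono[of "w _" 1 "\<bar>f _\<bar>" 1] mult_mono[of "w' _" 1 "\<bar>f _\<bar>" 1]
    by (auto intro!: M.integrable_const_bound[where B = 1] N.integrable_const_bound[where B = 1]
        simp: abs_mult indicator_def)
  \<comment> \<open>Subtracting the case a = b = 0 from (1, 0) and (0, 1) isolates the cosine and
    sine parts, which reassemble to \<open>iexp\<close>.\<close>
  have 0: "(\<integral>\<omega>. w \<omega> * indicator A (X \<omega>) \<partial>M) = (\<integral>\<omega>. w' \<omega> * indicator A (X' \<omega>) \<partial>N)"
    using key[of 0 0] by simp
  have c: "(\<integral>\<omega>. w \<omega> * cos (S \<omega>) * indicator A (X \<omega>) \<partial>M) = (\<integral>\<omega>. w' \<omega> * cos (S' \<omega>) * indicator A (X' \<omega>) \<partial>N)"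
    using key[of 1 0] 0 i[of "\<lambda>_. 1"] i[of cos] by (simp add: algebra_simps)
  have s: "(\<integral>\<omega>. w \<omega> * sin (S \<omega>) * indicator A (X \<omega>) \<partial>M) = (\<integral>\<omega>. w' \<omega> * sin (S' \<omega>) * indicator A (X' \<omega>) \<partial>N)"
    using key[of 0 1] 0 i[of "\<lambda>_. 1"] i[of sin] by (simp add: algebra_simps)
  have ic: "integrable M (\<lambda>\<omega>. w \<omega> * cos (S \<omega>) * indicator A (X \<omega>))"
      "integrable N (\<lambda>\<omega>. w' \<omega> * cos (S' \<omega>) * indicator A (X' \<omega>))"
    and si: "integrable M (\<lambda>\<omega>. w \<omega> * sin (S \<omega>) * indicator A (X \<omega>))"
      "integrable N (\<lambda>\<omega>. w' \<omega> * sin (S' \<omega>) * indicator A (X' \<omega>))"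
    using i[of cos] i[of sin] by simp_all
  have E: "(w * u) *\<^sub>R iexp x = complex_of_real (w * cos x * u) + \<i> * complex_of_real (w * sin x * u)" for w u x :: real
    by (simp add: complex_eq_iff Re_exp Im_exp)
  show ?thesis
    unfolding E
    by (subst (1 2) Bochner_Integration.integral_add)
      (simp_all only: ic si integral_mult_right_zero integral_complex_of_real c s
        integrable_mult_right integrable_of_real)
qed

text \<open>The set L interpolates between the two descriptions of a joint law: L = {} is the
  hypothesis on characters, L = K the equality of the probabilities of boxes.\<close>

lemma char_indicator_family:
  fixes X :: "'i \<Rightarrow> 'a \<Rightarrow> real" and Y :: "'i \<Rightarrow> 'b \<Rightarrow> real"
  assumes M: "prob_space M" and N: "prob_space N" and "finite K"
    and X: "\<And>k. k \<in> K \<Longrightarrow> X k \<in> borel_measurable M" and Y: "\<And>k. k \<in> K \<Longrightarrow> Y k \<in> borel_measurable N"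
    and eq: "\<And>c. (CLINT \<omega>|M. iexp (\<Sum>k\<in>K. c k * X k \<omega>)) = (CLINT \<omega>|N. iexp (\<Sum>k\<in>K. c k * Y k \<omega>))"
    and A: "\<And>k. k \<in> K \<Longrightarrow> A k \<in> sets borel"
    and "L \<subseteq> K"
  shows "(CLINT \<omega>|M. (\<Prod>k\<in>L. indicator (A k) (X k \<omega>)) *\<^sub>R iexp (\<Sum>k\<in>K - L. c k * X k \<omega>)) =
         (CLINT \<omega>|N. (\<Prod>k\<in>L. indicator (A k) (Y k \<omega>)) *\<^sub>R iexp (\<Sum>k\<in>K - L. c k * Y k \<omega>))"
proof -
  have "finite L" using \<open>finite K\<close> \<open>L \<subseteq> K\<close> by (rule rev_finite_subset)
  then show ?thesis using \<open>L \<subseteq> K\<close>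
  proof (induction L arbitrary: c rule: finite_induct)
    case empty
    then show ?case by (simp add: eq del: of_real_sum)
  next
    case (insert j L)
    then have j: "j \<in> K" "j \<notin> L" and L: "L \<subseteq> K" by auto
    have [measurable]: "X j \<in> borel_measurable M" "Y j \<in> borel_measurable N"
      using X Y j by auto
    let ?R = "K - insert j L"
    have KL: "K - L = insert j ?R" "j \<notin> ?R" using j by auto
    have meas: "(\<lambda>\<omega>. \<Prod>k\<in>L. indicator (A k) (X k \<omega>) :: real) \<in> borel_measurable M"
       "(\<lambda>\<omega>. \<Prod>k\<in>L. indicator (A k) (Y k \<omega>) :: real) \<in> borel_measurable N"
       "(\<lambda>\<omega>. \<Sum>k\<in>?R. c k * X k \<omega>) \<in> borel_measurable M"
       "(\<lambda>\<omega>. \<Sum>k\<in>?R. c k * Y k \<omega>) \<in> borel_measurable N"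
      using X Y A L
      by (auto intro!: borel_measurable_prod borel_measurable_sum borel_measurable_times
           measurable_compose[OF _ borel_measurable_indicator])
    have "(CLINT \<omega>|M. ((\<Prod>k\<in>L. indicator (A k) (X k \<omega>)) * indicator (A j) (X j \<omega>)) *\<^sub>R iexp (\<Sum>k\<in>?R. c k * X k \<omega>)) =
       (CLINT \<omega>|N. ((\<Prod>k\<in>L. indicator (A k) (Y k \<omega>)) * indicator (A j) (Y j \<omega>)) *\<^sub>R iexp (\<Sum>k\<in>?R. c k * Y k \<omega>))"
    proof (rule weighted_char_indicator[OF M N])
      fix s t :: real
      \<comment> \<open>The induction hypothesis holds for all coefficient families; the one needed
        scales the remaining coefficients by s and gives coordinate j the coefficient t.\<close>
      have sum_eq: "s * (\<Sum>k\<in>?R. c k * f k) + t * f j = (\<Sum>k\<in>K - L. ((\<lambda>k. s * c k)(j := t)) k * f k)" for f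
      proof -
        have "(\<Sum>k\<in>K - L. ((\<lambda>k. s * c k)(j := t)) k * f k) = t * f j + (\<Sum>k\<in>?R. ((\<lambda>k. s * c k)(j := t)) k * f k)"
          unfolding KL(1) using KL(2) \<open>finite K\<close> by (subst sum.insert) auto
        also have "(\<Sum>k\<in>?R. ((\<lambda>k. s * c k)(j := t)) k * f k) = s * (\<Sum>k\<in>?R. c k * f k)"
          unfolding sum_distrib_left using KL(2) by (intro sum.cong) (auto simp: mult.assoc)
        finally show ?thesis by simp
      qed
      show "(CLINT \<omega>|M. (\<Prod>k\<in>L. indicator (A k) (X k \<omega>)) *\<^sub>R iexp (s * (\<Sum>k\<in>?R. c k * X k \<omega>) + t * X j \<omega>)) =
         (CLINT \<omega>|N. (\<Prod>k\<in>L. indicator (A k) (Y k \<omega>)) *\<^sub>R iexp (s * (\<Sum>k\<in>?R. c k * Y k \<omega>) + t * Y j \<omega>))"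
        using insert.IH[OF L, of "(\<lambda>k. s * c k)(j := t)"]
        by (simp only: sum_eq[of "\<lambda>k. X k _"] sum_eq[of "\<lambda>k. Y k _"])
    qed (use A j meas in \<open>auto intro!: prod_nonneg prod_le_1\<close>)
    moreover have "(\<Prod>k\<in>insert j L. f k) = (\<Prod>k\<in>L. f k) * f j" for f :: "'i \<Rightarrow> real"
      using insert.hyps by (simp add: mult.commute)
    ultimately show ?case by (simp only:)
  qed
qed

text \<open>The Cramer--Wold device.\<close>

lemma distr_PiM_eq_of_char:
  fixes X :: "'i \<Rightarrow> 'a \<Rightarrow> real" and Y :: "'i \<Rightarrow> 'b \<Rightarrow> real"
  assumes M: "prob_space M" and N: "prob_space N" and K: "finite K"
    and X: "\<And>k. k \<in> K \<Longrightarrow> X k \<in> borel_measurable M" and Y: "\<And>k. k \<in> K \<Longrightarrow> Y k \<in> borel_measurable N"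
    and eq: "\<And>c. (CLINT \<omega>|M. iexp (\<Sum>k\<in>K. c k * X k \<omega>)) = (CLINT \<omega>|N. iexp (\<Sum>k\<in>K. c k * Y k \<omega>))"
  shows "distr M (PiM K (\<lambda>_. borel)) (\<lambda>\<omega>. \<lambda>k\<in>K. X k \<omega>) = distr N (PiM K (\<lambda>_. borel)) (\<lambda>\<omega>. \<lambda>k\<in>K. Y k \<omega>)"
    (is "?P = ?Q")
proof (rule measure_eqI_PiM_finite[where I = K and M = "\<lambda>_. borel" and A = "\<lambda>_::nat. space (PiM K (\<lambda>_. borel))"])
  interpret M: prob_space M by fact
  interpret N: prob_space N by fact
  have mX[measurable]: "(\<lambda>\<omega>. \<lambda>k\<in>K. X k \<omega>) \<in> measurable M (PiM K (\<lambda>_. borel))"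
    using X by (intro measurable_restrict) auto
  have mY[measurable]: "(\<lambda>\<omega>. \<lambda>k\<in>K. Y k \<omega>) \<in> measurable N (PiM K (\<lambda>_. borel))"
    using Y by (intro measurable_restrict) auto
  show "range (\<lambda>_::nat. space (PiM K (\<lambda>_. borel))) \<subseteq> prod_algebra K (\<lambda>_. borel :: real measure)"
    using K by (auto simp: space_PiM intro!: prod_algebraI_finite)
  show "?P (Pi\<^sub>E K A) = ?Q (Pi\<^sub>E K A)" if A: "\<And>i. i \<in> K \<Longrightarrow> A i \<in> sets (borel :: real measure)" for A
  proof -
    have box: "Pi\<^sub>E K A \<in> sets (PiM K (\<lambda>_. borel))"
      using A K by (intro sets_PiM_I_finite)
    have "(CLINT \<omega>|M. complex_of_real (\<Prod>k\<in>K. indicator (A k) (X k \<omega>))) =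
       (CLINT \<omega>|N. complex_of_real (\<Prod>k\<in>K. indicator (A k) (Y k \<omega>)))"
      using char_indicator_family[OF M N K X Y eq A subset_refl, where c = "\<lambda>_. 0"]
      by (simp add: scaleR_conv_of_real)
    then have 1: "(\<integral>\<omega>. (\<Prod>k\<in>K. indicat_real (A k) (X k \<omega>)) \<partial>M) = (\<integral>\<omega>. (\<Prod>k\<in>K. indicat_real (A k) (Y k \<omega>)) \<partial>N)"
      by (simp only: integral_complex_of_real of_real_eq_iff)
    have ind: "(\<Prod>k\<in>K. indicator (A k) (f k)) = (indicator (Pi\<^sub>E K A) (\<lambda>k\<in>K. f k) :: real)" for f
      using K by (auto simp: indicator_def PiE_iff Pi_iff)
    have "measure ?P (Pi\<^sub>E K A) = measure ?Q (Pi\<^sub>E K A)"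
    proof -
      have "measure ?P (Pi\<^sub>E K A) = (\<integral>\<omega>. indicat_real (Pi\<^sub>E K A) (\<lambda>k\<in>K. X k \<omega>) \<partial>M)"
        using box by (subst integral_distr[OF mX, symmetric]) auto
      moreover have "measure ?Q (Pi\<^sub>E K A) = (\<integral>\<omega>. indicat_real (Pi\<^sub>E K A) (\<lambda>k\<in>K. Y k \<omega>) \<partial>N)"
        using box by (subst integral_distr[OF mY, symmetric]) auto
      ultimately show ?thesis using 1 unfolding ind by simp
    qed
    then show ?thesis
      by (simp add: finite_measure.emeasure_eq_measure prob_space.finite_measure M.prob_space_distr N.prob_space_distr)
  qed
  show "?P (space (PiM K (\<lambda>_. borel))) \<noteq> \<infinity>" for i :: nat
    using prob_space.emeasure_space_1[OF M.prob_space_distr[OF mX]] by simp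
qed (use K in auto)

section \<open>Moments of power sums of Gaussian vectors\<close>

text \<open>With the nonnegative integral on the right, the even moment may be infinite. The
  inequality serves twice: to replace a mean by an independent copy, and to pull the power under the
  integral along the rotation.\<close>

lemma (in prob_space) nn_jensen_even_power:
  assumes X: "integrable M X"
  shows "ennreal (expectation X ^ (2 * r)) \<le> (\<integral>\<^sup>+\<omega>. ennreal (X \<omega> ^ (2 * r)) \<partial>M)"
proof (cases "(\<integral>\<^sup>+\<omega>. ennreal (X \<omega> ^ (2 * r)) \<partial>M) = \<infinity>")
  case False
  have [measurable]: "X \<in> borel_measurable M" using X by auto
  have int: "integrable M (\<lambda>\<omega>. X \<omega> ^ (2 * r))"
    using False by (intro integrableI_nonneg) (auto simp: zero_le_even_power top.not_eq_extremum)
  have "expectation X ^ (2 * r) \<le> expectation (\<lambda>\<omega>. X \<omega> ^ (2 * r))"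
    by (rule jensens_inequality[where I = UNIV and q = "\<lambda>x. x ^ (2 * r)"])
      (use X int convex_power_even[of "2 * r"] in auto)
  then show ?thesis
    using int by (subst nn_integral_eq_integral) (auto simp: zero_le_even_power)
qed simp

lemma convex_on_power_nonneg: "convex_on {0::real..} (\<lambda>x. x ^ n)"
  using convex_power_odd[of n] convex_power_even[of n] convex_on_subset[of UNIV _ "{0..}"]
  by (cases "even n") auto

text \<open>Jensen's inequality for the uniform weights on K, multiplied out. It is the source of
  the factor \<open>real (card K) ^ (r - 1)\<close> in the moment bound.\<close>

lemma power_sum_le:
  fixes f :: "'i \<Rightarrow> real"
  assumes "finite K" "0 < r" "\<And>k. k \<in> K \<Longrightarrow> 0 \<le> f k"
  shows "(\<Sum>k\<in>K. f k) ^ r \<le> real (card K) ^ (r - 1) * (\<Sum>k\<in>K. f k ^ r)"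
proof (cases "K = {}")
  case True then show ?thesis using \<open>0 < r\<close> by (simp add: zero_power)
next
  case False
  then have c: "0 < real (card K)" using assms by (simp add: card_gt_0_iff)
  have "(\<Sum>k\<in>K. (1 / real (card K)) *\<^sub>R f k) ^ r \<le> (\<Sum>k\<in>K. (1 / real (card K)) * f k ^ r)"
    by (rule convex_on_sum[OF _ _ convex_on_power_nonneg]) (use assms c False in auto)
  then have "(\<Sum>k\<in>K. f k) ^ r / real (card K) ^ r \<le> (\<Sum>k\<in>K. f k ^ r) / real (card K)"
    by (simp add: sum_distrib_left[symmetric] sum_divide_distrib[symmetric] power_divide)
  then have "(\<Sum>k\<in>K. f k) ^ r \<le> (\<Sum>k\<in>K. f k ^ r) / real (card K) * real (card K) ^ r"
    using c by (simp add: divide_le_eq)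
  also have "\<dots> = real (card K) ^ (r - 1) * (\<Sum>k\<in>K. f k ^ r)"
    using c \<open>0 < r\<close> by (simp add: power_eq_if)
  finally show ?thesis .
qed

lemma (in prob_space) integrable_mult_of_squares:
  fixes X Y :: "'a \<Rightarrow> real"
  assumes [measurable]: "X \<in> borel_measurable M" "Y \<in> borel_measurable M"
    and "integrable M (\<lambda>\<omega>. (X \<omega>)\<^sup>2)" "integrable M (\<lambda>\<omega>. (Y \<omega>)\<^sup>2)"
  shows "integrable M (\<lambda>\<omega>. X \<omega> * Y \<omega>)"
proof (rule Bochner_Integration.integrable_bound)
  show "integrable M (\<lambda>\<omega>. (X \<omega>)\<^sup>2 + (Y \<omega>)\<^sup>2)" using assms by auto
  have "\<bar>x * y\<bar> \<le> x\<^sup>2 + y\<^sup>2" for x y :: real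
  proof -
    have "0 \<le> (\<bar>x\<bar> - \<bar>y\<bar>)\<^sup>2" by simp
    then have "2 * (\<bar>x\<bar> * \<bar>y\<bar>) \<le> x\<^sup>2 + y\<^sup>2" by (simp add: power2_diff)
    moreover have "0 \<le> \<bar>x\<bar> * \<bar>y\<bar>" by simp
    ultimately show ?thesis unfolding abs_mult by linarith
  qed
  then show "AE \<omega> in M. norm (X \<omega> * Y \<omega>) \<le> norm ((X \<omega>)\<^sup>2 + (Y \<omega>)\<^sup>2)" by simp
qed simp

text \<open>Schur's test for the covariance matrix.\<close>

lemma (in prob_space) expectation_square_sum_le:
  fixes X :: "'i \<Rightarrow> 'a \<Rightarrow> real"
  assumes "finite K" and X: "\<And>k. k \<in> K \<Longrightarrow> X k \<in> borel_measurable M"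
    "\<And>k. k \<in> K \<Longrightarrow> integrable M (\<lambda>\<omega>. (X k \<omega>)\<^sup>2)"
    and R: "\<And>j. j \<in> K \<Longrightarrow> (\<Sum>k\<in>K. \<bar>expectation (\<lambda>\<omega>. X j \<omega> * X k \<omega>)\<bar>) \<le> R"
  shows "expectation (\<lambda>\<omega>. (\<Sum>k\<in>K. a k * X k \<omega>)\<^sup>2) \<le> R * (\<Sum>k\<in>K. (a k)\<^sup>2)"
proof -
  let ?S = "\<lambda>j k. expectation (\<lambda>\<omega>. X j \<omega> * X k \<omega>)"
  have int: "integrable M (\<lambda>\<omega>. X j \<omega> * X k \<omega>)" if "j \<in> K" "k \<in> K" for j k
    using that X by (intro integrable_mult_of_squares) auto
  have "(\<Sum>k\<in>K. a k * X k \<omega>)\<^sup>2 = (\<Sum>j\<in>K. \<Sum>k\<in>K. a j * a k * (X j \<omega> * X k \<omega>))" for \<omega>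
    unfolding power2_eq_square sum_product by (intro sum.cong refl) (simp only: ac_simps)
  then have "expectation (\<lambda>\<omega>. (\<Sum>k\<in>K. a k * X k \<omega>)\<^sup>2) = (\<Sum>j\<in>K. \<Sum>k\<in>K. a j * a k * ?S j k)"
    using int by (simp add: Bochner_Integration.integral_sum)
  \<comment> \<open>The inequality of arithmetic and geometric means shares each term between row j
    and row k; once the order of summation is exchanged, both halves are weighted row sums.\<close>
  also have "\<dots> \<le> (\<Sum>j\<in>K. \<Sum>k\<in>K. (a j)\<^sup>2 / 2 * \<bar>?S j k\<bar> + (a k)\<^sup>2 / 2 * \<bar>?S k j\<bar>)"
  proof (intro sum_mono)
    fix j k
    have sym: "?S j k = ?S k j" by (simp only: mult.commute)
    have "a j * a k * ?S j k \<le> \<bar>a j * a k\<bar> * \<bar>?S j k\<bar>"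
      by (metis abs_ge_self abs_mult)
    also have "\<dots> \<le> ((a j)\<^sup>2 / 2 + (a k)\<^sup>2 / 2) * \<bar>?S j k\<bar>"
    proof (rule mult_right_mono)
      have "0 \<le> (\<bar>a j\<bar> - \<bar>a k\<bar>)\<^sup>2" by simp
      then show "\<bar>a j * a k\<bar> \<le> (a j)\<^sup>2 / 2 + (a k)\<^sup>2 / 2"
        by (simp add: power2_diff abs_mult)
    qed simp
    finally show "a j * a k * ?S j k \<le> (a j)\<^sup>2 / 2 * \<bar>?S j k\<bar> + (a k)\<^sup>2 / 2 * \<bar>?S k j\<bar>"
      using sym by (simp add: distrib_right)
  qed
  also have "\<dots> = (\<Sum>j\<in>K. \<Sum>k\<in>K. (a j)\<^sup>2 / 2 * \<bar>?S j k\<bar>) + (\<Sum>j\<in>K. \<Sum>k\<in>K. (a k)\<^sup>2 / 2 * \<bar>?S k j\<bar>)"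
    by (simp add: sum.distrib)
  also have "(\<Sum>j\<in>K. \<Sum>k\<in>K. (a k)\<^sup>2 / 2 * \<bar>?S k j\<bar>) = (\<Sum>j\<in>K. \<Sum>k\<in>K. (a j)\<^sup>2 / 2 * \<bar>?S j k\<bar>)"
    by (rule sum.swap)
  also have "(\<Sum>j\<in>K. \<Sum>k\<in>K. (a j)\<^sup>2 / 2 * \<bar>?S j k\<bar>) + (\<Sum>j\<in>K. \<Sum>k\<in>K. (a j)\<^sup>2 / 2 * \<bar>?S j k\<bar>)
      = (\<Sum>j\<in>K. (a j)\<^sup>2 * (\<Sum>k\<in>K. \<bar>?S j k\<bar>))"
    by (simp add: sum_distrib_left sum.distrib[symmetric])
  also have "\<dots> \<le> (\<Sum>j\<in>K. (a j)\<^sup>2 * R)"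
    by (intro sum_mono mult_left_mono R) auto
  also have "\<dots> = R * (\<Sum>k\<in>K. (a k)\<^sup>2)"
    by (simp add: sum_distrib_left mult.commute)
  finally show ?thesis .
qed

section \<open>Rotation of two independent copies of a Gaussian vector\<close>

lemma gaussian_process_on_sum:
  assumes "gaussian_process_on M K X" "finite K"
  shows "gaussian_rv M (\<lambda>\<omega>. \<Sum>k\<in>K. c k * X k \<omega>)"
  using assms(1)[unfolded gaussian_process_on_def, rule_format, of K c] assms(2) by simp

lemma gaussian_process_on_coord:
  assumes "gaussian_process_on M K X" "k \<in> K"
  shows "gaussian_rv M (X k)"
proof -
  have "gaussian_rv M (\<lambda>\<omega>. \<Sum>t\<in>{k}. (\<lambda>_. 1) t * X t \<omega>)"
    using assms(1)[unfolded gaussian_process_on_def, rule_format, of "{k}" "\<lambda>_. 1"] assms(2) by simp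
  then show ?thesis by simp
qed

text \<open>The two coordinates of \<open>M \<Otimes>\<^sub>M M\<close> provide the independent copies. The flag in the index set
  \<open>UNIV \<times> K\<close> separates position and velocity of the rotation.\<close>

lemma (in prob_space) gaussian_rotation:
  fixes X :: "'i \<Rightarrow> 'a \<Rightarrow> real"
  assumes K: "finite K" and G: "gaussian_process_on M K X"
    and mean: "\<And>k. k \<in> K \<Longrightarrow> expectation (X k) = 0"
    and sc: "s\<^sup>2 + c\<^sup>2 = (1::real)"
  shows "distr (M \<Otimes>\<^sub>M M) (PiM (UNIV \<times> K) (\<lambda>_. borel)) (\<lambda>w. \<lambda>i\<in>UNIV \<times> K.
           if fst i then s * X (snd i) (fst w) + c * X (snd i) (snd w)
           else c * X (snd i) (fst w) - s * X (snd i) (snd w)) =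
         distr (M \<Otimes>\<^sub>M M) (PiM (UNIV \<times> K) (\<lambda>_. borel)) (\<lambda>w. \<lambda>i\<in>UNIV \<times> K.
           if fst i then X (snd i) (fst w) else X (snd i) (snd w))"
proof -
  interpret P: pair_prob_space M M ..
  have PM: "prob_space (M \<Otimes>\<^sub>M M)" by (rule P.prob_space_axioms)
  have X: "X k \<in> borel_measurable M" if "k \<in> K" for k
    using gaussian_process_on_coord[OF G that] by (simp add: gaussian_rv_def)
  have X12: "(\<lambda>w. X k (fst w)) \<in> borel_measurable (M \<Otimes>\<^sub>M M)"
      "(\<lambda>w. X k (snd w)) \<in> borel_measurable (M \<Otimes>\<^sub>M M)" if "k \<in> K" for k
    using measurable_compose[OF measurable_fst X[OF that]] measurable_compose[OF measurable_snd X[OF that]] .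
  have lin0: "expectation (\<lambda>\<omega>. \<Sum>k\<in>K. a k * X k \<omega>) = 0" for a
    using mean integrable_gaussian_rv_power[OF gaussian_process_on_coord[OF G], of _ 1]
    by (subst Bochner_Integration.integral_sum) auto
  define L where "L a \<omega> = (\<Sum>k\<in>K. a k * X k \<omega>)" for a \<omega>
  have L[measurable]: "L a \<in> borel_measurable M" for a
    unfolding L_def using X by (intro borel_measurable_sum borel_measurable_times) auto
  have GL: "gaussian_rv M (L a)" "expectation (L a) = 0" for a
    using gaussian_process_on_sum[OF G K] lin0 unfolding L_def by auto
  have sq: "integrable M (\<lambda>\<omega>. (L a \<omega>)\<^sup>2)" for a
    by (rule integrable_gaussian_rv_power[OF GL(1)])
  \<comment> \<open>By independence of the two coordinates, the character of a linear form in both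
    depends only on the sum of the two variances.\<close>
  have char2: "(CLINT w|M \<Otimes>\<^sub>M M. iexp (L a (fst w) + L b (snd w))) =
      exp (- complex_of_real (expectation (\<lambda>\<omega>. (L a \<omega>)\<^sup>2 + (L b \<omega>)\<^sup>2)) / 2)" for a b
  proof -
    have "(CLINT w|M \<Otimes>\<^sub>M M. iexp (L a (fst w) + L b (snd w))) =
        (CLINT x|M. (CLINT y|M. iexp (L a x + L b y)))"
      by (subst P.integral_fst'[symmetric]) (auto intro!: P.integrable_const_bound[where B = 1])
    also have "\<dots> = (CLINT x|M. iexp (L a x) * (CLINT y|M. iexp (L b y)))"
      by (simp add: distrib_left exp_add)
    also have "\<dots> = (CLINT x|M. iexp (L a x)) * (CLINT y|M. iexp (L b y))"
      by simp
    also have "\<dots> = exp (- complex_of_real (expectation (\<lambda>\<omega>. (L a \<omega>)\<^sup>2 + (L b \<omega>)\<^sup>2)) / 2)"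
      unfolding gaussian_rv_char[OF GL] exp_add[symmetric]
      by (simp add: Bochner_Integration.integral_add[OF sq sq] add_divide_distrib diff_divide_distrib)
    finally show ?thesis .
  qed
  show ?thesis
  proof (rule distr_PiM_eq_of_char[OF PM PM])
    fix d :: "bool \<times> 'i \<Rightarrow> real"
    define a where "a k = d (True, k)" for k
    define b where "b k = d (False, k)" for k
    have split: "(\<Sum>i\<in>UNIV \<times> K. d i * (if fst i then f (snd i) else g (snd i))) =
        (\<Sum>k\<in>K. a k * f k) + (\<Sum>k\<in>K. b k * g k)" for f g :: "'i \<Rightarrow> real"
    proof -
      have "(\<Sum>i\<in>UNIV \<times> K. d i * (if fst i then f (snd i) else g (snd i))) =
        (\<Sum>v\<in>UNIV. \<Sum>k\<in>K. d (v, k) * (if v then f k else g k))"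
        by (subst sum.cartesian_product) (auto intro!: sum.cong)
      then show ?thesis by (simp add: UNIV_bool a_def b_def)
    qed
    have 1: "(\<Sum>i\<in>UNIV \<times> K. d i * (if fst i then s * X (snd i) x + c * X (snd i) y
           else c * X (snd i) x - s * X (snd i) y)) =
        L (\<lambda>k. s * a k + c * b k) x + L (\<lambda>k. c * a k - s * b k) y" for x y
      unfolding split[of "\<lambda>k. s * X k x + c * X k y" "\<lambda>k. c * X k x - s * X k y"] L_def
      by (simp add: algebra_simps sum.distrib sum_subtractf)
    have 2: "(\<Sum>i\<in>UNIV \<times> K. d i * (if fst i then X (snd i) x else X (snd i) y)) = L a x + L b y" for x y
      unfolding split[of "\<lambda>k. X k x" "\<lambda>k. X k y"] L_def ..
    have lin: "L (\<lambda>k. u * a k + v * b k) x = u * L a x + v * L b x"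
        "L (\<lambda>k. u * a k - v * b k) x = u * L a x - v * L b x" for u v x
      unfolding L_def by (simp_all add: algebra_simps sum.distrib sum_subtractf sum_distrib_left)
    \<comment> \<open>The rotation acts on the pair of coefficient families (a, b) by an orthogonal
      matrix, and it preserves the sum of the two squares pointwise. The covariance matrix never has
      to be written down.\<close>
    have "(s * A + c * B)\<^sup>2 + (c * A - s * B)\<^sup>2 = (s\<^sup>2 + c\<^sup>2) * (A\<^sup>2 + B\<^sup>2)" for A B :: real
      by algebra
    then have "(L (\<lambda>k. s * a k + c * b k) \<omega>)\<^sup>2 + (L (\<lambda>k. c * a k - s * b k) \<omega>)\<^sup>2 = (L a \<omega>)\<^sup>2 + (L b \<omega>)\<^sup>2" for \<omega>
      unfolding lin using sc by simp
    then show "(CLINT w|M \<Otimes>\<^sub>M M. iexp (\<Sum>i\<in>UNIV \<times> K. d i * (if fst i then s * X (snd i) (fst w) + c * X (snd i) (snd w)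
           else c * X (snd i) (fst w) - s * X (snd i) (snd w)))) =
       (CLINT w|M \<Otimes>\<^sub>M M. iexp (\<Sum>i\<in>UNIV \<times> K. d i * (if fst i then X (snd i) (fst w) else X (snd i) (snd w))))"
      unfolding 1 2 char2 by simp
  qed (use K X in \<open>auto intro!: borel_measurable_add borel_measurable_diff borel_measurable_times X12\<close>)
qed

text \<open>The one functional of the joint law that is needed: a weight depending on the position,
  linear in the velocity. The right-hand side does not involve the angle.\<close>

lemma (in prob_space) gaussian_rotation_nn_integral:
  fixes X :: "'i \<Rightarrow> 'a \<Rightarrow> real"
  assumes K: "finite K" and G: "gaussian_process_on M K X"
    and mean: "\<And>k. k \<in> K \<Longrightarrow> expectation (X k) = 0"
    and sc: "s\<^sup>2 + c\<^sup>2 = (1::real)" and h[measurable]: "h \<in> borel_measurable borel"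
    and g[measurable]: "g \<in> borel_measurable borel"
  shows "(\<integral>\<^sup>+w. g (\<Sum>k\<in>K. h (s * X k (fst w) + c * X k (snd w)) * (c * X k (fst w) - s * X k (snd w))) \<partial>(M \<Otimes>\<^sub>M M)) =
    (\<integral>\<^sup>+w. g (\<Sum>k\<in>K. h (X k (fst w)) * X k (snd w)) \<partial>(M \<Otimes>\<^sub>M M))"
proof -
  have X: "X k \<in> borel_measurable M" if "k \<in> K" for k
    using gaussian_process_on_coord[OF G that] by (simp add: gaussian_rv_def)
  have X12: "(\<lambda>w. X k (fst w)) \<in> borel_measurable (M \<Otimes>\<^sub>M M)"
      "(\<lambda>w. X k (snd w)) \<in> borel_measurable (M \<Otimes>\<^sub>M M)" if "k \<in> K" for k
    using measurable_compose[OF measurable_fst X[OF that]] measurable_compose[OF measurable_snd X[OF that]] .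
  define F where "F z = g (\<Sum>k\<in>K. h (z (True, k)) * z (False, k))" for z :: "bool \<times> 'i \<Rightarrow> real"
  have F: "F \<in> borel_measurable (PiM (UNIV \<times> K) (\<lambda>_. borel))"
    unfolding F_def
    by (intro measurable_compose[OF _ g] borel_measurable_sum borel_measurable_times
       measurable_compose[OF _ h]) auto
  let ?Z = "\<lambda>w. \<lambda>i\<in>UNIV \<times> K.
           if fst i then s * X (snd i) (fst w) + c * X (snd i) (snd w)
           else c * X (snd i) (fst w) - s * X (snd i) (snd w)"
  let ?Y = "\<lambda>w. \<lambda>i\<in>UNIV \<times> K. if fst i then X (snd i) (fst w) else X (snd i) (snd w)"
  have Z: "?Z \<in> measurable (M \<Otimes>\<^sub>M M) (PiM (UNIV \<times> K) (\<lambda>_. borel))"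
    using X by (intro measurable_restrict) (auto intro!: borel_measurable_add borel_measurable_diff borel_measurable_times X12)
  have Y: "?Y \<in> measurable (M \<Otimes>\<^sub>M M) (PiM (UNIV \<times> K) (\<lambda>_. borel))"
    using X by (intro measurable_restrict) (auto intro!: X12)
  have "(\<integral>\<^sup>+w. F (?Z w) \<partial>(M \<Otimes>\<^sub>M M)) = (\<integral>\<^sup>+w. F (?Y w) \<partial>(M \<Otimes>\<^sub>M M))"
    using gaussian_rotation[OF K G mean sc] nn_integral_distr[OF Z, of F] nn_integral_distr[OF Y, of F] F by simp
  then show ?thesis by (simp add: F_def)
qed

text \<open>Written with positive and negative parts, the odd power is visibly continuous at 0 for a
  positive exponent.\<close>

lemma sgn_powr_eq:
  "sgn x * \<bar>x\<bar> powr a = max x 0 powr a - max (- x) 0 powr a" for x a :: real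
  by (cases x "0 :: real" rule: linorder_cases) (auto simp: max_def)

lemma isCont_sgn_powr:
  assumes "0 < a"
  shows "isCont (\<lambda>x::real. sgn x * \<bar>x\<bar> powr a) x"
proof -
  have "continuous_on UNIV (\<lambda>x::real. max x 0 powr a - max (- x) 0 powr a)"
    using assms by (intro continuous_intros continuous_on_powr') auto
  then show ?thesis
    unfolding sgn_powr_eq by (simp add: continuous_on_eq_continuous_at)
qed

lemma has_real_derivative_abs_powr:
  assumes "1 < p"
  shows "((\<lambda>x. \<bar>x\<bar> powr p) has_real_derivative p * (sgn x * \<bar>x\<bar> powr (p - 1))) (at x)"
proof (cases x "0 :: real" rule: linorder_cases)
  case less
  have "((\<lambda>x. (- x) powr p) has_real_derivative p * (sgn x * \<bar>x\<bar> powr (p - 1))) (at x)"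
    using less by (auto intro!: derivative_eq_intros)
  then show ?thesis
    by (rule has_field_derivative_transform_within_open[where S = "{..<0}"]) (use less in auto)
next
  case equal
  \<comment> \<open>At the origin the difference quotient is sgn h |h|^(p - 1), which tends to 0
    because p > 1.\<close>
  have "((\<lambda>h. sgn h * \<bar>h\<bar> powr (p - 1)) \<longlongrightarrow> sgn 0 * \<bar>0\<bar> powr (p - 1)) (at (0::real))"
    using isCont_sgn_powr[of "p - 1" 0] assms unfolding isCont_def by simp
  moreover have "\<forall>\<^sub>F h in at (0::real). sgn h * \<bar>h\<bar> powr (p - 1) = (\<bar>0 + h\<bar> powr p - \<bar>0\<bar> powr p) / h"
  proof -
    have "sgn h * \<bar>h\<bar> powr (p - 1) = (\<bar>0 + h\<bar> powr p - \<bar>0\<bar> powr p) / h" if "h \<noteq> 0" for h :: real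
      using that assms by (cases "h > 0") (auto simp: powr_diff sgn_if)
    then show ?thesis by (simp add: eventually_at_filter)
  qed
  ultimately show ?thesis
    unfolding DERIV_def equal by (simp add: Lim_transform_eventually)
next
  case greater
  have "((\<lambda>x. x powr p) has_real_derivative p * (sgn x * \<bar>x\<bar> powr (p - 1))) (at x)"
    using greater by (auto intro!: derivative_eq_intros)
  then show ?thesis
    by (rule has_field_derivative_transform_within_open[where S = "{0<..}"]) (use greater in auto)
qed

text \<open>\<open>y\<close> is joined to \<open>x\<close> by the arc \<open>sin \<theta> x + cos \<theta> y\<close>, whose velocity is the rotated copy
  \<open>cos \<theta> x - sin \<theta> y\<close>.\<close>

lemma power_sum_diff_le_arc_integral:
  fixes x y :: "'i \<Rightarrow> real"
  assumes p: "1 < p"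
  shows "ennreal (((\<Sum>k\<in>K. \<bar>x k\<bar> powr p) - (\<Sum>k\<in>K. \<bar>y k\<bar> powr p)) ^ (2 * r)) \<le>
    (\<integral>\<^sup>+u. ennreal ((pi / 2 * p * (\<Sum>k\<in>K.
        (\<lambda>z. sgn z * \<bar>z\<bar> powr (p - 1)) (sin (pi / 2 * u) * x k + cos (pi / 2 * u) * y k) *
        (cos (pi / 2 * u) * x k - sin (pi / 2 * u) * y k))) ^ (2 * r)) \<partial>restrict_space lborel {0..1})"
proof -
  let ?h = "\<lambda>z::real. sgn z * \<bar>z\<bar> powr (p - 1)"
  let ?s = "\<lambda>u. sin (pi / 2 * u)" and ?c = "\<lambda>u. cos (pi / 2 * u)"
  \<comment> \<open>The quarter turn is parametrized by the unit interval, so that the parameter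
    carries a probability measure and Jensen's inequality applies. The price is the speed pi /
    2.\<close>
  interpret U: prob_space "restrict_space lborel {0..1::real}"
    by (rule prob_space_restrict_space) auto
  define F where "F u = (\<Sum>k\<in>K. \<bar>?s u * x k + ?c u * y k\<bar> powr p)" for u
  define f where "f u = pi / 2 * p * (\<Sum>k\<in>K. ?h (?s u * x k + ?c u * y k) * (?c u * x k - ?s u * y k))" for u
  have deriv: "DERIV F u :> f u" for u
  proof -
    have "((\<lambda>u. ?s u * x k + ?c u * y k) has_real_derivative pi / 2 * (?c u * x k - ?s u * y k)) (at u)" for k
      by (auto intro!: derivative_eq_intros simp: algebra_simps)
    then have "((\<lambda>u. \<bar>?s u * x k + ?c u * y k\<bar> powr p) has_real_derivative
       p * ?h (?s u * x k + ?c u * y k) * (pi / 2 * (?c u * x k - ?s u * y k))) (at u)" for k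
      by (rule DERIV_chain2[OF has_real_derivative_abs_powr[OF p]])
    then have "DERIV F u :> (\<Sum>k\<in>K. p * ?h (?s u * x k + ?c u * y k) * (pi / 2 * (?c u * x k - ?s u * y k)))"
      unfolding F_def by (rule DERIV_sum)
    then show ?thesis
      unfolding f_def sum_distrib_left by (simp add: mult.assoc mult.left_commute)
  qed
  have cont: "isCont f u" for u
  proof -
    have "isCont (\<lambda>u. ?s u * x k + ?c u * y k) u" for k
      by (intro continuous_intros)
    then have ch: "isCont (\<lambda>u. ?h (?s u * x k + ?c u * y k)) u" for k
      by (rule isCont_o2[OF _ isCont_sgn_powr]) (use p in simp)
    have v: "isCont (\<lambda>u. ?c u * x k - ?s u * y k) u" for k
      by (intro continuous_intros)
    show ?thesis
      unfolding f_def by (rule continuous_mult_left, rule continuous_sum, rule continuous_mult[OF ch v])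
  qed
  have FTC: "has_bochner_integral lborel (\<lambda>u. f u * indicator {0..1} u) (F 1 - F 0)"
    by (rule has_bochner_integral_FTC_Icc_real) (use deriv cont in auto)
  have int: "integrable (restrict_space lborel {0..1}) f"
    using FTC by (auto simp: integrable_restrict_space has_bochner_integral_iff set_integrable_def mult.commute)
  have "U.expectation f = F 1 - F 0"
    using FTC by (simp add: integral_restrict_space set_lebesgue_integral_def has_bochner_integral_iff mult.commute)
  moreover have "F 1 = (\<Sum>k\<in>K. \<bar>x k\<bar> powr p)" "F 0 = (\<Sum>k\<in>K. \<bar>y k\<bar> powr p)"
    by (simp_all add: F_def)
  ultimately have "ennreal (((\<Sum>k\<in>K. \<bar>x k\<bar> powr p) - (\<Sum>k\<in>K. \<bar>y k\<bar> powr p)) ^ (2 * r)) \<le>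
      (\<integral>\<^sup>+u. ennreal (f u ^ (2 * r)) \<partial>restrict_space lborel {0..1})"
    using U.nn_jensen_even_power[OF int, of r] by simp
  then show ?thesis unfolding f_def .
qed

lemma std_normal_nn_integral_even_power:
  "(\<integral>\<^sup>+z. ennreal (z ^ (2 * r)) \<partial>std_normal_distribution) = ennreal (normal_abs_moment (real (2 * r)))"
  if "0 < r"
proof -
  have "z ^ (2 * r) = \<bar>z\<bar> powr real (2 * r)" for z :: real
    using that by (cases "z = 0") (simp_all only: abs_0 powr_realpow zero_less_abs_iff power_even_abs even_mult_iff dvd_refl
       simp_thms, auto)
  then show ?thesis
    unfolding normal_abs_moment_def
    by (subst nn_integral_eq_integral[symmetric]) (auto intro!: integrable_std_normal_abs_powr)
qed

text \<open>Maurey and Pisier's argument: compare with an independent copy along the rotation that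
  exchanges the two. Conditionally on the position, the velocity is a centred Gaussian.\<close>

theorem (in prob_space) gaussian_power_sum_moment:
  fixes X :: "'i \<Rightarrow> 'a \<Rightarrow> real"
  assumes K: "finite K" and G: "gaussian_process_on M K X"
    and mean: "\<And>k. k \<in> K \<Longrightarrow> expectation (X k) = 0"
    and R: "\<And>j. j \<in> K \<Longrightarrow> (\<Sum>k\<in>K. \<bar>expectation (\<lambda>\<omega>. X j \<omega> * X k \<omega>)\<bar>) \<le> R" "0 \<le> R"
    and p: "1 < p" and r: "0 < r"
  shows "(\<integral>\<^sup>+\<omega>. ennreal (((\<Sum>k\<in>K. \<bar>X k \<omega>\<bar> powr p) - (\<Sum>k\<in>K. expectation (\<lambda>\<omega>. \<bar>X k \<omega>\<bar> powr p))) ^ (2 * r)) \<partial>M)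
    \<le> ennreal ((pi / 2 * p) ^ (2 * r) * normal_abs_moment (real (2 * r)) * R ^ r * real (card K) ^ (r - 1) *
        (\<Sum>k\<in>K. expectation (\<lambda>\<omega>. \<bar>X k \<omega>\<bar> powr (real (2 * r) * (p - 1)))))"
proof -
  interpret P: pair_prob_space M M ..
  interpret U: prob_space "restrict_space lborel {0..1::real}"
    by (rule prob_space_restrict_space) auto
  interpret PU: pair_sigma_finite "M \<Otimes>\<^sub>M M" "restrict_space lborel {0..1::real}" ..
  let ?h = "\<lambda>z::real. sgn z * \<bar>z\<bar> powr (p - 1)"
  let ?s = "\<lambda>u. sin (pi / 2 * u)" and ?c = "\<lambda>u. cos (pi / 2 * u)"
  let ?C = "pi / 2 * p" and ?m = "normal_abs_moment (real (2 * r))"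
  note Gk = gaussian_process_on_coord[OF G]
  have X: "X k \<in> borel_measurable M" if "k \<in> K" for k
    using Gk[OF that] by (simp add: gaussian_rv_def)
  have X1: "(\<lambda>w. X k (fst w)) \<in> borel_measurable (M \<Otimes>\<^sub>M N)" if "k \<in> K" for k and N :: "'c measure"
    using measurable_compose[OF measurable_fst X[OF that]] .
  have X2: "(\<lambda>w. X k (snd w)) \<in> borel_measurable (N \<Otimes>\<^sub>M M)" if "k \<in> K" for k and N :: "'c measure"
    using measurable_compose[OF measurable_snd X[OF that]] .
  have h[measurable]: "?h \<in> borel_measurable borel" by measurable
  define V where "V \<omega> = (\<Sum>k\<in>K. \<bar>X k \<omega>\<bar> powr p)" for \<omega>
  have V[measurable]: "V \<in> borel_measurable M"
    unfolding V_def using X by (intro borel_measurable_sum measurable_compose[OF X]) auto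
  have intV: "integrable M V"
    unfolding V_def using p by (intro Bochner_Integration.integrable_sum gaussian_rv_abs_powr Gk mean) auto
  have EV: "expectation V = (\<Sum>k\<in>K. expectation (\<lambda>\<omega>. \<bar>X k \<omega>\<bar> powr p))"
    unfolding V_def using p by (intro Bochner_Integration.integral_sum gaussian_rv_abs_powr Gk mean) auto
  define D where "D w u = ?C * (\<Sum>k\<in>K. ?h (?s u * X k (fst w) + ?c u * X k (snd w)) *
        (?c u * X k (fst w) - ?s u * X k (snd w)))" for w u
  have D: "(\<lambda>(w, u). ennreal (D w u ^ (2 * r))) \<in> borel_measurable ((M \<Otimes>\<^sub>M M) \<Otimes>\<^sub>M restrict_space lborel {0..1})"
  proof -
    have A: "(\<lambda>z. X k (fst (fst z))) \<in> borel_measurable ((M \<Otimes>\<^sub>M M) \<Otimes>\<^sub>M restrict_space lborel {0..1::real})"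
       "(\<lambda>z. X k (snd (fst z))) \<in> borel_measurable ((M \<Otimes>\<^sub>M M) \<Otimes>\<^sub>M restrict_space lborel {0..1::real})" if "k \<in> K" for k
      using measurable_compose[OF measurable_fst X1[OF that, of M]] measurable_compose[OF measurable_fst X2[OF that, of M]] .
    have "(\<lambda>z. snd z) \<in> borel_measurable ((M \<Otimes>\<^sub>M M) \<Otimes>\<^sub>M restrict_space lborel {0..1::real})"
      by (rule measurable_compose[OF measurable_snd]) (simp add: measurable_restrict_space1)
    then have B: "(\<lambda>z. ?s (snd z)) \<in> borel_measurable ((M \<Otimes>\<^sub>M M) \<Otimes>\<^sub>M restrict_space lborel {0..1::real})"
       "(\<lambda>z. ?c (snd z)) \<in> borel_measurable ((M \<Otimes>\<^sub>M M) \<Otimes>\<^sub>M restrict_space lborel {0..1::real})"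
      by auto
    show ?thesis
      unfolding D_def split_beta
      by (intro measurable_compose[OF _ measurable_ennreal] borel_measurable_power borel_measurable_times borel_measurable_sum
           borel_measurable_const measurable_compose[OF _ h] borel_measurable_add borel_measurable_diff A B)
  qed
  have "(\<integral>\<^sup>+\<omega>. ennreal ((V \<omega> - expectation V) ^ (2 * r)) \<partial>M) \<le>
      (\<integral>\<^sup>+\<omega>. \<integral>\<^sup>+\<omega>'. ennreal ((V \<omega> - V \<omega>') ^ (2 * r)) \<partial>M \<partial>M)"
  proof (rule nn_integral_mono)
    fix \<omega>
    \<comment> \<open>Jensen's inequality is applied in the second copy with the first one
      fixed.\<close>
    have E: "expectation (\<lambda>\<omega>'. V \<omega> - V \<omega>') = V \<omega> - expectation V"
      using intV by (simp add: Bochner_Integration.integral_diff prob_space)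
    then show "ennreal ((V \<omega> - expectation V) ^ (2 * r)) \<le> (\<integral>\<^sup>+\<omega>'. ennreal ((V \<omega> - V \<omega>') ^ (2 * r)) \<partial>M)"
      using nn_jensen_even_power[of "\<lambda>\<omega>'. V \<omega> - V \<omega>'" r] intV unfolding E by simp
  qed
  also have "\<dots> = (\<integral>\<^sup>+w. ennreal ((V (fst w) - V (snd w)) ^ (2 * r)) \<partial>(M \<Otimes>\<^sub>M M))"
    by (subst nn_integral_fst[symmetric]) auto
  also have "\<dots> \<le> (\<integral>\<^sup>+w. \<integral>\<^sup>+u. ennreal (D w u ^ (2 * r)) \<partial>restrict_space lborel {0..1} \<partial>(M \<Otimes>\<^sub>M M))"
    unfolding V_def D_def by (intro nn_integral_mono power_sum_diff_le_arc_integral p)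
  also have "\<dots> = (\<integral>\<^sup>+u. \<integral>\<^sup>+w. ennreal (D w u ^ (2 * r)) \<partial>(M \<Otimes>\<^sub>M M) \<partial>restrict_space lborel {0..1})"
    by (rule PU.Fubini'[OF D, symmetric])
  \<comment> \<open>For each angle, position and velocity are distributed like two independent
    copies, so the inner integral is the same for all u.\<close>
  also have "\<dots> = (\<integral>\<^sup>+u. \<integral>\<^sup>+w. ennreal ((?C * (\<Sum>k\<in>K. ?h (X k (fst w)) * X k (snd w))) ^ (2 * r)) \<partial>(M \<Otimes>\<^sub>M M)
      \<partial>restrict_space lborel {0..1::real})"
    unfolding D_def
    by (intro nn_integral_cong gaussian_rotation_nn_integral[OF K G mean _ h, where g = "\<lambda>z. ennreal ((?C * z) ^ (2 * r))"])
      auto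
  also have "\<dots> = (\<integral>\<^sup>+w. ennreal ((?C * (\<Sum>k\<in>K. ?h (X k (fst w)) * X k (snd w))) ^ (2 * r)) \<partial>(M \<Otimes>\<^sub>M M))"
    using U.emeasure_space_1 by simp
  also have "\<dots> = (\<integral>\<^sup>+x. \<integral>\<^sup>+y. ennreal ((?C * (\<Sum>k\<in>K. ?h (X k x) * X k y)) ^ (2 * r)) \<partial>M \<partial>M)"
  proof (subst nn_integral_fst[symmetric])
    show "(\<lambda>w. ennreal ((?C * (\<Sum>k\<in>K. ?h (X k (fst w)) * X k (snd w))) ^ (2 * r))) \<in> borel_measurable (M \<Otimes>\<^sub>M M)"
      by (intro measurable_compose[OF _ measurable_ennreal] borel_measurable_power borel_measurable_times borel_measurable_sum
           borel_measurable_const measurable_compose[OF _ h] X1 X2)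
  qed simp
  also have "\<dots> \<le> (\<integral>\<^sup>+x. ennreal (?C ^ (2 * r) * ?m * R ^ r * real (card K) ^ (r - 1)) *
      (\<Sum>k\<in>K. ennreal (\<bar>X k x\<bar> powr (real (2 * r) * (p - 1)))) \<partial>M)"
  proof (rule nn_integral_mono)
    fix x
    \<comment> \<open>Once the position x is fixed, the velocity enters linearly with these
      coefficients, and the sum is a centred normal variable of variance \<open>?v\<close>.\<close>
    let ?a = "\<lambda>k. ?h (X k x)"
    let ?v = "expectation (\<lambda>y. (\<Sum>k\<in>K. ?a k * X k y)\<^sup>2)"
    have "expectation (\<lambda>y. \<Sum>k\<in>K. ?a k * X k y) = 0"
      using mean integrable_gaussian_rv_power[OF Gk, of _ 1]
      by (subst Bochner_Integration.integral_sum) auto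
    note gv = gaussian_process_on_sum[OF G K, of ?a] this
    have "(\<integral>\<^sup>+y. ennreal ((?C * (\<Sum>k\<in>K. ?a k * X k y)) ^ (2 * r)) \<partial>M) =
       (\<integral>\<^sup>+z. ennreal ((?C * (sqrt ?v * z)) ^ (2 * r)) \<partial>std_normal_distribution)"
      by (rule gaussian_rv_nn_integral[OF gv, of "\<lambda>z. ennreal ((?C * z) ^ (2 * r))"]) simp
    also have "\<dots> = (\<integral>\<^sup>+z. ennreal (?C ^ (2 * r) * ?v ^ r) * ennreal (z ^ (2 * r)) \<partial>std_normal_distribution)"
    proof (intro nn_integral_cong)
      fix z :: real
      have "(c * (sqrt v * z)) ^ (2 * r) = (c ^ (2 * r) * v ^ r) * z ^ (2 * r)" if "0 \<le> v" for c v :: real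
        using that by (simp add: power_mult_distrib power_mult)
      moreover have "0 \<le> ?v" by simp
      ultimately have "(?C * (sqrt ?v * z)) ^ (2 * r) = (?C ^ (2 * r) * ?v ^ r) * z ^ (2 * r)"
        by blast
      then show "ennreal ((?C * (sqrt ?v * z)) ^ (2 * r)) = ennreal (?C ^ (2 * r) * ?v ^ r) * ennreal (z ^ (2 * r))"
        using p by (simp only:) (rule ennreal_mult, auto simp: zero_le_even_power)
    qed
    also have "\<dots> = ennreal (?C ^ (2 * r) * ?v ^ r * ?m)"
    proof -
      have v: "0 \<le> ?C ^ (2 * r) * ?v ^ r" using p by (intro mult_nonneg_nonneg zero_le_power) auto
      have "(\<integral>\<^sup>+z. ennreal (?C ^ (2 * r) * ?v ^ r) * ennreal (z ^ (2 * r)) \<partial>std_normal_distribution) =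
          ennreal (?C ^ (2 * r) * ?v ^ r) * (\<integral>\<^sup>+z. ennreal (z ^ (2 * r)) \<partial>std_normal_distribution)"
        by (rule nn_integral_cmult) simp
      then show ?thesis
        by (simp only: std_normal_nn_integral_even_power[OF r] ennreal_mult[OF v normal_abs_moment_nonneg])
    qed
    also have "\<dots> \<le> ennreal (?C ^ (2 * r) * (R ^ r * (real (card K) ^ (r - 1) * (\<Sum>k\<in>K. \<bar>X k x\<bar> powr (real (2 * r) * (p - 1))))) * ?m)"
    proof (intro ennreal_leI mult_mono order_refl)
      have sq: "((?a k)\<^sup>2) ^ r = \<bar>X k x\<bar> powr (real (2 * r) * (p - 1))" for k
      proof (cases "X k x = 0")
        case False
        then have "\<bar>X k x\<bar> powr (real (2 * r) * (p - 1)) = (\<bar>X k x\<bar> powr (p - 1)) ^ (2 * r)"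
          by (subst powr_realpow[symmetric]) (auto simp: powr_powr mult.commute)
        then show ?thesis using False by (simp add: power_mult power_mult_distrib sgn_if)
      qed (use r in \<open>simp add: zero_power\<close>)
      \<comment> \<open>Schur's test bounds the conditional variance by R times the sum of the
        squared coefficients; \<open>power_sum_le\<close> then opens the r-th power of that
        sum.\<close>
      have "?v \<le> R * (\<Sum>k\<in>K. (?a k)\<^sup>2)"
        using expectation_square_sum_le[OF K X integrable_gaussian_rv_power[OF Gk] R(1)] by simp
      then have "?v ^ r \<le> (R * (\<Sum>k\<in>K. (?a k)\<^sup>2)) ^ r"
        by (intro power_mono) auto
      also have "\<dots> \<le> R ^ r * (real (card K) ^ (r - 1) * (\<Sum>k\<in>K. ((?a k)\<^sup>2) ^ r))"
        unfolding power_mult_distrib[of R]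
        using R K r by (intro mult_left_mono power_sum_le) auto
      also have "\<dots> = R ^ r * (real (card K) ^ (r - 1) * (\<Sum>k\<in>K. \<bar>X k x\<bar> powr (real (2 * r) * (p - 1))))"
        by (simp only: sq)
      finally show "?v ^ r \<le> R ^ r * (real (card K) ^ (r - 1) * (\<Sum>k\<in>K. \<bar>X k x\<bar> powr (real (2 * r) * (p - 1))))" .
    qed (use R p in \<open>auto intro!: normal_abs_moment_nonneg mult_nonneg_nonneg sum_nonneg\<close>)
    also have "\<dots> = ennreal (?C ^ (2 * r) * ?m * R ^ r * real (card K) ^ (r - 1)) *
      (\<Sum>k\<in>K. ennreal (\<bar>X k x\<bar> powr (real (2 * r) * (p - 1))))"
      using R p by (simp add: ennreal_mult[symmetric] normal_abs_moment_nonneg sum_nonneg ac_simps)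
    finally show "(\<integral>\<^sup>+y. ennreal ((?C * (\<Sum>k\<in>K. ?a k * X k y)) ^ (2 * r)) \<partial>M) \<le>
      ennreal (?C ^ (2 * r) * ?m * R ^ r * real (card K) ^ (r - 1)) *
      (\<Sum>k\<in>K. ennreal (\<bar>X k x\<bar> powr (real (2 * r) * (p - 1))))" .
  qed
  also have "\<dots> = ennreal (?C ^ (2 * r) * ?m * R ^ r * real (card K) ^ (r - 1)) *
      (\<Sum>k\<in>K. \<integral>\<^sup>+x. ennreal (\<bar>X k x\<bar> powr (real (2 * r) * (p - 1))) \<partial>M)"
  proof -
    have m: "(\<lambda>x. ennreal (\<bar>X k x\<bar> powr (real (2 * r) * (p - 1)))) \<in> borel_measurable M" if "k \<in> K" for k
      by (rule measurable_compose[OF X[OF that]]) simp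
    then show ?thesis
      by (subst nn_integral_cmult) (auto simp only: nn_integral_sum intro!: borel_measurable_sum)
  qed
  also have "\<dots> = ennreal (?C ^ (2 * r) * ?m * R ^ r * real (card K) ^ (r - 1) *
        (\<Sum>k\<in>K. expectation (\<lambda>\<omega>. \<bar>X k \<omega>\<bar> powr (real (2 * r) * (p - 1)))))"
  proof -
    have "(\<integral>\<^sup>+x. ennreal (\<bar>X k x\<bar> powr (real (2 * r) * (p - 1))) \<partial>M) =
      ennreal (expectation (\<lambda>\<omega>. \<bar>X k \<omega>\<bar> powr (real (2 * r) * (p - 1))))" if "k \<in> K" for k
      using gaussian_rv_abs_powr(2)[OF Gk[OF that] mean[OF that], of "real (2 * r) * (p - 1)"] p
      by (intro nn_integral_eq_integral) auto
    then have "(\<Sum>k\<in>K. \<integral>\<^sup>+x. ennreal (\<bar>X k x\<bar> powr (real (2 * r) * (p - 1))) \<partial>M) =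
      ennreal (\<Sum>k\<in>K. expectation (\<lambda>\<omega>. \<bar>X k \<omega>\<bar> powr (real (2 * r) * (p - 1))))"
      by simp
    then show ?thesis
      using R p by (simp add: ennreal_mult[symmetric] normal_abs_moment_nonneg sum_nonneg)
  qed
  finally show ?thesis by (simp only: EV V_def)
qed

section \<open>Increments of fractional Brownian motion\<close>

text \<open>For \<alpha> = 2 H the difference of the two sides is, up to sign, twice the covariance
  of increments over intervals of lengths x and z separated by a gap y. Its sign is the monotonicity
  of \<open>?g\<close>, whose derivative has the sign of \<alpha> - 1 or vanishes. Derivatives are
  taken in the open interval only, because y may be 0.\<close>

lemma powr_second_difference_sign:
  fixes \<alpha> x y z :: real
  assumes "0 \<le> x" "0 \<le> y" "0 \<le> z" "0 < \<alpha>"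
  shows "1 \<le> \<alpha> \<Longrightarrow> (x + y) powr \<alpha> + (y + z) powr \<alpha> \<le> (x + y + z) powr \<alpha> + y powr \<alpha>"
    and "\<alpha> \<le> 1 \<Longrightarrow> (x + y + z) powr \<alpha> + y powr \<alpha> \<le> (x + y) powr \<alpha> + (y + z) powr \<alpha>"
proof -
  let ?g = "\<lambda>u. (u + z) powr \<alpha> - u powr \<alpha>"
  have deriv: "(?g has_real_derivative \<alpha> * ((u + z) powr (\<alpha> - 1) - u powr (\<alpha> - 1))) (at u)" if "0 < u" for u
    using that assms by (auto intro!: derivative_eq_intros simp: algebra_simps)
  have cont: "continuous_on {y..x + y} ?g"
    using assms by (intro continuous_intros continuous_on_powr') auto
  show "(x + y) powr \<alpha> + (y + z) powr \<alpha> \<le> (x + y + z) powr \<alpha> + y powr \<alpha>" if "1 \<le> \<alpha>"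
  proof -
    have "?g y \<le> ?g (x + y)"
    proof (rule DERIV_nonneg_imp_increasing_open[where f = ?g and a = y and b = "x + y"])
      show "\<exists>D. (?g has_real_derivative D) (at u) \<and> 0 \<le> D" if "y < u" "u < x + y" for u
        by (intro exI conjI, rule deriv) (use that assms \<open>1 \<le> \<alpha>\<close> in \<open>auto intro!: mult_nonneg_nonneg powr_mono2\<close>)
    qed (use assms cont in auto)
    then show ?thesis by (simp add: add_ac)
  qed
  show "(x + y + z) powr \<alpha> + y powr \<alpha> \<le> (x + y) powr \<alpha> + (y + z) powr \<alpha>" if "\<alpha> \<le> 1"
  proof -
    have "?g (x + y) \<le> ?g y"
    proof (rule DERIV_nonpos_imp_decreasing_open[where f = ?g and a = y and b = "x + y"])
      show "\<exists>D. (?g has_real_derivative D) (at u) \<and> D \<le> 0" if "y < u" "u < x + y" for u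
        by (intro exI conjI, rule deriv) (use that assms \<open>\<alpha> \<le> 1\<close> in \<open>auto intro!: mult_nonneg_nonpos powr_mono2'\<close>)
    qed (use assms cont in auto)
    then show ?thesis by (simp add: add_ac)
  qed
qed

lemma (in prob_space) expectation_mult_square_le:
  fixes X Y :: "'a \<Rightarrow> real"
  assumes [measurable]: "X \<in> borel_measurable M" "Y \<in> borel_measurable M"
    and X2: "integrable M (\<lambda>\<omega>. (X \<omega>)\<^sup>2)" and Y2: "integrable M (\<lambda>\<omega>. (Y \<omega>)\<^sup>2)"
  shows "(expectation (\<lambda>\<omega>. X \<omega> * Y \<omega>))\<^sup>2 \<le> expectation (\<lambda>\<omega>. (X \<omega>)\<^sup>2) * expectation (\<lambda>\<omega>. (Y \<omega>)\<^sup>2)"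
proof -
  define a b c where "a = expectation (\<lambda>\<omega>. (X \<omega>)\<^sup>2)" and "b = expectation (\<lambda>\<omega>. (Y \<omega>)\<^sup>2)"
    and "c = expectation (\<lambda>\<omega>. X \<omega> * Y \<omega>)"
  note XY = integrable_mult_of_squares[OF assms]
  have quad: "0 \<le> t\<^sup>2 * a - 2 * t * c + b" for t
  proof -
    have "0 \<le> expectation (\<lambda>\<omega>. (t * X \<omega> - Y \<omega>)\<^sup>2)" by simp
    also have "(\<lambda>\<omega>. (t * X \<omega> - Y \<omega>)\<^sup>2) = (\<lambda>\<omega>. t\<^sup>2 * (X \<omega>)\<^sup>2 - 2 * t * (X \<omega> * Y \<omega>) + (Y \<omega>)\<^sup>2)"
      by (intro ext) (simp add: power2_eq_square algebra_simps)
    also have "expectation \<dots> = t\<^sup>2 * a - 2 * t * c + b"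
      using X2 Y2 XY by (simp add: a_def b_def c_def Bochner_Integration.integral_add Bochner_Integration.integral_diff)
    finally show ?thesis .
  qed
  have "0 \<le> a" by (simp add: a_def)
  then consider "a = 0" | "0 < a" by linarith
  then have "c\<^sup>2 \<le> a * b"
  proof cases
    case 1
    have "c = 0"
    proof (rule ccontr)
      assume "c \<noteq> 0"
      \<comment> \<open>Without the quadratic term the parabola is the line b - 2 t c, which takes
        the value -1 at this t.\<close>
      then show False using quad[of "(b + 1) / (2 * c)"] 1 by simp
    qed
    then show ?thesis using 1 by simp
  next
    case 2
    \<comment> \<open>The parabola is evaluated at its minimum.\<close>
    then show ?thesis using quad[of "c / a"] by (simp add: field_simps power2_eq_square)
  qed
  then show ?thesis by (simp add: a_def b_def c_def)
qed

locale fbm = prob_space M for M :: "'a measure" +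
  fixes B :: "real \<Rightarrow> 'a \<Rightarrow> real" and T H :: real
  assumes fbm: "fractional_brownian_motion_on M T H B"
    and T: "0 < T" and H: "0 < H" "H < 1"
begin

section \<open>Law and covariance of the increments\<close>

lemma gaussian: "gaussian_process_on M {0..T} B"
  and mean: "t \<in> {0..T} \<Longrightarrow> expectation (B t) = 0"
  and cont: "\<omega> \<in> space M \<Longrightarrow> continuous_on {0..T} (\<lambda>t. B t \<omega>)"
  and variogram: "s \<in> {0..T} \<Longrightarrow> t \<in> {0..T} \<Longrightarrow> expectation (\<lambda>\<omega>. (B t \<omega> - B s \<omega>)\<^sup>2) = \<bar>t - s\<bar> powr (2 * H)"
  using fbm unfolding fractional_brownian_motion_on_def by auto

lemma gaussian_B: "t \<in> {0..T} \<Longrightarrow> gaussian_rv M (B t)"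
  by (rule gaussian_process_on_coord[OF gaussian])

lemma borel_B: "t \<in> {0..T} \<Longrightarrow> B t \<in> borel_measurable M"
  using gaussian_B by (simp add: gaussian_rv_def)

lemma integrable_B: "t \<in> {0..T} \<Longrightarrow> integrable M (B t)"
  using integrable_gaussian_rv_power[OF gaussian_B, of t 1] by simp

lemma integrable_B2: "s \<in> {0..T} \<Longrightarrow> t \<in> {0..T} \<Longrightarrow> integrable M (\<lambda>\<omega>. B s \<omega> * B t \<omega>)"
  using integrable_gaussian_rv_power[OF gaussian_B, of _ 2]
  by (intro integrable_mult_of_squares) (auto intro: borel_B)

lemma integrable_increment_sq:
  assumes "s \<in> {0..T}" "t \<in> {0..T}"
  shows "integrable M (\<lambda>\<omega>. (B t \<omega> - B s \<omega>)\<^sup>2)"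
proof -
  have "(B t \<omega> - B s \<omega>)\<^sup>2 = B t \<omega> * B t \<omega> + B s \<omega> * B s \<omega> - 2 * (B t \<omega> * B s \<omega>)" for \<omega>
    by (simp add: power2_eq_square algebra_simps)
  then show ?thesis
    using assms by (simp only:) (intro Bochner_Integration.integrable_diff Bochner_Integration.integrable_add
       integrable_mult_right integrable_B2)
qed

text \<open>A Gaussian process is defined through sums over sets of times, whereas clamped grid
  points repeat. Grouping the coefficients by time bridges the gap.\<close>

lemma gaussian_sum:
  assumes "finite I" "\<And>i. i \<in> I \<Longrightarrow> v i \<in> {0..T}"
  shows "gaussian_rv M (\<lambda>\<omega>. \<Sum>i\<in>I. c i * B (v i) \<omega>)"
proof -
  have "(\<Sum>i\<in>I. c i * B (v i) \<omega>) = (\<Sum>t\<in>v ` I. (\<Sum>i\<in>{i\<in>I. v i = t}. c i) * B t \<omega>)" for \<omega>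
  proof -
    have "(\<Sum>i\<in>I. c i * B (v i) \<omega>) = (\<Sum>t\<in>v ` I. \<Sum>i\<in>{i\<in>I. v i = t}. c i * B (v i) \<omega>)"
      by (rule sum.image_gen[OF assms(1)])
    also have "\<dots> = (\<Sum>t\<in>v ` I. (\<Sum>i\<in>{i\<in>I. v i = t}. c i) * B t \<omega>)"
      unfolding sum_distrib_right by (intro sum.cong) auto
    finally show ?thesis .
  qed
  moreover have "gaussian_rv M (\<lambda>\<omega>. \<Sum>t\<in>v ` I. (\<Sum>i\<in>{i\<in>I. v i = t}. c i) * B t \<omega>)"
    using gaussian[unfolded gaussian_process_on_def, rule_format, of "v ` I" "\<lambda>t. \<Sum>i\<in>{i\<in>I. v i = t}. c i"] assms
    by (auto simp: image_subset_iff)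
  ultimately show ?thesis by simp
qed

lemma gaussian_increments:
  assumes "\<And>i. v i \<in> {0..T}"
  shows "gaussian_process_on M UNIV (\<lambda>k::nat. \<lambda>\<omega>. B (v (Suc k)) \<omega> - B (v k) \<omega>)"
  unfolding gaussian_process_on_def
proof (intro allI impI)
  fix J :: "nat set" and c :: "nat \<Rightarrow> real" assume J: "finite J \<and> J \<subseteq> UNIV"
  \<comment> \<open>An increment is a linear form in two values of the process; the flag tells its
    right end from its left end.\<close>
  define w where "w i = v (if fst i then Suc (snd i) else snd i)" for i :: "bool \<times> nat"
  define d where "d i = (if fst i then c (snd i) else - c (snd i))" for i :: "bool \<times> nat"
  have "gaussian_rv M (\<lambda>\<omega>. \<Sum>i\<in>UNIV \<times> J. d i * B (w i) \<omega>)"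
    using J assms by (intro gaussian_sum) (auto simp: w_def)
  moreover have "(\<Sum>i\<in>UNIV \<times> J. d i * B (w i) \<omega>) = (\<Sum>k\<in>J. c k * (B (v (Suc k)) \<omega> - B (v k) \<omega>))" for \<omega>
  proof -
    have "(\<Sum>i\<in>UNIV \<times> J. d i * B (w i) \<omega>) = (\<Sum>b\<in>UNIV. \<Sum>k\<in>J. d (b, k) * B (w (b, k)) \<omega>)"
      by (subst sum.cartesian_product) (auto intro!: sum.cong)
    then show ?thesis
      by (simp add: UNIV_bool d_def w_def sum_negf algebra_simps sum_subtractf)
  qed
  ultimately show "gaussian_rv M (\<lambda>\<omega>. \<Sum>k\<in>J. c k * (B (v (Suc k)) \<omega> - B (v k) \<omega>))"
    by simp
qed

text \<open>Polarization: twice the product of two increments is a signed sum of four squared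
  increments, so the variogram suffices.\<close>

lemma increment_covariance:
  assumes "a \<in> {0..T}" "b \<in> {0..T}" "c \<in> {0..T}" "d \<in> {0..T}"
  shows "expectation (\<lambda>\<omega>. (B b \<omega> - B a \<omega>) * (B d \<omega> - B c \<omega>)) =
    (\<bar>d - a\<bar> powr (2 * H) + \<bar>c - b\<bar> powr (2 * H) - \<bar>d - b\<bar> powr (2 * H) - \<bar>c - a\<bar> powr (2 * H)) / 2"
proof -
  note sq = integrable_increment_sq
  have "(B b \<omega> - B a \<omega>) * (B d \<omega> - B c \<omega>) =
      ((B d \<omega> - B a \<omega>)\<^sup>2 + (B c \<omega> - B b \<omega>)\<^sup>2 - (B d \<omega> - B b \<omega>)\<^sup>2 - (B c \<omega> - B a \<omega>)\<^sup>2) / 2" for \<omega>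
    by (simp add: power2_eq_square field_simps)
  then have "expectation (\<lambda>\<omega>. (B b \<omega> - B a \<omega>) * (B d \<omega> - B c \<omega>)) = 
    expectation (\<lambda>\<omega>. (B d \<omega> - B a \<omega>)\<^sup>2 + (B c \<omega> - B b \<omega>)\<^sup>2 - (B d \<omega> - B b \<omega>)\<^sup>2 - (B c \<omega> - B a \<omega>)\<^sup>2) / 2"
    by (simp only: integral_divide_zero)
  also have "\<dots> = (\<bar>d - a\<bar> powr (2 * H) + \<bar>c - b\<bar> powr (2 * H) - \<bar>d - b\<bar> powr (2 * H) - \<bar>c - a\<bar> powr (2 * H)) / 2"
    using assms by (simp add: Bochner_Integration.integral_add Bochner_Integration.integral_diff
        Bochner_Integration.integrable_add Bochner_Integration.integrable_diff sq variogram)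
  finally show ?thesis .
qed

lemma disjoint_increments_covariance_sign:
  assumes "0 \<le> a" "a \<le> b" "b \<le> c" "c \<le> d" "d \<le> T"
  shows "0 \<le> (2 * H - 1) * expectation (\<lambda>\<omega>. (B b \<omega> - B a \<omega>) * (B d \<omega> - B c \<omega>))"
proof -
  have "expectation (\<lambda>\<omega>. (B b \<omega> - B a \<omega>) * (B d \<omega> - B c \<omega>)) =
    ((d - a) powr (2 * H) + (c - b) powr (2 * H) - (d - b) powr (2 * H) - (c - a) powr (2 * H)) / 2"
    using assms by (subst increment_covariance) auto
  moreover note powr_second_difference_sign[of "b - a" "c - b" "d - c" "2 * H"]
  ultimately show ?thesis
    using assms H by (cases "1 \<le> 2 * H") (auto intro!: mult_nonneg_nonneg mult_nonpos_nonpos)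
qed

text \<open>The increments over disjoint intervals have covariances of one sign, so the sum of their
  absolute values is the absolute value of a single covariance.\<close>

lemma increment_covariance_row_sum:
  assumes v: "\<And>i. v i \<in> {0..T}" "mono v" and j: "j < n" and gap: "\<And>i. v (Suc i) - v i \<le> l" and l: "l \<le> T"
  shows "(\<Sum>k<n. \<bar>expectation (\<lambda>\<omega>. (B (v (Suc j)) \<omega> - B (v j) \<omega>) * (B (v (Suc k)) \<omega> - B (v k) \<omega>))\<bar>)
    \<le> 3 * T powr H * l powr H"
proof -
  let ?X = "\<lambda>k \<omega>. B (v (Suc k)) \<omega> - B (v k) \<omega>"
  let ?S = "\<lambda>k. expectation (\<lambda>\<omega>. ?X j \<omega> * ?X k \<omega>)"
  \<comment> \<open>The common sign of the covariances off the diagonal. For 2 H = 1 these vanish,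
    and either sign would do.\<close>
  define \<sigma> where "\<sigma> = (if 1 \<le> 2 * H then 1 else - 1 :: real)"
  define \<delta> where "\<delta> = v (Suc j) - v j"
  have \<delta>: "0 \<le> \<delta>" "\<delta> \<le> l" "\<delta> \<le> T"
    using gap[of j] l monoD[OF v(2), of j "Suc j"] by (auto simp: \<delta>_def)
  have mono: "v i \<le> v k" if "i \<le> k" for i k using monoD[OF v(2) that] .
  have pos: "0 \<le> \<sigma> * ?S k" if "k \<noteq> j" for k
  proof -
    have "0 \<le> (2 * H - 1) * ?S k"
    proof (cases "j < k")
      case True
      then show ?thesis
        using v(1)[of j] v(1)[of "Suc k"] by (intro disjoint_increments_covariance_sign) (auto intro: mono)
    next
      case False
      then have "0 \<le> (2 * H - 1) * expectation (\<lambda>\<omega>. ?X k \<omega> * ?X j \<omega>)"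
        using that v(1)[of k] v(1)[of "Suc j"] by (intro disjoint_increments_covariance_sign) (auto intro: mono)
      then show ?thesis by (simp only: mult.commute)
    qed
    \<comment> \<open>For 2 H = 1 the factor 2 H - 1 is zero and the sign lemma says nothing. There
      the four terms of the covariance are linear and cancel.\<close>
    moreover have "?S k = 0" if "2 * H = 1"
    proof -
      have "v (Suc k) \<le> v j \<or> v (Suc j) \<le> v k"
        using \<open>k \<noteq> j\<close> by (cases "j < k") (auto intro: mono)
      moreover have "v k \<le> v (Suc k)" "v j \<le> v (Suc j)" by (auto intro: mono)
      ultimately show ?thesis
        using that by (subst increment_covariance[OF v(1) v(1) v(1) v(1)]) auto
    qed
    ultimately show ?thesis
      by (auto simp: \<sigma>_def zero_le_mult_iff split: if_splits)
  qed
  have intX: "integrable M (\<lambda>\<omega>. ?X j \<omega> * ?X k \<omega>)" for k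
  proof -
    have "?X j \<omega> * ?X k \<omega> = (B (v (Suc j)) \<omega> * B (v (Suc k)) \<omega> - B (v (Suc j)) \<omega> * B (v k) \<omega>)
        - (B (v j) \<omega> * B (v (Suc k)) \<omega> - B (v j) \<omega> * B (v k) \<omega>)" for \<omega>
      by (simp add: algebra_simps)
    then show ?thesis
      by (simp only:) (intro Bochner_Integration.integrable_diff integrable_B2 v(1))
  qed
  have Sjj: "?S j = \<delta> powr (2 * H)"
    using variogram[OF v(1) v(1), of "Suc j" j] \<delta> by (simp add: power2_eq_square \<delta>_def)
  \<comment> \<open>The signed row sum telescopes to the covariance with the increment from
    \<open>v 0\<close> to \<open>v n\<close>, to which the Cauchy--Schwarz inequality
    applies.\<close>
  have "(\<Sum>k<n. ?S k) = expectation (\<lambda>\<omega>. ?X j \<omega> * (B (v n) \<omega> - B (v 0) \<omega>))"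
    using intX by (subst Bochner_Integration.integral_sum[symmetric])
      (auto simp: sum_distrib_left[symmetric] sum_lessThan_telescope[of "\<lambda>i. B (v i) _"])
  also have "\<bar>\<dots>\<bar> \<le> \<delta> powr H * T powr H"
  proof -
    have vn: "\<bar>v n - v 0\<bar> \<le> T" using v(1)[of n] v(1)[of 0] by auto
    have int: "integrable M (\<lambda>\<omega>. (B t \<omega> - B s \<omega>)\<^sup>2)" if "s \<in> {0..T}" "t \<in> {0..T}" for s t
      by (rule integrable_increment_sq[OF that])
    have "(expectation (\<lambda>\<omega>. ?X j \<omega> * (B (v n) \<omega> - B (v 0) \<omega>)))\<^sup>2
        \<le> expectation (\<lambda>\<omega>. (?X j \<omega>)\<^sup>2) * expectation (\<lambda>\<omega>. (B (v n) \<omega> - B (v 0) \<omega>)\<^sup>2)"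
      by (intro expectation_mult_square_le int v(1) borel_measurable_diff borel_B)
    also have "\<dots> = \<delta> powr (2 * H) * \<bar>v n - v 0\<bar> powr (2 * H)"
      using \<delta>(1) by (simp add: variogram[OF v(1) v(1)] \<delta>_def)
    also have "\<dots> \<le> \<delta> powr (2 * H) * T powr (2 * H)"
      using vn H by (intro mult_left_mono powr_mono2) auto
    also have "\<dots> = (\<delta> powr H * T powr H)\<^sup>2"
      by (simp add: power2_eq_square powr_add[symmetric] mult_ac)
    finally show ?thesis
      by (rule abs_le_square_iff[THEN iffD2, THEN order_trans]) simp
  qed
  finally have total: "\<bar>\<Sum>k<n. ?S k\<bar> \<le> \<delta> powr H * T powr H" .
  have split: "(\<Sum>k<n. f k) = f j + (\<Sum>k\<in>{..<n} - {j}. f k)" for f :: "nat \<Rightarrow> real"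
    using j by (simp add: sum.remove)
  have "(\<Sum>k<n. \<bar>?S k\<bar>) = \<bar>?S j\<bar> + \<sigma> * (\<Sum>k\<in>{..<n} - {j}. ?S k)"
  proof -
    have "\<bar>?S k\<bar> = \<sigma> * ?S k" if "k \<noteq> j" for k
      using pos[OF that] by (auto simp: \<sigma>_def)
    then show ?thesis
      unfolding split[of "\<lambda>k. \<bar>?S k\<bar>"] sum_distrib_left by (intro arg_cong2[where f = "(+)"] sum.cong) auto
  qed
  also have "\<dots> = \<bar>?S j\<bar> + \<sigma> * ((\<Sum>k<n. ?S k) - ?S j)"
    unfolding split[of ?S] by simp
  \<comment> \<open>The variance on the diagonal counts twice: once as a term of the row, once
    because it is removed from the signed total. Together with the total this gives the constant
    3.\<close>
  also have "\<dots> \<le> 2 * \<delta> powr (2 * H) + \<delta> powr H * T powr H"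
  proof -
    have "\<sigma> * (x - y) \<le> \<bar>x\<bar> + \<bar>y\<bar>" for x y
      by (auto simp: \<sigma>_def)
    then have "\<sigma> * ((\<Sum>k<n. ?S k) - ?S j) \<le> \<bar>\<Sum>k<n. ?S k\<bar> + \<bar>?S j\<bar>" .
    moreover have "\<bar>?S j\<bar> = \<delta> powr (2 * H)" unfolding Sjj by simp
    ultimately show ?thesis using total by linarith
  qed
  also have "\<delta> powr (2 * H) \<le> \<delta> powr H * T powr H"
  proof -
    have "\<delta> powr (2 * H) = \<delta> powr H * \<delta> powr H" by (simp add: powr_add[symmetric])
    also have "\<dots> \<le> \<delta> powr H * T powr H"
      using \<delta> H by (intro mult_left_mono powr_mono2) auto
    finally show ?thesis .
  qed
  also have "2 * (\<delta> powr H * T powr H) + \<delta> powr H * T powr H = 3 * T powr H * \<delta> powr H" by simp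
  also have "\<dots> \<le> 3 * T powr H * l powr H"
    using \<delta> H by (intro mult_left_mono powr_mono2) auto
  finally show ?thesis by simp
qed

lemma increment_abs_powr:
  assumes "s \<in> {0..T}" "t \<in> {0..T}" "0 \<le> q"
  shows "(\<integral>\<^sup>+\<omega>. ennreal (\<bar>B t \<omega> - B s \<omega>\<bar> powr q) \<partial>M) = ennreal (\<bar>t - s\<bar> powr (H * q) * normal_abs_moment q)"
    and "expectation (\<lambda>\<omega>. \<bar>B t \<omega> - B s \<omega>\<bar> powr q) = \<bar>t - s\<bar> powr (H * q) * normal_abs_moment q"
proof -
  have G: "gaussian_rv M (\<lambda>\<omega>. B t \<omega> - B s \<omega>)"
    using gaussian_process_on_coord[OF gaussian_increments[of "\<lambda>i. if i = 0 then s else t"], of 0] assms by simp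
  have E: "expectation (\<lambda>\<omega>. B t \<omega> - B s \<omega>) = 0"
    using assms integrable_B mean by simp
  note gaussian_rv_abs_powr[OF G E assms(3)]
  then show "(\<integral>\<^sup>+\<omega>. ennreal (\<bar>B t \<omega> - B s \<omega>\<bar> powr q) \<partial>M) = ennreal (\<bar>t - s\<bar> powr (H * q) * normal_abs_moment q)"
    "expectation (\<lambda>\<omega>. \<bar>B t \<omega> - B s \<omega>\<bar> powr q) = \<bar>t - s\<bar> powr (H * q) * normal_abs_moment q"
    using assms by (simp_all add: variogram powr_powr)
qed

section \<open>Moments of the power variation along a monotone sequence\<close>

definition moment_const :: "nat \<Rightarrow> real" where
  "moment_const r = (pi / 2 * (1 / H)) ^ (2 * r) * normal_abs_moment (real (2 * r)) * (3 * T powr H) ^ r *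
     normal_abs_moment (real (2 * r) * (1 / H - 1))"

lemma moment_const_nonneg: "0 \<le> moment_const r"
  unfolding moment_const_def using H T by (intro mult_nonneg_nonneg normal_abs_moment_nonneg) auto

text \<open>With exponent 1 / H, the mean power of an increment is proportional to the length of its
  interval, so the means telescope exactly. In 2 - H, the part H comes from the row sums and the
  part 2 - 2 H from the absolute moments of order 2 r (1 / H - 1), each counted per unit of r. Only
  the gaps of the sequence matter, and points may repeat.\<close>

lemma power_variation_moment:
  assumes v: "\<And>i. v i \<in> {0..T}" "mono v" and gap: "\<And>i. v (Suc i) - v i \<le> l" and l: "0 < l" "l \<le> T"
    and r: "0 < r" and n: "0 < n"
  shows "(\<integral>\<^sup>+\<omega>. ennreal (((\<Sum>k<n. \<bar>B (v (Suc k)) \<omega> - B (v k) \<omega>\<bar> powr (1 / H)) -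
        normal_abs_moment (1 / H) * (v n - v 0)) ^ (2 * r)) \<partial>M)
    \<le> ennreal (moment_const r * (real n * l powr (2 - H)) ^ r)"
proof -
  let ?X = "\<lambda>k \<omega>. B (v (Suc k)) \<omega> - B (v k) \<omega>" and ?p = "1 / H" and ?q = "real (2 * r) * (1 / H - 1)"
  let ?R = "3 * T powr H * l powr H"
  have p: "1 < ?p" using H by simp
  have q: "0 \<le> ?q" using p by simp
  have mono: "v k \<le> v (Suc k)" for k using monoD[OF v(2)] by simp
  have G: "gaussian_process_on M {..<n} ?X"
    using gaussian_increments[of v, OF v(1)] unfolding gaussian_process_on_def by auto
  have mean_X: "expectation (?X k) = 0" for k
    using v(1) integrable_B mean by simp
  have Ep: "(\<Sum>k<n. expectation (\<lambda>\<omega>. \<bar>?X k \<omega>\<bar> powr ?p)) = normal_abs_moment ?p * (v n - v 0)"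
  proof -
    have "expectation (\<lambda>\<omega>. \<bar>?X k \<omega>\<bar> powr ?p) = (v (Suc k) - v k) * normal_abs_moment ?p" for k
      using p H mono[of k] by (subst increment_abs_powr(2)[OF v(1) v(1)]) auto
    then show ?thesis
      by (simp add: sum_distrib_right[symmetric] sum_lessThan_telescope)
  qed
  have Eq: "(\<Sum>k<n. expectation (\<lambda>\<omega>. \<bar>?X k \<omega>\<bar> powr ?q)) \<le> real n * (l powr (2 - 2 * H)) ^ r * normal_abs_moment ?q"
  proof -
    have "expectation (\<lambda>\<omega>. \<bar>?X k \<omega>\<bar> powr ?q) \<le> (l powr (2 - 2 * H)) ^ r * normal_abs_moment ?q" for k
    proof -
      have "expectation (\<lambda>\<omega>. \<bar>?X k \<omega>\<bar> powr ?q) = \<bar>v (Suc k) - v k\<bar> powr (H * ?q) * normal_abs_moment ?q"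
        by (rule increment_abs_powr(2)[OF v(1) v(1) q])
      also have "\<dots> \<le> l powr (H * ?q) * normal_abs_moment ?q"
        using mono[of k] gap[of k] H q by (intro mult_right_mono powr_mono2 normal_abs_moment_nonneg) auto
      also have "l powr (H * ?q) = (l powr (2 - 2 * H)) ^ r"
      proof -
        have "H * ?q = (2 - 2 * H) * real r" using H by (simp add: field_simps)
        then show ?thesis using l by (subst powr_realpow[symmetric]) (auto simp only: powr_powr, simp)
      qed
      finally show ?thesis .
    qed
    then have "(\<Sum>k<n. expectation (\<lambda>\<omega>. \<bar>?X k \<omega>\<bar> powr ?q)) \<le> (\<Sum>k<n. (l powr (2 - 2 * H)) ^ r * normal_abs_moment ?q)"
      by (intro sum_mono)
    then show ?thesis by (simp add: mult.assoc)
  qed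
  have "(\<integral>\<^sup>+\<omega>. ennreal (((\<Sum>k<n. \<bar>?X k \<omega>\<bar> powr ?p) - normal_abs_moment ?p * (v n - v 0)) ^ (2 * r)) \<partial>M)
    \<le> ennreal ((pi / 2 * ?p) ^ (2 * r) * normal_abs_moment (real (2 * r)) * ?R ^ r * real (card {..<n}) ^ (r - 1) *
        (\<Sum>k<n. expectation (\<lambda>\<omega>. \<bar>?X k \<omega>\<bar> powr (real (2 * r) * (?p - 1)))))"
    unfolding Ep[symmetric]
    by (intro gaussian_power_sum_moment finite_lessThan G mean_X p r increment_covariance_row_sum v gap l) auto
  also have "\<dots> \<le> ennreal ((pi / 2 * ?p) ^ (2 * r) * normal_abs_moment (real (2 * r)) * ?R ^ r * real n ^ (r - 1) *
      (real n * (l powr (2 - 2 * H)) ^ r * normal_abs_moment ?q))"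
    unfolding card_lessThan
    by (rule ennreal_leI, rule mult_left_mono[OF Eq]) (use H in \<open>auto intro!: mult_nonneg_nonneg normal_abs_moment_nonneg\<close>)
  also have "(pi / 2 * ?p) ^ (2 * r) * normal_abs_moment (real (2 * r)) * ?R ^ r * real n ^ (r - 1) *
      (real n * (l powr (2 - 2 * H)) ^ r * normal_abs_moment ?q) = moment_const r * (real n * l powr (2 - H)) ^ r"
  proof -
    have 1: "real n ^ (r - 1) * real n = real n ^ r" using r by (simp add: power_eq_if)
    have 2: "(l powr H) ^ r * (l powr (2 - 2 * H)) ^ r = (l powr (2 - H)) ^ r"
      by (simp add: power_mult_distrib[symmetric] powr_add[symmetric])
    have "(pi / 2 * ?p) ^ (2 * r) * normal_abs_moment (real (2 * r)) * ?R ^ r * real n ^ (r - 1) *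
      (real n * (l powr (2 - 2 * H)) ^ r * normal_abs_moment ?q) =
      moment_const r * ((real n ^ (r - 1) * real n) * ((l powr H) ^ r * (l powr (2 - 2 * H)) ^ r))"
      unfolding moment_const_def power_mult_distrib by (simp only: mult_ac)
    also have "\<dots> = moment_const r * (real n * l powr (2 - H)) ^ r"
      unfolding 1 2 power_mult_distrib ..
    finally show ?thesis .
  qed
  finally show ?thesis .
qed

end

section \<open>Hoelder continuity of the paths\<close>

text \<open>Chaining through \<open>d m u\<close>, the last dyadic point of level m at or before u.
  The steps from one level to the next are geometrically small, and two points at distance at most T
  / 2^m have equal or adjacent dyadic points at level m.\<close>

lemma holder_of_dyadic_increments:
  fixes x :: "real \<Rightarrow> real"
  assumes T: "0 < T" and x: "continuous_on {0..T} x" and \<gamma>: "0 < \<gamma>" and C: "0 \<le> C"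
    and incr: "\<And>m j. j < 2 ^ m \<Longrightarrow> \<bar>x (real (Suc j) * T / 2 ^ m) - x (real j * T / 2 ^ m)\<bar> \<le> C * (2 powr - \<gamma>) ^ m"
  obtains L where "0 \<le> L" "\<And>s t. s \<in> {0..T} \<Longrightarrow> t \<in> {0..T} \<Longrightarrow> \<bar>x s - x t\<bar> \<le> L * \<bar>s - t\<bar> powr \<gamma>"
proof -
  define \<rho> where "\<rho> = (2::real) powr - \<gamma>"
  have \<rho>: "0 < \<rho>" "\<rho> < 1"
    using \<gamma> powr_less_mono[of "- \<gamma>" 0 "2 :: real"] by (simp_all add: \<rho>_def)
  define k where "k m u = nat \<lfloor>u * 2 ^ m / T\<rfloor>" for m :: nat and u :: real
  define d where "d m u = real (k m u) * T / 2 ^ m" for m u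
  have k: "real (k m u) \<le> u * 2 ^ m / T" "u * 2 ^ m / T < real (k m u) + 1" if "0 \<le> u" for m u
  proof -
    have "0 \<le> u * 2 ^ m / T" using that T by simp
    then have "real (k m u) = of_int \<lfloor>u * 2 ^ m / T\<rfloor>" by (simp add: k_def)
    then show "real (k m u) \<le> u * 2 ^ m / T" "u * 2 ^ m / T < real (k m u) + 1" by linarith+
  qed
  have k_le: "k m u \<le> 2 ^ m" if "u \<in> {0..T}" for m u
  proof -
    have "real (k m u) \<le> u * 2 ^ m / T" using k that by auto
    also have "\<dots> \<le> 2 ^ m" using that T by (simp add: divide_le_eq)
    finally show ?thesis by (metis of_nat_le_iff of_nat_numeral of_nat_power)
  qed
  have d: "0 \<le> d m u" "d m u \<le> u" "u - d m u \<le> T / 2 ^ m" if "0 \<le> u" for m u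
  proof -
    show "0 \<le> d m u" "d m u \<le> u" using k[OF that, of m] T by (auto simp: d_def field_simps)
    have "u < (real (k m u) + 1) * T / 2 ^ m" using k[OF that, of m] T by (simp add: field_simps)
    then show "u - d m u \<le> T / 2 ^ m" by (simp add: d_def add_divide_distrib distrib_right)
  qed
  have step1: "\<bar>x (real i * T / 2 ^ m) - x (real j * T / 2 ^ m)\<bar> \<le> C * \<rho> ^ m"
    if "i \<le> 2 ^ m" "j \<le> 2 ^ m" "i \<le> Suc j" "j \<le> Suc i" for i j m
  proof -
    consider "i = j" | "i = Suc j" | "j = Suc i" using \<open>i \<le> Suc j\<close> \<open>j \<le> Suc i\<close> by linarith
    then show ?thesis
    proof cases
      case 1 then show ?thesis using C \<rho> by simp
    next
      case 2 then show ?thesis using incr[of j m] that by (simp add: \<rho>_def)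
    next
      case 3 then show ?thesis using incr[of i m] that by (simp add: \<rho>_def abs_minus_commute)
    qed
  qed
  have step: "\<bar>x (d (Suc m) u) - x (d m u)\<bar> \<le> C * \<rho> ^ Suc m" if u: "u \<in> {0..T}" for m u
  proof -
    have "real (2 * k m u) \<le> u * 2 ^ Suc m / T" "u * 2 ^ Suc m / T < real (2 * k m u) + 2"
    proof -
      have e: "u * 2 ^ Suc m / T = 2 * (u * 2 ^ m / T)" by simp
      have "real (k m u) \<le> u * 2 ^ m / T" "u * 2 ^ m / T < real (k m u) + 1"
        using k[of u m] u by auto
      then show "real (2 * k m u) \<le> u * 2 ^ Suc m / T" "u * 2 ^ Suc m / T < real (2 * k m u) + 2"
        unfolding e of_nat_mult of_nat_numeral by linarith+
    qed
    \<comment> \<open>One level down, the last dyadic point either stays or advances by a single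
      cell.\<close>
    then have "2 * k m u \<le> k (Suc m) u" "k (Suc m) u \<le> Suc (2 * k m u)"
      using k[of u "Suc m"] u by auto
    moreover have "d m u = real (2 * k m u) * T / 2 ^ Suc m" by (simp add: d_def)
    moreover have "2 * k m u \<le> 2 ^ Suc m" using k_le[OF u, of m] by simp
    ultimately show ?thesis
      unfolding d_def[of "Suc m"] using k_le[OF u, of "Suc m"] by (simp only:) (rule step1, auto)
  qed
  have tail: "\<bar>x (d (m + n) u) - x (d m u)\<bar> \<le> C * (\<rho> ^ m / (1 - \<rho>))" if u: "u \<in> {0..T}" for m n u
  proof -
    have "\<bar>x (d (m + n) u) - x (d m u)\<bar> \<le> C * (\<rho> ^ m * (\<Sum>i<n. \<rho> ^ i))"
    proof (induction n)
      case (Suc n)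
      have "\<bar>x (d (m + Suc n) u) - x (d (m + n) u)\<bar> \<le> C * \<rho> ^ Suc (m + n)"
        using step[OF u, of "m + n"] by simp
      also have "\<dots> \<le> C * \<rho> ^ (m + n)" using C \<rho> by (intro mult_left_mono power_decreasing) auto
      finally show ?case using Suc by (simp add: algebra_simps power_add)
    qed simp
    also have "\<dots> \<le> C * (\<rho> ^ m * (1 / (1 - \<rho>)))"
      using C \<rho> by (intro mult_left_mono) (auto simp: sum_gp_strict divide_right_mono)
    finally show ?thesis by simp
  qed
  have approx: "\<bar>x u - x (d m u)\<bar> \<le> C * (\<rho> ^ m / (1 - \<rho>))" if u: "u \<in> {0..T}" for m u
  proof -
    have lim: "(\<lambda>n. d (m + n) u) \<longlonglongrightarrow> u"
    proof (rule tendsto_sandwich[where f = "\<lambda>n. u - (T / 2 ^ m) * (1 / 2) ^ n" and h = "\<lambda>_. u"])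
      have "(\<lambda>n. u - (T / 2 ^ m) * (1 / 2) ^ n) \<longlonglongrightarrow> u - (T / 2 ^ m) * 0"
        by (intro tendsto_intros LIMSEQ_power_zero) auto
      then show "(\<lambda>n. u - (T / 2 ^ m) * (1 / 2) ^ n) \<longlonglongrightarrow> u" by simp
      show "\<forall>\<^sub>F n in sequentially. u - (T / 2 ^ m) * (1 / 2) ^ n \<le> d (m + n) u"
      proof (intro always_eventually allI)
        fix n show "u - (T / 2 ^ m) * (1 / 2) ^ n \<le> d (m + n) u"
          using d(3)[of u "m + n"] u by (simp add: power_add power_divide)
      qed
    qed (use d u in auto)
    have "(\<lambda>n. x (d (m + n) u)) \<longlonglongrightarrow> x u"
    proof (rule continuous_on_tendsto_compose[OF x lim])
      have "d (m + n) u \<in> {0..T}" for n using d(1,2)[of u "m + n"] u by auto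
      then show "\<forall>\<^sub>F n in sequentially. d (m + n) u \<in> {0..T}" by simp
    qed (use u in simp)
    then have "(\<lambda>n. \<bar>x (d (m + n) u) - x (d m u)\<bar>) \<longlonglongrightarrow> \<bar>x u - x (d m u)\<bar>"
      by (intro tendsto_intros)
    then show ?thesis
      by (rule LIMSEQ_le_const2) (use tail[OF u] in auto)
  qed
  \<comment> \<open>Two tails, one for each point, and one step between their dyadic points.\<close>
  define C1 where "C1 = C * (2 / (1 - \<rho>) + 1)"
  have C1: "0 \<le> C1" using C \<rho> by (simp add: C1_def)
  have close: "\<bar>x s - x t\<bar> \<le> C1 * \<rho> ^ m" if s: "s \<in> {0..T}" and t: "t \<in> {0..T}" and st: "\<bar>s - t\<bar> \<le> T / 2 ^ m" for s t m
  proof -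
    have "\<bar>s * 2 ^ m / T - t * 2 ^ m / T\<bar> \<le> 1"
    proof -
      have "s * 2 ^ m / T - t * 2 ^ m / T = (s - t) * (2 ^ m / T)" by (simp add: left_diff_distrib diff_divide_distrib)
      then have "\<bar>s * 2 ^ m / T - t * 2 ^ m / T\<bar> = \<bar>s - t\<bar> * (2 ^ m / T)" using T by (simp add: abs_mult)
      also have "\<dots> \<le> T / 2 ^ m * (2 ^ m / T)" using st T by (intro mult_right_mono) auto
      finally show ?thesis using T by simp
    qed
    then have "k m s \<le> Suc (k m t)" "k m t \<le> Suc (k m s)"
      using k[of s m] k[of t m] s t by auto
    then have "\<bar>x (d m s) - x (d m t)\<bar> \<le> C * \<rho> ^ m"
      unfolding d_def using k_le s t by (intro step1) auto
    moreover have "\<bar>x s - x (d m s)\<bar> \<le> C * (\<rho> ^ m / (1 - \<rho>))" "\<bar>x t - x (d m t)\<bar> \<le> C * (\<rho> ^ m / (1 - \<rho>))"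
      using approx s t by auto
    ultimately have "\<bar>x s - x t\<bar> \<le> C * (\<rho> ^ m / (1 - \<rho>)) + C * (\<rho> ^ m / (1 - \<rho>)) + C * \<rho> ^ m" by linarith
    also have "\<dots> = C1 * \<rho> ^ m" by (simp add: C1_def algebra_simps)
    finally show ?thesis .
  qed
  show ?thesis
  proof
    show "0 \<le> C1 * (2 / T) powr \<gamma>" using C1 by simp
    fix s t assume s: "s \<in> {0..T}" and t: "t \<in> {0..T}"
    show "\<bar>x s - x t\<bar> \<le> C1 * (2 / T) powr \<gamma> * \<bar>s - t\<bar> powr \<gamma>"
    proof (cases "s = t")
      case False
      have "(\<lambda>m. T * (1 / 2) ^ m) \<longlonglongrightarrow> T * 0"
        by (intro tendsto_intros LIMSEQ_power_zero) auto
      then have "\<forall>\<^sub>F m in sequentially. T * (1 / 2) ^ m < \<bar>s - t\<bar>"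
        by (rule order_tendstoD) (use False in auto)
      then have ex: "\<exists>m. T / 2 ^ m < \<bar>s - t\<bar>"
        by (auto simp: eventually_sequentially power_divide)
      \<comment> \<open>The first level whose mesh is below |s - t|. It is not level 0, since |s -
        t| \<le> T; the level before it satisfies the hypothesis of \<open>close\<close>, while its
        mesh is below 2 |s - t|. Hence the factor 2 / T.\<close>
      define N where "N = (LEAST m. T / 2 ^ m < \<bar>s - t\<bar>)"
      have N: "T / 2 ^ N < \<bar>s - t\<bar>" unfolding N_def by (rule LeastI_ex[OF ex])
      have "N \<noteq> 0"
      proof
        assume "N = 0"
        with N have "T < \<bar>s - t\<bar>" by simp
        then show False using s t by auto
      qed
      then obtain m where m: "N = Suc m" by (cases N) auto
      then have "\<not> T / 2 ^ m < \<bar>s - t\<bar>"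
        using not_less_Least[of m "\<lambda>m. T / 2 ^ m < \<bar>s - t\<bar>"] by (simp add: N_def)
      then have "\<bar>x s - x t\<bar> \<le> C1 * \<rho> ^ m" by (intro close s t) auto
      also have "\<rho> ^ m = (1 / 2 ^ m) powr \<gamma>"
        by (simp add: \<rho>_def powr_minus powr_divide powr_realpow[symmetric] powr_powr mult.commute power_inverse inverse_eq_divide)
      also have "\<dots> \<le> (2 / T * \<bar>s - t\<bar>) powr \<gamma>"
        using N T \<gamma> m by (intro powr_mono2) (auto simp: field_simps)
      also have "\<dots> = (2 / T) powr \<gamma> * \<bar>s - t\<bar> powr \<gamma>" by (rule powr_mult)
      finally show ?thesis using C1 by (simp add: mult_left_mono mult.assoc)
    qed (use C1 in simp)
  qed
qed

context fbm
begin

text \<open>Kolmogorov's criterion with moments of order \<open>4 / H\<close>.\<close>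

lemma holder_paths:
  "AE \<omega> in M. \<exists>L\<ge>0. \<forall>s\<in>{0..T}. \<forall>t\<in>{0..T}. \<bar>B s \<omega> - B t \<omega>\<bar> \<le> L * \<bar>s - t\<bar> powr (H / 2)"
proof -
  let ?q = "4 / H" and ?u = "\<lambda>m j. real j * T / 2 ^ m"
  let ?D = "\<lambda>m j \<omega>. \<bar>B (?u m (Suc j)) \<omega> - B (?u m j) \<omega>\<bar>"
  \<comment> \<open>The moment of order 4 / H of an increment is proportional to the fourth power of
    its length, that is to 16^(-m). With 2^m cells and the weight 4^m, level m contributes a
    multiple of 2^(-m). Conversely, finiteness of \<open>S\<close> bounds the increments of level m
    by a multiple of 4^(-m H / 4), which is exponent H / 2.\<close>
  define S where "S \<omega> = (\<Sum>m. \<Sum>j<2 ^ m. ennreal (4 ^ m * ?D m j \<omega> powr ?q))" for \<omega>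
  have u: "?u m j \<in> {0..T}" if "j \<le> 2 ^ m" for m j
  proof -
    have "real j \<le> 2 ^ m" using that by (metis of_nat_le_iff of_nat_numeral of_nat_power)
    then show ?thesis using T by (simp add: divide_le_eq)
  qed
  have meas: "(\<lambda>\<omega>. ennreal (4 ^ m * ?D m j \<omega> powr ?q)) \<in> borel_measurable M" if "j < 2 ^ m" for m j
  proof -
    have [measurable]: "B (?u m (Suc j)) \<in> borel_measurable M" "B (?u m j) \<in> borel_measurable M"
      using that by (auto intro!: borel_B u simp del: of_nat_Suc)
    show ?thesis by measurable
  qed
  have "(\<integral>\<^sup>+\<omega>. S \<omega> \<partial>M) = (\<Sum>m. \<Sum>j<2 ^ m. \<integral>\<^sup>+\<omega>. ennreal (4 ^ m * ?D m j \<omega> powr ?q) \<partial>M)"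
    unfolding S_def
    by (subst nn_integral_suminf, rule borel_measurable_sum, rule meas, simp only: lessThan_iff,
        rule suminf_cong, rule nn_integral_sum, rule meas, simp only: lessThan_iff)
  also have "\<dots> = (\<Sum>m. ennreal (T ^ 4 * normal_abs_moment ?q * (1 / 2) ^ m))"
  proof (intro suminf_cong)
    fix m
    have "(\<integral>\<^sup>+\<omega>. ennreal (4 ^ m * ?D m j \<omega> powr ?q) \<partial>M) = ennreal (T ^ 4 * normal_abs_moment ?q * (1 / 4) ^ m)"
      if "j < 2 ^ m" for j
    proof -
      have [measurable]: "B (?u m (Suc j)) \<in> borel_measurable M" "B (?u m j) \<in> borel_measurable M"
        using that by (auto intro!: borel_B u simp del: of_nat_Suc)
      have "(\<integral>\<^sup>+\<omega>. ennreal (4 ^ m * ?D m j \<omega> powr ?q) \<partial>M) = ennreal (4 ^ m) * (\<integral>\<^sup>+\<omega>. ennreal (?D m j \<omega> powr ?q) \<partial>M)"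
      proof -
        have "(\<lambda>\<omega>. ennreal (?D m j \<omega> powr ?q)) \<in> borel_measurable M" by measurable
        then show ?thesis
          by (subst nn_integral_cmult[symmetric]) (auto intro!: nn_integral_cong ennreal_mult)
      qed
      also have "(\<integral>\<^sup>+\<omega>. ennreal (?D m j \<omega> powr ?q) \<partial>M) = ennreal (\<bar>?u m (Suc j) - ?u m j\<bar> powr (H * ?q) * normal_abs_moment ?q)"
        using that H by (intro increment_abs_powr u) auto
      also have "\<bar>?u m (Suc j) - ?u m j\<bar> = T / 2 ^ m" using T by (simp add: field_simps)
      also have "(T / 2 ^ m) powr (H * ?q) = T ^ 4 * (1 / 16) ^ m"
      proof -
        have "H * ?q = real 4" using H by simp
        then have "(T / 2 ^ m) powr (H * ?q) = (T / 2 ^ m) ^ 4" using T by (simp only:) (rule powr_realpow, simp)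
        also have "\<dots> = T ^ 4 * (1 / 16) ^ m" by (simp add: power_divide power_mult[symmetric] mult.commute[of m 4]) (simp add: power_mult)
        finally show ?thesis .
      qed
      also have "ennreal (4 ^ m) * ennreal (T ^ 4 * (1 / 16) ^ m * normal_abs_moment ?q) = ennreal (T ^ 4 * normal_abs_moment ?q * (1 / 4) ^ m)"
      proof -
        have "4 ^ m * (1 / 16) ^ m = (1 / 4 :: real) ^ m" by (simp add: power_mult_distrib[symmetric])
        then have eq: "4 ^ m * (T ^ 4 * (1 / 16) ^ m * normal_abs_moment ?q) = T ^ 4 * normal_abs_moment ?q * (1 / 4) ^ m"
          by (simp add: mult_ac)
        show ?thesis
          unfolding eq[symmetric]
          by (rule ennreal_mult[symmetric]) (use T in \<open>auto intro!: mult_nonneg_nonneg normal_abs_moment_nonneg\<close>)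
      qed
      finally show ?thesis .
    qed
    then have "(\<Sum>j<2 ^ m. \<integral>\<^sup>+\<omega>. ennreal (4 ^ m * ?D m j \<omega> powr ?q) \<partial>M) = (\<Sum>j<(2::nat) ^ m. ennreal (T ^ 4 * normal_abs_moment ?q * (1 / 4) ^ m))"
      by (intro sum.cong) auto
    also have "\<dots> = ennreal (2 ^ m) * ennreal (T ^ 4 * normal_abs_moment ?q * (1 / 4) ^ m)"
      by (simp add: ennreal_of_nat_eq_real_of_nat)
    also have "\<dots> = ennreal (T ^ 4 * normal_abs_moment ?q * (1 / 2) ^ m)"
    proof -
      have "2 ^ m * (1 / 4) ^ m = (1 / 2 :: real) ^ m" by (simp add: power_mult_distrib[symmetric])
      then have eq: "2 ^ m * (T ^ 4 * normal_abs_moment ?q * (1 / 4) ^ m) = T ^ 4 * normal_abs_moment ?q * (1 / 2) ^ m"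
        by (metis mult.assoc mult.commute)
      show ?thesis
        unfolding eq[symmetric]
        by (rule ennreal_mult[symmetric]) (use T in \<open>auto intro!: mult_nonneg_nonneg normal_abs_moment_nonneg\<close>)
    qed
    finally show "(\<Sum>j<2 ^ m. \<integral>\<^sup>+\<omega>. ennreal (4 ^ m * ?D m j \<omega> powr ?q) \<partial>M) = ennreal (T ^ 4 * normal_abs_moment ?q * (1 / 2) ^ m)" .
  qed
  also have "\<dots> < \<infinity>"
    using T by (subst suminf_ennreal2)
      (auto intro!: mult_nonneg_nonneg normal_abs_moment_nonneg summable_mult summable_geometric)
  finally have fin: "(\<integral>\<^sup>+\<omega>. S \<omega> \<partial>M) \<noteq> \<infinity>" by simp
  have "S \<in> borel_measurable M"
    unfolding S_def
    by (rule borel_measurable_suminf_order, rule borel_measurable_sum, rule meas, simp only: lessThan_iff)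
  then have "AE \<omega> in M. S \<omega> \<noteq> \<infinity>" using fin by (rule nn_integral_noteq_infinite)
  then show ?thesis
  proof (rule AE_mp, intro AE_I2 impI)
    fix \<omega> assume \<omega>: "\<omega> \<in> space M" and S: "S \<omega> \<noteq> \<infinity>"
    define K where "K = enn2real (S \<omega>)"
    have K: "ennreal K = S \<omega>" "0 \<le> K" using S by (simp_all add: K_def less_top)
    have bound: "?D m j \<omega> \<le> K powr (H / 4) * (2 powr - (H / 2)) ^ m" if "j < 2 ^ m" for m j
    proof -
      have "ennreal (4 ^ m * ?D m j \<omega> powr ?q) \<le> (\<Sum>j<2 ^ m. ennreal (4 ^ m * ?D m j \<omega> powr ?q))"
        using that by (intro member_le_sum) auto
      also have "\<dots> \<le> S \<omega>"
        unfolding S_def using sum_le_suminf[of "\<lambda>m. \<Sum>j<2 ^ m. ennreal (4 ^ m * ?D m j \<omega> powr ?q)" "{m}"] by simp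
      finally have "4 ^ m * ?D m j \<omega> powr ?q \<le> K"
        unfolding K(1)[symmetric] using K(2) by (simp add: ennreal_le_iff)
      then have "?D m j \<omega> powr ?q \<le> K * (1 / 4) ^ m" by (simp add: power_divide field_simps)
      then have "(?D m j \<omega> powr ?q) powr (H / 4) \<le> (K * (1 / 4) ^ m) powr (H / 4)"
        using H by (intro powr_mono2) auto
      moreover have "(?D m j \<omega> powr ?q) powr (H / 4) = ?D m j \<omega>" using H by (simp add: powr_powr)
      moreover have "(K * (1 / 4) ^ m) powr (H / 4) = K powr (H / 4) * (2 powr - (H / 2)) ^ m"
      proof -
        have "(1 / 4 :: real) ^ m = 2 powr (- 2 * real m)"
          by (simp add: powr_minus powr_realpow[symmetric] powr_powr power_divide) (simp add: powr_powr[symmetric] powr_realpow inverse_eq_divide)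
        then have "((1 / 4 :: real) ^ m) powr (H / 4) = (2 powr - (H / 2)) ^ m"
          by (simp add: powr_powr powr_realpow[symmetric] mult.commute)
        then show ?thesis using K(2) by (simp add: powr_mult)
      qed
      ultimately show ?thesis by simp
    qed
    show "\<exists>L\<ge>0. \<forall>s\<in>{0..T}. \<forall>t\<in>{0..T}. \<bar>B s \<omega> - B t \<omega>\<bar> \<le> L * \<bar>s - t\<bar> powr (H / 2)"
      by (rule holder_of_dyadic_increments[OF T cont[OF \<omega>], of "H / 2" "K powr (H / 4)"])
        (use H bound in auto)
  qed
qed

end

section \<open>Energies along shifted grids\<close>

lemma sorted_list_of_set_insert_greater:
  fixes b :: "'a :: linorder"
  assumes "finite A" "\<And>a. a \<in> A \<Longrightarrow> a < b"
  shows "sorted_list_of_set (insert b A) = sorted_list_of_set A @ [b]"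
proof -
  let ?xs = "sorted_list_of_set A @ [b]"
  have "set ?xs = insert b A" using assms(1) by auto
  moreover have "sorted ?xs" "distinct ?xs"
    using assms by (auto simp: sorted_append intro: less_imp_le)
  ultimately show ?thesis
    by (metis sorted_list_of_set.idem_if_sorted_distinct)
qed

text \<open>The enumeration may repeat points: a repeated point contributes a diagonal term of \<open>f\<close>.\<close>

lemma sum_nodes_eq_sum_enumeration:
  fixes w :: "nat \<Rightarrow> real" and f :: "real \<Rightarrow> real \<Rightarrow> real"
  assumes mono: "\<And>i. w i \<le> w (Suc i)" and f0: "\<And>u. f u u = 0"
  shows "(\<Sum>i<card (w ` {..n}) - 1. f (node (w ` {..n}) i) (node (w ` {..n}) (Suc i))) = (\<Sum>k<n. f (w k) (w (Suc k)))"
proof -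
  have le: "w i \<le> w j" if "i \<le> j" for i j
    using lift_Suc_mono_le[of w i j] mono that by blast
  \<comment> \<open>The last node is carried through the induction, because it is the left end of
    the cell that a new point adds.\<close>
  have "(\<Sum>i<card (w ` {..n}) - 1. f (node (w ` {..n}) i) (node (w ` {..n}) (Suc i))) = (\<Sum>k<n. f (w k) (w (Suc k)))
     \<and> node (w ` {..n}) (card (w ` {..n}) - 1) = w n"
  proof (induction n)
    case 0
    then show ?case by (simp add: node_def)
  next
    case (Suc n)
    let ?A = "w ` {..n}" and ?b = "w (Suc n)"
    have ins: "w ` {..Suc n} = insert ?b ?A" by (simp add: atMost_Suc)
    have c: "0 < card ?A" by (simp add: card_gt_0_iff)
    show ?case
    proof (cases "?b = w n")
      case True
      then have "insert ?b ?A = ?A" by (simp add: insert_absorb)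
      then show ?thesis using Suc True f0 by (simp only: ins sum.lessThan_Suc) simp
    next
      case False
      then have less: "a < ?b" if "a \<in> ?A" for a
        using that le mono[of n] by (metis atMost_iff imageE order_le_less order_less_le_trans)
      then have nin: "?b \<notin> ?A" by blast
      have L: "sorted_list_of_set (insert ?b ?A) = sorted_list_of_set ?A @ [?b]"
        by (rule sorted_list_of_set_insert_greater) (use less in auto)
      have node_old: "node (insert ?b ?A) i = node ?A i" if "i < card ?A" for i
        using that by (simp add: node_def L nth_append)
      have node_new: "node (insert ?b ?A) (card ?A) = ?b"
        by (simp add: node_def L nth_append)
      have card_ins: "card (insert ?b ?A) = Suc (card ?A)" using nin by simp
      have "(\<Sum>i<card ?A. f (node (insert ?b ?A) i) (node (insert ?b ?A) (Suc i))) =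
          (\<Sum>i<card ?A - 1. f (node (insert ?b ?A) i) (node (insert ?b ?A) (Suc i))) + f (node (insert ?b ?A) (card ?A - 1)) (node (insert ?b ?A) (card ?A))"
        using c sum.lessThan_Suc[of "\<lambda>i. f (node (insert ?b ?A) i) (node (insert ?b ?A) (Suc i))" "card ?A - 1"]
        by (simp only: Suc_diff_1)
      also have "(\<Sum>i<card ?A - 1. f (node (insert ?b ?A) i) (node (insert ?b ?A) (Suc i))) =
          (\<Sum>i<card ?A - 1. f (node ?A i) (node ?A (Suc i)))"
        by (intro sum.cong refl) (simp add: node_old)
      also have "f (node (insert ?b ?A) (card ?A - 1)) (node (insert ?b ?A) (card ?A)) = f (w n) ?b"
        using Suc c by (simp add: node_new node_old)
      finally show ?thesis
        using Suc by (simp only: ins card_ins diff_Suc_1 node_new sum.lessThan_Suc)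
    qed
  qed
  then show ?thesis ..
qed

text \<open>The index is shifted so that, for \<open>a < l\<close>, the point of index \<open>0\<close> is clamped to the left end
  of the interval. On one scale of \<open>l\<close> all grids then have the same number of cells.\<close>

definition grid_time :: "real \<Rightarrow> real \<Rightarrow> real \<Rightarrow> nat \<Rightarrow> real" where
  "grid_time t l a k = max 0 (min (a + (real k - 1) * l) t)"

definition grid_energy :: "real \<Rightarrow> (real \<Rightarrow> real) \<Rightarrow> real \<Rightarrow> real \<Rightarrow> real \<Rightarrow> nat \<Rightarrow> real" where
  "grid_energy p x t l a n = (\<Sum>k<n. \<bar>x (grid_time t l a (Suc k)) - x (grid_time t l a k)\<bar> powr p)"

lemma grid_time_mono: "0 \<le> l \<Longrightarrow> mono (grid_time t l a)"
  unfolding grid_time_def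
  by (intro monoI max.mono min.mono order_refl add_left_mono mult_right_mono diff_right_mono) auto

lemma grid_time_in: "0 \<le> t \<Longrightarrow> t \<le> T \<Longrightarrow> grid_time t l a k \<in> {0..T}"
  by (auto simp: grid_time_def)

lemma grid_time_gap: "0 \<le> l \<Longrightarrow> grid_time t l a (Suc k) - grid_time t l a k \<le> l"
  by (auto simp: grid_time_def max_def min_def algebra_simps)

text \<open>Clamping is nonexpansive, and the index multiplies a change of the step by at most n.
  The bound 1 \<le> n covers k = 0, where the multiplier is -1.\<close>

lemma grid_time_diff_le:
  assumes k: "k \<le> Suc n" and n: "1 \<le> n"
  shows "\<bar>grid_time t l a k - grid_time t' l' a' k\<bar> \<le> \<bar>t - t'\<bar> + \<bar>a - a'\<bar> + real n * \<bar>l - l'\<bar>"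
proof -
  have mm: "\<bar>max 0 (min x t) - max 0 (min y t')\<bar> \<le> max \<bar>x - y\<bar> \<bar>t - t'\<bar>" for x y :: real
    by (auto simp: max_def min_def abs_if)
  have "\<bar>(real k - 1) * l - (real k - 1) * l'\<bar> = \<bar>real k - 1\<bar> * \<bar>l - l'\<bar>"
    by (simp add: abs_mult[symmetric] algebra_simps)
  also have "\<dots> \<le> real n * \<bar>l - l'\<bar>"
    using k n by (intro mult_right_mono) auto
  finally have "\<bar>(a + (real k - 1) * l) - (a' + (real k - 1) * l')\<bar> \<le> \<bar>a - a'\<bar> + real n * \<bar>l - l'\<bar>"
    by linarith
  then show ?thesis
    using mm[of "a + (real k - 1) * l" "a' + (real k - 1) * l'"] unfolding grid_time_def
    by (smt (verit) abs_ge_zero mult_nonneg_nonneg of_nat_0_le_iff)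
qed

text \<open>By the condition on K, the unclamped point of index \<open>Suc K\<close> has reached T,
  so clamping enumerates the whole grid, possibly with repetitions. Stopping at t amounts to
  clamping at t instead of T.\<close>

lemma stopped_energy_shifted_grid:
  assumes T: "0 < T" and l: "0 < l" and a: "0 \<le> a" "a < l" and K: "T \<le> a + real K * l" and t: "0 \<le> t" "t \<le> T"
  shows "stopped_energy p (shifted_grid T l a) x t = grid_energy p x t l a (Suc K)"
    and "grid_time t l a (Suc K) = t" and "grid_time t l a 0 = 0"
proof -
  let ?w = "grid_time T l a"
  have w0: "?w 0 = 0" and wK: "?w (Suc K) = T"
    using a K T by (auto simp: grid_time_def)
  have img: "?w ` {..Suc K} = shifted_grid T l a"
  proof (rule set_eqI, rule iffI)
    fix u assume "u \<in> ?w ` {..Suc K}"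
    then obtain k where u: "u = ?w k" by blast
    let ?y = "a + (real k - 1) * l"
    consider "?y \<le> 0" | "T \<le> ?y" | "0 < ?y" "?y < T" by linarith
    then show "u \<in> shifted_grid T l a"
    proof cases
      case 3
      then have "u = a + of_int (int k - 1) * l" using u by (simp add: grid_time_def)
      moreover have "0 < u" "u < T" using 3 u by (auto simp: grid_time_def)
      ultimately show ?thesis unfolding shifted_grid_def by blast
    qed (use u T in \<open>auto simp: grid_time_def shifted_grid_def\<close>)
  next
    fix u assume "u \<in> shifted_grid T l a"
    then consider "u = 0" | "u = T" | k :: int where "u = a + of_int k * l" "0 < u" "u < T"
      unfolding shifted_grid_def by auto
    then show "u \<in> ?w ` {..Suc K}"
    proof cases
      case 1 then show ?thesis using w0 by (metis atMost_iff image_eqI zero_le)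
    next
      case 2 then show ?thesis using wK by (metis atMost_iff image_eqI order_refl)
    next
      case 3
      \<comment> \<open>Because a < l, a positive grid point has index k \<ge> 0; the shifted
        enumeration reaches it at k + 1.\<close>
      have "0 < (of_int k + 1) * l" using 3 a by (simp add: distrib_right)
      then have "0 < of_int k + (1::real)" using l by (simp add: zero_less_mult_iff)
      then have k0: "0 \<le> k" by linarith
      have "of_int k * l < real K * l" using 3 K by linarith
      then have "of_int k < real K" using l by simp
      then have kK: "nat k \<le> K" using k0 by linarith
      have "?w (Suc (nat k)) = u" using 3 k0 by (simp add: grid_time_def)
      then show ?thesis using kK by (metis Suc_le_mono atMost_iff image_eqI)
    qed
  qed
  let ?f = "\<lambda>u v. \<bar>x (min v t) - x (min u t)\<bar> powr p"
  have "stopped_energy p (shifted_grid T l a) x t = (\<Sum>k<Suc K. ?f (?w k) (?w (Suc k)))"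
    unfolding stopped_energy_def img[symmetric]
    by (rule sum_nodes_eq_sum_enumeration[where f = ?f]) (use monoD[OF grid_time_mono[of l]] l in auto)
  moreover have "min (?w k) t = grid_time t l a k" for k
    using t by (auto simp: grid_time_def min_def max_def)
  ultimately show "stopped_energy p (shifted_grid T l a) x t = grid_energy p x t l a (Suc K)"
    by (simp only: grid_energy_def)
  show "grid_time t l a (Suc K) = t" "grid_time t l a 0 = 0"
    using a K t by (auto simp: grid_time_def)
qed

section \<open>Stability of the energy under displacement of the grid points\<close>

lemma abs_powr_diff_le:
  fixes y z p C :: real
  assumes p: "1 < p" and "\<bar>y\<bar> \<le> C" "\<bar>z\<bar> \<le> C"
  shows "\<bar>\<bar>y\<bar> powr p - \<bar>z\<bar> powr p\<bar> \<le> p * C powr (p - 1) * \<bar>y - z\<bar>"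
proof -
  have "norm (\<bar>y\<bar> powr p - \<bar>z\<bar> powr p) \<le> (p * C powr (p - 1)) * norm (y - z)"
  proof (rule field_differentiable_bound[where S = "{- C..C}"])
    show "((\<lambda>x. \<bar>x\<bar> powr p) has_field_derivative p * (sgn u * \<bar>u\<bar> powr (p - 1))) (at u within {- C..C})"
      for u :: real
      by (rule has_field_derivative_at_within[OF has_real_derivative_abs_powr[OF p]])
    show "norm (p * (sgn u * \<bar>u\<bar> powr (p - 1))) \<le> p * C powr (p - 1)" if "u \<in> {- C..C}" for u
    proof -
      have "\<bar>sgn u\<bar> * \<bar>u\<bar> powr (p - 1) \<le> 1 * C powr (p - 1)"
        using that p by (intro mult_mono powr_mono2) (auto simp: sgn_if)
      then show ?thesis using p by (simp add: abs_mult)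
    qed
  qed (use assms in auto)
  then show ?thesis by simp
qed

text \<open>The mean value theorem cell by cell, with the crude bound L T^\<gamma> for every
  increment. Each cell has two displaced ends, hence 2 L. The loss of a factor n is made good by the
  fineness of the net.\<close>

lemma grid_energy_diff_le:
  assumes p: "1 < p" and L: "0 \<le> L" and \<gamma>: "0 < \<gamma>" and T: "0 < T"
    and hoelder: "\<And>s t. s \<in> {0..T} \<Longrightarrow> t \<in> {0..T} \<Longrightarrow> \<bar>x s - x t\<bar> \<le> L * \<bar>s - t\<bar> powr \<gamma>"
    and t: "t \<in> {0..T}" "t' \<in> {0..T}"
    and close: "\<And>k. k \<le> n \<Longrightarrow> \<bar>grid_time t l a k - grid_time t' l' a' k\<bar> \<le> \<epsilon>"
  shows "\<bar>grid_energy p x t l a n - grid_energy p x t' l' a' n\<bar>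
    \<le> real n * (p * (L * T powr \<gamma>) powr (p - 1) * (2 * L * \<epsilon> powr \<gamma>))"
proof -
  let ?u = "grid_time t l a" and ?v = "grid_time t' l' a'"
  have u: "?u k \<in> {0..T}" and v: "?v k \<in> {0..T}" for k
    using t grid_time_in[of t T l a k] grid_time_in[of t' T l' a' k] by auto
  have bound: "\<bar>x r - x s\<bar> \<le> L * T powr \<gamma>" if "r \<in> {0..T}" "s \<in> {0..T}" for r s
  proof -
    have "\<bar>x r - x s\<bar> \<le> L * \<bar>r - s\<bar> powr \<gamma>" using hoelder that .
    also have "\<dots> \<le> L * T powr \<gamma>" using that L \<gamma> by (intro mult_left_mono powr_mono2) auto
    finally show ?thesis .
  qed
  have near: "\<bar>x (?u k) - x (?v k)\<bar> \<le> L * \<epsilon> powr \<gamma>" if "k \<le> n" for k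
  proof -
    have "\<bar>x (?u k) - x (?v k)\<bar> \<le> L * \<bar>?u k - ?v k\<bar> powr \<gamma>" using hoelder u v .
    also have "\<dots> \<le> L * \<epsilon> powr \<gamma>" using close[OF that] L \<gamma> by (intro mult_left_mono powr_mono2) auto
    finally show ?thesis .
  qed
  have "\<bar>grid_energy p x t l a n - grid_energy p x t' l' a' n\<bar> \<le>
     (\<Sum>k<n. \<bar>\<bar>x (?u (Suc k)) - x (?u k)\<bar> powr p - \<bar>x (?v (Suc k)) - x (?v k)\<bar> powr p\<bar>)"
    unfolding grid_energy_def sum_subtractf[symmetric] by (rule sum_abs)
  also have "\<dots> \<le> (\<Sum>k<n. p * (L * T powr \<gamma>) powr (p - 1) * (2 * L * \<epsilon> powr \<gamma>))"
  proof (intro sum_mono)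
    fix k assume "k \<in> {..<n}"
    then have k: "k \<le> n" "Suc k \<le> n" by auto
    have "\<bar>\<bar>x (?u (Suc k)) - x (?u k)\<bar> powr p - \<bar>x (?v (Suc k)) - x (?v k)\<bar> powr p\<bar>
      \<le> p * (L * T powr \<gamma>) powr (p - 1) * \<bar>(x (?u (Suc k)) - x (?u k)) - (x (?v (Suc k)) - x (?v k))\<bar>"
      by (intro abs_powr_diff_le p bound u v)
    also have "\<dots> \<le> p * (L * T powr \<gamma>) powr (p - 1) * (2 * L * \<epsilon> powr \<gamma>)"
      using near[OF k(1)] near[OF k(2)] p by (intro mult_left_mono) auto
    finally show "\<bar>\<bar>x (?u (Suc k)) - x (?u k)\<bar> powr p - \<bar>x (?v (Suc k)) - x (?v k)\<bar> powr p\<bar>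
      \<le> p * (L * T powr \<gamma>) powr (p - 1) * (2 * L * \<epsilon> powr \<gamma>)" .
  qed
  also have "\<dots> = real n * (p * (L * T powr \<gamma>) powr (p - 1) * (2 * L * \<epsilon> powr \<gamma>))" by simp
  finally show ?thesis .
qed

section \<open>Uniform convergence over all shifted grids\<close>

context fbm
begin

definition net :: "nat \<Rightarrow> nat \<Rightarrow> (nat \<times> nat \<times> nat) set" where
  "net Q N = {(i, j, m). i \<le> N ^ Q \<and> j \<le> N ^ Q \<and> m \<le> N ^ Q \<and> real i * (T / real N ^ Q) \<le> T / real N}"

definition net_time :: "nat \<Rightarrow> nat \<Rightarrow> nat \<times> nat \<times> nat \<Rightarrow> nat \<Rightarrow> real" where
  "net_time Q N = (\<lambda>(i, j, m). grid_time (real m * (T / real N ^ Q)) (real i * (T / real N ^ Q)) (real j * (T / real N ^ Q)))"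

text \<open>The centring uses the actual end points, since the clamped sequence of a net element
  need not start at 0 or end at its stopping time.\<close>

definition net_deviation :: "nat \<Rightarrow> nat \<Rightarrow> nat \<times> nat \<times> nat \<Rightarrow> 'a \<Rightarrow> real" where
  "net_deviation Q N z \<omega> =
     (\<Sum>k<N + 2. \<bar>B (net_time Q N z (Suc k)) \<omega> - B (net_time Q N z k) \<omega>\<bar> powr (1 / H))
       - normal_abs_moment (1 / H) * (net_time Q N z (N + 2) - net_time Q N z 0)"

lemma net_subset: "net Q N \<subseteq> {..N ^ Q} \<times> {..N ^ Q} \<times> {..N ^ Q}"
  by (auto simp: net_def)

lemma finite_net: "finite (net Q N)"
  by (rule finite_subset[OF net_subset]) auto

lemma card_net:
  assumes "1 \<le> N"
  shows "real (card (net Q N)) \<le> 8 * real N ^ (3 * Q)"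
proof -
  have "card (net Q N) \<le> card ({..N ^ Q} \<times> {..N ^ Q} \<times> {..N ^ Q})"
    by (rule card_mono[OF _ net_subset]) auto
  also have "\<dots> = (N ^ Q + 1) ^ 3" by (simp add: card_cartesian_product power3_eq_cube)
  also have "\<dots> \<le> (2 * N ^ Q) ^ 3" using assms by (intro power_mono) auto
  also have "\<dots> = 8 * N ^ (3 * Q)" by (simp add: power_mult_distrib power_mult[symmetric] mult.commute)
  finally have "real (card (net Q N)) \<le> real (8 * N ^ (3 * Q))" by (simp only: of_nat_le_iff)
  then show ?thesis by simp
qed

lemma net_time_props:
  assumes z: "z \<in> net Q N" and N: "1 \<le> N"
  shows "net_time Q N z k \<in> {0..T}" "mono (net_time Q N z)" "net_time Q N z (Suc k) - net_time Q N z k \<le> T / real N"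
proof -
  obtain i j m where zeq: "z = (i, j, m)" by (cases z) auto
  let ?h = "T / real N ^ Q"
  have i: "0 \<le> real i * ?h" using T by (intro mult_nonneg_nonneg) auto
  have "real m \<le> real N ^ Q" using z zeq by (simp add: net_def)
  then have "real m * ?h \<le> T" using T N by (simp add: divide_le_eq)
  then show "net_time Q N z k \<in> {0..T}"
    unfolding net_time_def zeq split using T by (intro grid_time_in mult_nonneg_nonneg) auto
  show "mono (net_time Q N z)"
    unfolding net_time_def zeq split by (rule grid_time_mono[OF i])
  have "net_time Q N z (Suc k) - net_time Q N z k \<le> real i * ?h"
    unfolding net_time_def zeq split by (rule grid_time_gap[OF i])
  also have "\<dots> \<le> T / real N" using z zeq by (simp add: net_def)
  finally show "net_time Q N z (Suc k) - net_time Q N z k \<le> T / real N" .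
qed

lemma net_deviation_measurable:
  assumes "z \<in> net Q N" "1 \<le> N"
  shows "net_deviation Q N z \<in> borel_measurable M"
proof -
  have [measurable]: "B (net_time Q N z k) \<in> borel_measurable M" for k
    by (rule borel_B[OF net_time_props(1)[OF assms]])
  show ?thesis unfolding net_deviation_def by measurable
qed

text \<open>In the exponent, 3 Q pays for the size of the net and 2 leaves a summable series over N.
  The base is N + 2 cells times (T / N)^(2 - H), of order N^(H - 1), so r only has to be large
  compared with Q / (1 - H).\<close>

lemma net_moment:
  assumes z: "z \<in> net Q N" and N: "1 \<le> N" and r: "0 < r" "3 * real Q + 2 \<le> (1 - H) * real r"
  shows "(\<integral>\<^sup>+\<omega>. ennreal (net_deviation Q N z \<omega> ^ (2 * r)) \<partial>M)
    \<le> ennreal (moment_const r * (3 * T powr (2 - H)) ^ r * real N powr - (3 * real Q + 2))"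
proof -
  have "(\<integral>\<^sup>+\<omega>. ennreal (net_deviation Q N z \<omega> ^ (2 * r)) \<partial>M)
    \<le> ennreal (moment_const r * (real (N + 2) * (T / real N) powr (2 - H)) ^ r)"
    unfolding net_deviation_def using T N
    by (intro power_variation_moment net_time_props[OF z N] r) (auto simp: divide_le_eq)
  also have "\<dots> \<le> ennreal (moment_const r * ((3 * T powr (2 - H)) * real N powr (H - 1)) ^ r)"
  proof (intro ennreal_leI mult_left_mono power_mono moment_const_nonneg)
    have "(T / real N) powr a = T powr a * real N powr - a" for a
      using N T by (simp add: powr_divide powr_minus_divide)
    from this[of "2 - H"] have eq: "(T / real N) powr (2 - H) = T powr (2 - H) * real N powr - (2 - H)" .
    have "real (N + 2) * (T / real N) powr (2 - H) \<le> (3 * real N) * (T powr (2 - H) * real N powr - (2 - H))"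
      unfolding eq by (rule mult_right_mono) (use N in auto)
    also have "\<dots> = (3 * T powr (2 - H)) * (real N powr 1 * real N powr - (2 - H))"
      using N by simp
    also have "\<dots> = (3 * T powr (2 - H)) * real N powr (H - 1)"
    proof -
      have "real N powr 1 * real N powr - (2 - H) = real N powr (H - 1)"
        by (subst powr_add[symmetric]) simp
      then show ?thesis by (simp only:)
    qed
    finally show "real (N + 2) * (T / real N) powr (2 - H) \<le> (3 * T powr (2 - H)) * real N powr (H - 1)" .
  qed auto
  also have "\<dots> \<le> ennreal (moment_const r * ((3 * T powr (2 - H)) ^ r * real N powr - (3 * real Q + 2)))"
    unfolding power_mult_distrib[of "3 * T powr (2 - H)"]
  proof (intro ennreal_leI mult_left_mono moment_const_nonneg)
    have "(real N powr (H - 1)) ^ r = real N powr ((H - 1) * real r)"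
      using N by (subst powr_realpow[symmetric]) (auto simp: powr_powr)
    also have "\<dots> \<le> real N powr - (3 * real Q + 2)"
      using N r by (intro powr_mono) (auto simp: algebra_simps)
    finally show "(real N powr (H - 1)) ^ r \<le> real N powr - (3 * real Q + 2)" .
  qed auto
  finally show ?thesis by (simp only: mult.assoc)
qed

text \<open>The net has polynomial size, and the moments of the deviations decay faster than any given
  power once their order is large: the total expectation is finite.\<close>

lemma net_deviation_tendsto:
  "AE \<omega> in M. \<forall>e>0. \<exists>N0. \<forall>N\<ge>N0. 1 \<le> N \<longrightarrow> (\<forall>z\<in>net Q N. \<bar>net_deviation Q N z \<omega>\<bar> \<le> e)"
proof -
  obtain r0 :: nat where "(3 * real Q + 2) / (1 - H) \<le> real r0" using real_arch_simple by blast
  define r where "r = Suc r0"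
  have r: "0 < r" "3 * real Q + 2 \<le> (1 - H) * real r"
  proof -
    have "(3 * real Q + 2) / (1 - H) \<le> real r" using \<open>_ \<le> real r0\<close> by (simp add: r_def)
    then show "3 * real Q + 2 \<le> (1 - H) * real r" using H by (simp add: divide_le_eq mult.commute)
  qed (simp add: r_def)
  define C where "C = 8 * (moment_const r * (3 * T powr (2 - H)) ^ r)"
  have C: "0 \<le> C" using moment_const_nonneg by (auto simp: C_def)
  \<comment> \<open>The sum over the net dominates its maximum. A finite expectation of the sum over
    all scales makes \<open>S n\<close> tend to 0 almost surely, in place of a Borel--Cantelli
    argument.\<close>
  define S where "S n \<omega> = (\<Sum>z\<in>net Q (Suc n). net_deviation Q (Suc n) z \<omega> ^ (2 * r))" for n \<omega>
  have S0: "0 \<le> S n \<omega>" for n \<omega> unfolding S_def by (intro sum_nonneg) (simp add: zero_le_even_power)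
  have S_meas: "S n \<in> borel_measurable M" for n
    unfolding S_def by (intro borel_measurable_sum borel_measurable_power net_deviation_measurable) auto
  have ES: "(\<integral>\<^sup>+\<omega>. ennreal (S n \<omega>) \<partial>M) \<le> ennreal (C * (1 / real (Suc n) ^ 2))" for n
  proof -
    let ?N = "Suc n"
    let ?b = "moment_const r * (3 * T powr (2 - H)) ^ r * real ?N powr - (3 * real Q + 2)"
    have "(\<integral>\<^sup>+\<omega>. ennreal (S n \<omega>) \<partial>M) = (\<integral>\<^sup>+\<omega>. (\<Sum>z\<in>net Q ?N. ennreal (net_deviation Q ?N z \<omega> ^ (2 * r))) \<partial>M)"
      unfolding S_def by (intro nn_integral_cong) (simp add: zero_le_even_power)
    also have "\<dots> = (\<Sum>z\<in>net Q ?N. \<integral>\<^sup>+\<omega>. ennreal (net_deviation Q ?N z \<omega> ^ (2 * r)) \<partial>M)"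
      by (rule nn_integral_sum)
        (intro measurable_compose[OF _ measurable_ennreal] borel_measurable_power net_deviation_measurable, auto)
    also have "\<dots> \<le> (\<Sum>z\<in>net Q ?N. ennreal ?b)"
      by (intro sum_mono net_moment r) auto
    also have "\<dots> = ennreal (real (card (net Q ?N)) * ?b)"
      using moment_const_nonneg by (simp add: ennreal_of_nat_eq_real_of_nat ennreal_mult[symmetric] mult_nonneg_nonneg)
    also have "\<dots> \<le> ennreal ((8 * real ?N ^ (3 * Q)) * ?b)"
      using moment_const_nonneg by (intro ennreal_leI mult_right_mono card_net mult_nonneg_nonneg) auto
    also have "(8 * real ?N ^ (3 * Q)) * ?b = C * (real ?N ^ (3 * Q) * real ?N powr - (3 * real Q + 2))"
      by (simp only: C_def mult_ac)
    also have "real ?N ^ (3 * Q) * real ?N powr - (3 * real Q + 2) = 1 / real ?N ^ 2"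
    proof -
      have "real ?N ^ (3 * Q) = real ?N powr (3 * real Q)" by (subst powr_realpow[symmetric]) auto
      then have "real ?N ^ (3 * Q) * real ?N powr - (3 * real Q + 2) = real ?N powr (- real 2)"
        by (simp only: powr_add[symmetric]) simp
      also have "\<dots> = 1 / real ?N ^ 2" by (simp only: powr_minus_divide powr_realpow of_nat_0_less_iff zero_less_Suc)
      finally show ?thesis .
    qed
    finally show ?thesis .
  qed
  have "(\<integral>\<^sup>+\<omega>. (\<Sum>n. ennreal (S n \<omega>)) \<partial>M) = (\<Sum>n. \<integral>\<^sup>+\<omega>. ennreal (S n \<omega>) \<partial>M)"
    using S_meas by (intro nn_integral_suminf) auto
  also have "\<dots> \<le> (\<Sum>n. ennreal (C * (1 / real (Suc n) ^ 2)))"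
    by (intro suminf_le ES) auto
  also have "\<dots> < \<infinity>"
  proof -
    have "summable (\<lambda>n. 1 / real (Suc n) ^ 2)"
      using summable_Suc_iff[THEN iffD2, OF inverse_power_summable[of 2, where 'a = real]] by (simp add: inverse_eq_divide)
    then have "summable (\<lambda>n. C * (1 / real (Suc n) ^ 2))" by (rule summable_mult)
    then show ?thesis using C by (subst suminf_ennreal2) auto
  qed
  finally have fin: "(\<integral>\<^sup>+\<omega>. (\<Sum>n. ennreal (S n \<omega>)) \<partial>M) \<noteq> \<infinity>" by simp
  have "AE \<omega> in M. (\<Sum>n. ennreal (S n \<omega>)) \<noteq> \<infinity>"
    by (rule nn_integral_noteq_infinite[OF _ fin]) (use S_meas in auto)
  then show ?thesis
  proof (rule AE_mp, intro AE_I2 impI allI)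
    fix \<omega> and e :: real assume "(\<Sum>n. ennreal (S n \<omega>)) \<noteq> \<infinity>" and e: "0 < e"
    then have "summable (\<lambda>n. S n \<omega>)"
      using S0 by (intro summable_suminf_not_top) auto
    then have "(\<lambda>n. S n \<omega>) \<longlonglongrightarrow> 0" by (rule summable_LIMSEQ_zero)
    then have "\<forall>\<^sub>F n in sequentially. S n \<omega> < e ^ (2 * r)"
      using e by (intro order_tendstoD) auto
    then obtain n0 where n0: "\<And>n. n0 \<le> n \<Longrightarrow> S n \<omega> < e ^ (2 * r)"
      by (auto simp: eventually_sequentially)
    show "\<exists>N0. \<forall>N\<ge>N0. 1 \<le> N \<longrightarrow> (\<forall>z\<in>net Q N. \<bar>net_deviation Q N z \<omega>\<bar> \<le> e)"
    proof (intro exI[of _ "Suc n0"] allI impI ballI)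
      fix N z assume N: "Suc n0 \<le> N" and z: "z \<in> net Q N"
      then obtain n where n: "N = Suc n" "n0 \<le> n" by (cases N) auto
      have "net_deviation Q N z \<omega> ^ (2 * r) \<le> S n \<omega>"
        unfolding S_def n(1)[symmetric] using z finite_net
        by (intro member_le_sum) (auto simp: zero_le_even_power)
      then have "\<bar>net_deviation Q N z \<omega>\<bar> ^ (2 * r) < e ^ (2 * r)"
        using n0[OF n(2)] by (simp add: power_even_abs)
      then have "\<bar>net_deviation Q N z \<omega>\<bar> < e"
        by (rule power_less_imp_less_base) (use e in simp)
      then show "\<bar>net_deviation Q N z \<omega>\<bar> \<le> e" by simp
    qed
  qed
qed

end

section \<open>From the net to all grids\<close>

lemma nat_floor_mult_approx:
  fixes u h :: real
  assumes "0 \<le> u" "0 < h"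
  shows "real (nat \<lfloor>u / h\<rfloor>) * h \<le> u" "u - real (nat \<lfloor>u / h\<rfloor>) * h \<le> h"
proof -
  have "0 \<le> u / h" using assms by simp
  then have "real (nat \<lfloor>u / h\<rfloor>) = of_int \<lfloor>u / h\<rfloor>" by simp
  then have n: "real (nat \<lfloor>u / h\<rfloor>) \<le> u / h" "u / h < real (nat \<lfloor>u / h\<rfloor>) + 1" by linarith+
  show "real (nat \<lfloor>u / h\<rfloor>) * h \<le> u"
    using n(1) unfolding pos_le_divide_eq[OF assms(2)] .
  have "u < (real (nat \<lfloor>u / h\<rfloor>) + 1) * h"
    using n(2) unfolding pos_divide_less_eq[OF assms(2)] .
  then show "u - real (nat \<lfloor>u / h\<rfloor>) * h \<le> h"
    unfolding distrib_right by linarith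
qed

text \<open>The windows (T / (N + 1), T / N] cover all admissible steps, with N the integer part of
  T / l; a bound on l from above is a bound on N from below.\<close>

lemma grid_deviation_tendsto_0:
  assumes T: "0 < T"
    and unif: "\<And>e. 0 < e \<Longrightarrow> \<exists>N0. \<forall>N\<ge>N0. 1 \<le> N \<longrightarrow> (\<forall>l a t. T / (real N + 1) < l \<and> l \<le> T / real N \<and> 0 \<le> a \<and> a < l \<and> t \<in> {0..T} \<longrightarrow>
         \<bar>stopped_energy p (shifted_grid T l a) x t - A t\<bar> \<le> e)"
  shows "(grid_deviation p T x A \<longlongrightarrow> 0) (at_right 0)"
proof (rule order_tendstoI)
  fix b :: ennreal assume "0 < b"
  then obtain c where c: "0 < c" "c < b" using dense by blast
  \<comment> \<open>A real bound is inserted strictly below b, which may itself be infinite.\<close>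
  define e where "e = enn2real c"
  have e: "0 < e" "ennreal e < b"
    using c by (auto simp: e_def enn2real_positive_iff less_top[symmetric] ennreal_enn2real_if)
  obtain N0 where N0: "\<And>N l a t. \<lbrakk>N0 \<le> N; 1 \<le> N; T / (real N + 1) < l; l \<le> T / real N; 0 \<le> a; a < l; t \<in> {0..T}\<rbrakk> \<Longrightarrow>
         \<bar>stopped_energy p (shifted_grid T l a) x t - A t\<bar> \<le> e"
    using unif[OF e(1)] by metis
  have dev: "grid_deviation p T x A \<delta> \<le> ennreal e" if \<delta>: "\<delta> < T / (real N0 + 1)" for \<delta>
    unfolding grid_deviation_def
  proof (intro SUP_least ennreal_leI, clarify)
    fix l a t assume l: "0 < l" "l \<le> \<delta>" "l \<le> T" and a: "a \<in> {0..<l}" and t: "t \<in> {0..T}"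
    define N where "N = nat \<lfloor>T / l\<rfloor>"
    have "1 \<le> T / l" using l by simp
    then have N: "real N \<le> T / l" "T / l < real N + 1" unfolding N_def by linarith+
    then have N1: "1 \<le> N" using \<open>1 \<le> T / l\<close> by linarith
    have "l * (real N0 + 1) \<le> \<delta> * (real N0 + 1)" using l by (intro mult_right_mono) auto
    also have "\<dots> < T" using \<delta> by (simp add: pos_less_divide_eq)
    finally have "real N0 + 1 < T / l" using l by (simp add: pos_less_divide_eq mult.commute)
    then have "N0 \<le> N" using N by linarith
    moreover have "T / (real N + 1) < l" "l \<le> T / real N"
      using N N1 l T by (auto simp: field_simps)
    ultimately show "\<bar>stopped_energy p (shifted_grid T l a) x t - A t\<bar> \<le> e"
      using a t N1 by (intro N0) auto
  qed
  have "\<forall>\<^sub>F \<delta> in at_right 0. \<delta> < T / (real N0 + 1)"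
    using T by (intro order_tendstoD[OF tendsto_ident_at]) auto
  then show "\<forall>\<^sub>F \<delta> in at_right 0. grid_deviation p T x A \<delta> < b"
    by eventually_elim (use dev e(2) in \<open>blast intro: order_le_less_trans\<close>)
qed simp

context fbm
begin

text \<open>Three errors of size e / 3: moving the energy to the net, the deviation there, and
  moving the linear limit back.\<close>

lemma stopped_energy_uniform:
  "AE \<omega> in M. \<forall>e>0. \<exists>N0. \<forall>N\<ge>N0. 1 \<le> N \<longrightarrow> (\<forall>l a t. T / (real N + 1) < l \<and> l \<le> T / real N \<and> 0 \<le> a \<and> a < l \<and> t \<in> {0..T} \<longrightarrow>
     \<bar>stopped_energy (1 / H) (shifted_grid T l a) (\<lambda>s. B s \<omega>) t - normal_abs_moment (1 / H) * t\<bar> \<le> e)"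
proof -
  let ?p = "1 / H" and ?\<gamma> = "H / 2" and ?m = "normal_abs_moment (1 / H)"
  obtain Q0 :: nat where "4 / H \<le> real Q0" using real_arch_simple by blast
  define Q where "Q = Q0 + 2"
  \<comment> \<open>The displacement is of order N^(-(Q - 1)), and its power H / 2 is then at most
    of order N^(-2). Summed over N + 2 cells this still leaves 1 / N.\<close>
  have Q: "2 \<le> (real Q - 1) * ?\<gamma>"
  proof -
    have "4 / H \<le> real Q - 1" using \<open>4 / H \<le> real Q0\<close> by (simp add: Q_def)
    then show ?thesis using H by (simp add: field_simps)
  qed
  have p: "1 < ?p" using H by simp
  show ?thesis
    using net_deviation_tendsto[of Q] holder_paths
  proof (rule AE_mp[OF _ AE_mp], intro AE_I2 impI allI)
    fix \<omega> and e :: real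
    assume hoelder: "\<exists>L\<ge>0. \<forall>s\<in>{0..T}. \<forall>t\<in>{0..T}. \<bar>B s \<omega> - B t \<omega>\<bar> \<le> L * \<bar>s - t\<bar> powr ?\<gamma>"
      and net: "\<forall>e>0. \<exists>N0. \<forall>N\<ge>N0. 1 \<le> N \<longrightarrow> (\<forall>z\<in>net Q N. \<bar>net_deviation Q N z \<omega>\<bar> \<le> e)"
      and e: "0 < e"
    let ?x = "\<lambda>s. B s \<omega>"
    obtain L where L: "0 \<le> L" "\<And>s t. s \<in> {0..T} \<Longrightarrow> t \<in> {0..T} \<Longrightarrow> \<bar>?x s - ?x t\<bar> \<le> L * \<bar>s - t\<bar> powr ?\<gamma>"
      using hoelder by blast
    obtain N1 where N1: "\<And>N z. N1 \<le> N \<Longrightarrow> 1 \<le> N \<Longrightarrow> z \<in> net Q N \<Longrightarrow> \<bar>net_deviation Q N z \<omega>\<bar> \<le> e / 3"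
      using net e by (meson divide_pos_pos zero_less_numeral)
    define C where "C = 3 * (?p * (L * T powr ?\<gamma>) powr (?p - 1) * (2 * L * (4 * T) powr ?\<gamma>))"
    define C' where "C' = ?m * (8 * T)"
    have C: "0 \<le> C" "0 \<le> C'" using p L T H normal_abs_moment_nonneg[of ?p] by (auto simp: C_def C'_def)
    obtain N2 :: nat where N2: "3 * (C + C') / e \<le> real N2" using real_arch_simple by blast
    show "\<exists>N0. \<forall>N\<ge>N0. 1 \<le> N \<longrightarrow> (\<forall>l a t. T / (real N + 1) < l \<and> l \<le> T / real N \<and> 0 \<le> a \<and> a < l \<and> t \<in> {0..T} \<longrightarrow>
     \<bar>stopped_energy ?p (shifted_grid T l a) ?x t - ?m * t\<bar> \<le> e)"
    proof (intro exI[of _ "max N1 N2"] allI impI, elim conjE)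
      fix N l a t assume N: "max N1 N2 \<le> N" "1 \<le> N" and l: "T / (real N + 1) < l" "l \<le> T / real N"
        and a: "0 \<le> a" "a < l" and t: "t \<in> {0..T}"
      have N0: "0 < real N" using N by simp
      define h where "h = T / real N ^ Q"
      \<comment> \<open>Rounding displaces a point by at most h from stopping, h from the shift and
        (N + 1) h from the step, in total (N + 3) h \<le> 4 N h.\<close>
      define \<epsilon> where "\<epsilon> = 4 * real N * h"
      have h: "0 < h" using T N0 by (simp add: h_def)
      have l0: "0 < l" using l T by (smt (verit) divide_pos_pos of_nat_0_le_iff)
      have lT: "l \<le> T" using l(2) T N by (smt (verit) divide_le_eq_1 le_divide_eq_1 N0 mult_le_cancel_left1 divide_le_eq of_nat_1 of_nat_le_iff)
      \<comment> \<open>Rounding down keeps the step at most T / N, as membership in the net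
        demands.\<close>
      define i j m where "i = nat \<lfloor>l / h\<rfloor>" and "j = nat \<lfloor>a / h\<rfloor>" and "m = nat \<lfloor>t / h\<rfloor>"
      note i = nat_floor_mult_approx[OF less_imp_le[OF l0] h, folded i_def]
      note j = nat_floor_mult_approx[OF a(1) h, folded j_def]
      have t0: "0 \<le> t" "t \<le> T" using t by auto
      note m = nat_floor_mult_approx[OF t0(1) h, folded m_def]
      have le_pow: "k \<le> N ^ Q" if "real k * h \<le> T" for k
      proof -
        have "real k * h \<le> real N ^ Q * h" using that N0 by (simp add: h_def)
        then have "real k \<le> real N ^ Q" using h by simp
        then show ?thesis by (metis of_nat_le_iff of_nat_power)
      qed
      let ?z = "(i, j, m)"
      have z: "?z \<in> net Q N"
        unfolding net_def h_def[symmetric] using i j m l lT a t0 by (auto intro!: le_pow)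
      have net_time: "net_time Q N ?z = grid_time (real m * h) (real i * h) (real j * h)"
        by (simp add: net_time_def h_def)
      \<comment> \<open>The lower end of the window gives T < (N + 1) l, hence N + 2 clamped cells
        for every step on this scale.\<close>
      have K: "T \<le> a + real (N + 1) * l"
      proof -
        have "T < l * (real N + 1)" using l(1) by (simp add: divide_less_eq)
        then show ?thesis using a by (simp add: algebra_simps)
      qed
      note se = stopped_energy_shifted_grid[OF T l0 a K t0]
      have close: "\<bar>grid_time t l a k - grid_time (real m * h) (real i * h) (real j * h) k\<bar> \<le> \<epsilon>" if "k \<le> N + 2" for k
      proof -
        have "\<bar>grid_time t l a k - grid_time (real m * h) (real i * h) (real j * h) k\<bar> \<le>
          \<bar>t - real m * h\<bar> + \<bar>a - real j * h\<bar> + real (N + 1) * \<bar>l - real i * h\<bar>"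
          by (rule grid_time_diff_le) (use that in auto)
        also have "\<dots> \<le> h + h + real (N + 1) * h"
          using i j m by (intro add_mono mult_left_mono) auto
        also have "\<dots> = (real N + 3) * h" by (simp add: algebra_simps)
        also have "\<dots> \<le> \<epsilon>" unfolding \<epsilon>_def using N h by (intro mult_right_mono) auto
        finally show ?thesis .
      qed
      have N_le: "3 * (C + C') \<le> e * real N"
      proof -
        have "3 * (C + C') / e \<le> real N" using N2 N by linarith
        then show ?thesis using e by (simp add: divide_le_eq mult.commute)
      qed
      have pow: "real N * real N powr - (real Q - 1) \<le> 1"
      proof -
        have "1 \<le> real Q - 1" by (simp add: Q_def)
        then have "real N powr - (real Q - 1) \<le> real N powr - 1" using N by (intro powr_mono) auto
        then show ?thesis using N0 by (simp add: powr_minus_divide field_simps)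
      qed
      have \<epsilon>: "\<epsilon> = 4 * T * real N powr - (real Q - 1)"
      proof -
        have "real N powr - (real Q - 1) = real N powr 1 * real N powr - real Q"
          by (subst powr_add[symmetric]) simp
        also have "\<dots> = real N / real N ^ Q" using N0 by (simp add: powr_minus_divide powr_realpow)
        finally show ?thesis by (simp add: \<epsilon>_def h_def)
      qed
      have "\<bar>grid_energy ?p ?x t l a (N + 2) - grid_energy ?p ?x (real m * h) (real i * h) (real j * h) (N + 2)\<bar>
          \<le> real (N + 2) * (?p * (L * T powr ?\<gamma>) powr (?p - 1) * (2 * L * \<epsilon> powr ?\<gamma>))"
        using H m t0 h by (intro grid_energy_diff_le p L T t close) auto
      also have "\<dots> \<le> (3 * real N) * (?p * (L * T powr ?\<gamma>) powr (?p - 1) * (2 * L * ((4 * T) powr ?\<gamma> * real N powr - 2)))"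
      proof (intro mult_mono order_refl)
        have "\<epsilon> powr ?\<gamma> = (4 * T) powr ?\<gamma> * real N powr (- ((real Q - 1) * ?\<gamma>))"
        proof -
          have "\<epsilon> powr ?\<gamma> = (4 * T) powr ?\<gamma> * (real N powr - (real Q - 1)) powr ?\<gamma>"
            unfolding \<epsilon> by (rule powr_mult)
          also have "(real N powr - (real Q - 1)) powr ?\<gamma> = real N powr (- (real Q - 1) * ?\<gamma>)"
            by (rule powr_powr)
          also have "- (real Q - 1) * ?\<gamma> = - ((real Q - 1) * ?\<gamma>)" by (rule mult_minus_left)
          finally show ?thesis .
        qed
        also have "\<dots> \<le> (4 * T) powr ?\<gamma> * real N powr - 2"
          using Q N by (intro mult_left_mono powr_mono) auto
        finally show "\<epsilon> powr ?\<gamma> \<le> (4 * T) powr ?\<gamma> * real N powr - 2" .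
      qed (use N p L H in auto)
      also have "\<dots> = C / real N"
        using N0 by (simp add: C_def powr_minus_divide power2_eq_square)
      also have "\<dots> \<le> e / 3" using N_le C N0 by (simp add: divide_le_eq)
      finally have 1: "\<bar>grid_energy ?p ?x t l a (N + 2) - grid_energy ?p ?x (real m * h) (real i * h) (real j * h) (N + 2)\<bar> \<le> e / 3" .
      have 2: "\<bar>grid_energy ?p ?x (real m * h) (real i * h) (real j * h) (N + 2)
         - ?m * (net_time Q N ?z (N + 2) - net_time Q N ?z 0)\<bar> \<le> e / 3"
        using N1[of N ?z] N z unfolding net_deviation_def net_time grid_energy_def by auto
      have 3: "\<bar>?m * (net_time Q N ?z (N + 2) - net_time Q N ?z 0) - ?m * t\<bar> \<le> e / 3"
      proof -
        have "\<bar>(net_time Q N ?z (N + 2) - net_time Q N ?z 0) - t\<bar> \<le> 2 * \<epsilon>"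
          using close[of "N + 2"] close[of 0] se(2,3) unfolding net_time by simp
        then have "?m * \<bar>(net_time Q N ?z (N + 2) - net_time Q N ?z 0) - t\<bar> \<le> ?m * (2 * \<epsilon>)"
          by (intro mult_left_mono normal_abs_moment_nonneg)
        also have "\<dots> = C' * real N powr - (real Q - 1)" by (simp add: C'_def \<epsilon>)
        also have "\<dots> \<le> C' * (1 / real N)"
          using pow N0 C by (intro mult_left_mono) (auto simp: field_simps)
        also have "\<dots> \<le> e / 3" using N_le C N0 by (simp add: divide_le_eq)
        finally show ?thesis
          using normal_abs_moment_nonneg[of ?p] by (simp add: abs_mult right_diff_distrib[symmetric])
      qed
      have "stopped_energy ?p (shifted_grid T l a) ?x t = grid_energy ?p ?x t l a (N + 2)"
        using se(1) by simp
      then show "\<bar>stopped_energy ?p (shifted_grid T l a) ?x t - ?m * t\<bar> \<le> e"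
        using 1 2 3 by linarith
    qed
  qed
qed

end

section \<open>The variation measure along dyadic partitions\<close>

lemma initial_segment_sets: "{s \<in> {0..T}. s < a} \<in> sets (restrict_space borel {0..T})" for a T :: real
proof -
  have "{s \<in> {0..T}. s < a} = {0..T} \<inter> {..<a}" by auto
  then show ?thesis by (simp add: sets_restrict_space_iff)
qed

text \<open>Step functions on dyadic blocks approximate f uniformly, and the total masses stay
  bounded because they converge. The segments are open on the right to suit energy measures, which
  put the mass of a cell at its left end.\<close>

lemma weak_limit_on_of_initial_segments:
  assumes T: "0 < T"
    and fin: "\<And>n. finite_measure (\<nu> n)" "finite_measure \<mu>"
    and sets: "\<And>n. sets (\<nu> n) = sets (restrict_space borel {0..T})" "sets \<mu> = sets (restrict_space borel {0..T})"
    and conv: "\<And>j r. (\<lambda>n. measure (\<nu> n) {s \<in> {0..T}. s < real j * T / 2 ^ r}) \<longlonglongrightarrow> measure \<mu> {s \<in> {0..T}. s < real j * T / 2 ^ r}"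
  shows "weak_limit_on T \<nu> \<mu>"
  unfolding weak_limit_on_def
proof (intro allI impI)
  fix f :: "real \<Rightarrow> real" assume f: "continuous_on {0..T} f"
  have bdd: "bounded (f ` {0..T})" by (rule compact_imp_bounded[OF compact_continuous_image[OF f compact_Icc]])
  then obtain K where "\<forall>y\<in>f ` {0..T}. norm y \<le> K"
    unfolding bounded_iff by blast
  then have K: "\<bar>f s\<bar> \<le> K" if "s \<in> {0..T}" for s using that by auto
  have unif: "uniformly_continuous_on {0..T} f" by (rule compact_uniformly_continuous[OF f compact_Icc])
  define tot where "tot m = measure m {0..T}" for m :: "real measure"
  have tot0: "0 \<le> tot m" for m by (simp add: tot_def)
  \<comment> \<open>The end point 2 T is chosen because the segment up to T would omit T
    itself.\<close>
  have all: "{s \<in> {0..T}. s < real 2 * T / 2 ^ 0} = {0..T}" using T by auto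
  have tot_conv: "(\<lambda>n. tot (\<nu> n)) \<longlonglongrightarrow> tot \<mu>"
    using conv[of 2 0] unfolding all tot_def .
  show "(\<lambda>n. \<integral>s. f s \<partial>\<nu> n) \<longlonglongrightarrow> (\<integral>s. f s \<partial>\<mu>)"
  proof (rule LIMSEQ_I)
    fix \<eta> :: real assume \<eta>: "0 < \<eta>"
    define e where "e = \<eta> / (2 * tot \<mu> + 3)"
    have e: "0 < e" using \<eta> tot0[of \<mu>] by (simp add: e_def add_nonneg_pos)
    obtain d where d: "0 < d" "\<And>s t. s \<in> {0..T} \<Longrightarrow> t \<in> {0..T} \<Longrightarrow> dist t s < d \<Longrightarrow> dist (f t) (f s) < e"
      using unif e unfolding uniformly_continuous_on_def by metis
    have "(\<lambda>r. T * (1 / 2) ^ r) \<longlonglongrightarrow> T * 0" by (intro tendsto_intros LIMSEQ_power_zero) auto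
    then have "\<forall>\<^sub>F r in sequentially. T * (1 / 2) ^ r < d" by (rule order_tendstoD) (use d in auto)
    then obtain r where r: "T / 2 ^ r < d" by (auto simp: eventually_sequentially power_divide)
    define u where "u j = real j * T / 2 ^ r" for j
    define Bl where "Bl j = {s \<in> {0..T}. s < u (Suc j)} - {s \<in> {0..T}. s < u j}" for j
    \<comment> \<open>The index 2^r is included: its block is the single point T.\<close>
    define g where "g s = (\<Sum>j\<le>2 ^ r. f (u j) * indicator (Bl j) s)" for s
    have umono: "u j \<le> u (Suc j)" for j using T by (simp add: u_def divide_right_mono)
    have near: "\<bar>f s - g s\<bar> \<le> e" if s: "s \<in> {0..T}" for s
    proof -
      define j where "j = nat \<lfloor>s * 2 ^ r / T\<rfloor>"
      have "0 \<le> s * 2 ^ r / T" using s T by simp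
      then have "real j = of_int \<lfloor>s * 2 ^ r / T\<rfloor>" by (simp add: j_def)
      then have j: "real j \<le> s * 2 ^ r / T" "s * 2 ^ r / T < real j + 1" by linarith+
      have in_iff: "s \<in> Bl i \<longleftrightarrow> i = j" for i
      proof -
        have "s \<in> Bl i \<longleftrightarrow> real i \<le> s * 2 ^ r / T \<and> s * 2 ^ r / T < real i + 1"
          using s T by (auto simp: Bl_def u_def field_simps)
        also have "\<dots> \<longleftrightarrow> i = j" using j by auto
        finally show ?thesis .
      qed
      have "s * 2 ^ r / T \<le> 2 ^ r" using s T by (simp add: divide_le_eq)
      then have "real j \<le> 2 ^ r" using j by linarith
      then have "real j \<le> real (2 ^ r)" by (simp only: of_nat_power of_nat_numeral)
      then have j2: "j \<le> 2 ^ r" by (simp only: of_nat_le_iff)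
      have "g s = (\<Sum>i\<le>2 ^ r. if i = j then f (u i) else 0)"
        unfolding g_def by (intro sum.cong) (auto simp: in_iff indicator_def)
      then have g: "g s = f (u j)" using j2 by simp
      have "u j \<le> s" using j(1) T by (simp add: u_def field_simps)
      moreover have "s < u j + T / 2 ^ r" using j(2) T by (simp add: u_def field_simps)
      moreover have "0 \<le> u j" using T by (simp add: u_def)
      ultimately have "dist (f s) (f (u j)) < e" using s r by (intro d(2)) (auto simp: dist_real_def)
      then show ?thesis by (simp add: g dist_real_def)
    qed
    have approx: "\<bar>(\<integral>s. f s \<partial>m) - (\<Sum>j\<le>2 ^ r. f (u j) * measure m (Bl j))\<bar> \<le> e * tot m"
      if m: "finite_measure m" "sets m = sets (restrict_space borel {0..T})" for m
    proof -
      interpret finite_measure m by (rule m)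
      have sp: "space m = {0..T}" using sets_eq_imp_space_eq[OF m(2)] by (simp add: space_restrict_space)
      have Bl: "Bl j \<in> sets m" for j
        unfolding m(2) Bl_def by (intro sets.Diff initial_segment_sets)
      have fm: "f \<in> borel_measurable m"
        using borel_measurable_continuous_on_restrict[OF f] by (simp cong: measurable_cong_sets add: m(2))
      have fi: "integrable m f"
        by (rule integrable_const_bound[where B = K]) (use K fm in \<open>auto simp: sp intro!: AE_I2\<close>)
      have gi: "integrable m g"
        unfolding g_def using Bl by (intro Bochner_Integration.integrable_sum integrable_mult_right) (auto simp: less_top[symmetric])
      have ig: "(\<integral>s. g s \<partial>m) = (\<Sum>j\<le>2 ^ r. f (u j) * measure m (Bl j))"
        unfolding g_def using Bl by (subst Bochner_Integration.integral_sum) (auto simp: less_top[symmetric])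
      have "\<bar>\<integral>s. f s - g s \<partial>m\<bar> \<le> (\<integral>s. \<bar>f s - g s\<bar> \<partial>m)" by (rule integral_abs_bound)
      also have "\<dots> \<le> (\<integral>s. e \<partial>m)"
        using fi gi near by (intro integral_mono) (auto simp: sp)
      also have "\<dots> = e * tot m" by (simp add: tot_def sp)
      finally show ?thesis using fi gi by (simp add: ig)
    qed
    have lim: "(\<lambda>n. \<Sum>j\<le>2 ^ r. f (u j) * measure (\<nu> n) (Bl j)) \<longlonglongrightarrow> (\<Sum>j\<le>2 ^ r. f (u j) * measure \<mu> (Bl j))"
    proof (intro tendsto_sum tendsto_mult tendsto_const)
      fix j
      have split: "measure m (Bl j) = measure m {s \<in> {0..T}. s < u (Suc j)} - measure m {s \<in> {0..T}. s < u j}"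
        if m: "finite_measure m" "sets m = sets (restrict_space borel {0..T})" for m
      proof -
        interpret finite_measure m by (rule m)
        have "{s \<in> {0..T}. s < a} \<in> sets m" for a
          unfolding m(2) by (rule initial_segment_sets)
        moreover have "{s \<in> {0..T}. s < u j} \<subseteq> {s \<in> {0..T}. s < u (Suc j)}" using umono[of j] by auto
        ultimately show ?thesis unfolding Bl_def by (intro finite_measure_Diff)
      qed
      show "(\<lambda>n. measure (\<nu> n) (Bl j)) \<longlonglongrightarrow> measure \<mu> (Bl j)"
        unfolding split[OF fin(1) sets(1)] split[OF fin(2) sets(2)] u_def
        by (intro tendsto_diff conv)
    qed
    have "\<forall>\<^sub>F n in sequentially. \<bar>(\<Sum>j\<le>2 ^ r. f (u j) * measure (\<nu> n) (Bl j)) - (\<Sum>j\<le>2 ^ r. f (u j) * measure \<mu> (Bl j))\<bar> < e"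
      using tendstoD[OF lim e] by (simp add: dist_real_def)
    moreover have "\<forall>\<^sub>F n in sequentially. tot (\<nu> n) < tot \<mu> + 1"
      using tot_conv by (rule order_tendstoD) simp
    ultimately have "\<forall>\<^sub>F n in sequentially. norm ((\<integral>s. f s \<partial>\<nu> n) - (\<integral>s. f s \<partial>\<mu>)) < \<eta>"
    proof eventually_elim
      case (elim n)
      have "e * tot (\<nu> n) \<le> e * (tot \<mu> + 1)" using elim(2) e by (intro mult_left_mono) auto
      then have "\<bar>(\<integral>s. f s \<partial>\<nu> n) - (\<integral>s. f s \<partial>\<mu>)\<bar> < e * (tot \<mu> + 1) + e + e * tot \<mu>"
        using approx[OF fin(1) sets(1), of n] approx[OF fin(2) sets(2)] elim(1) by linarith
      also have "\<dots> \<le> e * (2 * tot \<mu> + 3)" using e by (simp add: algebra_simps)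
      also have "\<dots> = \<eta>" using tot0[of \<mu>] by (simp add: e_def)
      finally show ?case by simp
    qed
    then show "\<exists>n0. \<forall>n\<ge>n0. norm ((\<integral>s. f s \<partial>\<nu> n) - (\<integral>s. f s \<partial>\<mu>)) < \<eta>"
      by (simp add: eventually_sequentially)
  qed
qed

text \<open>The ramps \<open>?f a k\<close> increase to the indicator of the half-line right of a,
  so the integrals determine the masses of half-lines. Both measures are carried to the whole line,
  where half-lines determine a measure, and then back.\<close>

lemma finite_measure_eqI_continuous:
  fixes \<mu> \<mu>' :: "real measure"
  assumes fin: "finite_measure \<mu>" "finite_measure \<mu>'"
    and sets: "sets \<mu> = sets (restrict_space borel {0..T})" "sets \<mu>' = sets (restrict_space borel {0..T})"
    and eq: "\<And>f :: real \<Rightarrow> real. continuous_on {0..T} f \<Longrightarrow> (\<integral>s. f s \<partial>\<mu>) = (\<integral>s. f s \<partial>\<mu>')"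
  shows "\<mu> = \<mu>'"
proof -
  have sp: "space m = {0..T}" if "sets m = sets (restrict_space borel {0..T})" for m :: "real measure"
    using sets_eq_imp_space_eq[OF that] by (simp add: space_restrict_space)
  have id: "(\<lambda>x. x) \<in> measurable m borel" if "sets m = sets (restrict_space borel {0..T})" for m :: "real measure"
    using borel_measurable_continuous_on_restrict[of "{0..T}" "\<lambda>x. x"] by (simp cong: measurable_cong_sets add: that)
  let ?f = "\<lambda>a (k::nat) s. min 1 (real k * max 0 (s - a))"
  have lim: "(\<lambda>k. \<integral>s. ?f a k s \<partial>m) \<longlonglongrightarrow> measure m {s \<in> space m. a < s}"
    if m: "finite_measure m" "sets m = sets (restrict_space borel {0..T})" for m and a :: real
  proof -
    interpret finite_measure m by (rule m)
    note [measurable] = id[OF m(2)]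
    have S: "{s \<in> space m. a < s} \<in> sets m" by measurable
    have "(\<lambda>k. \<integral>s. ?f a k s \<partial>m) \<longlonglongrightarrow> (\<integral>s. indicator {s \<in> space m. a < s} s \<partial>m)"
    proof (rule integral_dominated_convergence[where w = "\<lambda>_. 1"])
      show "AE s in m. (\<lambda>k. ?f a k s) \<longlonglongrightarrow> indicator {s \<in> space m. a < s} s"
      proof (rule AE_I2)
        fix s assume s: "s \<in> space m"
        show "(\<lambda>k. ?f a k s) \<longlonglongrightarrow> indicator {s \<in> space m. a < s} s"
        proof (cases "a < s")
          case True
          obtain k0 :: nat where k0: "1 / (s - a) \<le> real k0" using real_arch_simple by blast
          have "?f a k s = 1" if "k0 \<le> k" for k
          proof -
            have "1 / (s - a) \<le> real k" using k0 that by linarith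
            then show ?thesis using True by (simp add: divide_le_eq max_def)
          qed
          then have "\<forall>\<^sub>F k in sequentially. ?f a k s = 1" unfolding eventually_sequentially by blast
          then show ?thesis using True s by (simp add: tendsto_eventually)
        qed (use s in auto)
      qed
      show "indicator {s \<in> space m. a < s} \<in> borel_measurable m" using S by simp
      show "AE s in m. norm (?f a k s) \<le> 1" for k
        by (rule AE_I2) (auto simp: min_def)
    qed auto
    then show ?thesis using S by simp
  qed
  have "distr \<mu> borel (\<lambda>x. x) = distr \<mu>' borel (\<lambda>x. x)"
  proof (rule measure_eqI_lessThan)
    show "emeasure (distr \<mu> borel (\<lambda>x. x)) {a<..} < \<infinity>" for a
      using finite_measure.emeasure_finite[OF finite_measure.finite_measure_distr[OF fin(1) id[OF sets(1)]]]
      by (simp add: less_top)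
    show "emeasure (distr \<mu> borel (\<lambda>x. x)) {a<..} = emeasure (distr \<mu>' borel (\<lambda>x. x)) {a<..}" for a
    proof -
      have "continuous_on {0..T} (?f a k)" for k by (intro continuous_intros)
      then have "(\<lambda>k. \<integral>s. ?f a k s \<partial>\<mu>) = (\<lambda>k. \<integral>s. ?f a k s \<partial>\<mu>')" using eq by blast
      then have "measure \<mu> {s \<in> space \<mu>. a < s} = measure \<mu>' {s \<in> space \<mu>'. a < s}"
        using lim[OF fin(1) sets(1), of a] lim[OF fin(2) sets(2), of a] LIMSEQ_unique by fastforce
      then have "emeasure \<mu> {s \<in> space \<mu>. a < s} = emeasure \<mu>' {s \<in> space \<mu>'. a < s}"
        using fin by (simp add: finite_measure.emeasure_eq_measure)
      moreover have "emeasure (distr m borel (\<lambda>x. x)) {a<..} = emeasure m {s \<in> space m. a < s}"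
        if "sets m = sets (restrict_space borel {0..T})" for m :: "real measure"
        using id[OF that] by (subst emeasure_distr) (auto intro!: arg_cong[where f = "emeasure m"])
      ultimately show ?thesis using sets by simp
    qed
  qed auto
  then have D: "emeasure (distr \<mu> borel (\<lambda>x. x)) A = emeasure (distr \<mu>' borel (\<lambda>x. x)) A" for A by simp
  show ?thesis
  proof (rule measure_eqI)
    show "sets \<mu> = sets \<mu>'" using sets by simp
    fix A assume "A \<in> sets \<mu>"
    then obtain A' where A': "A' \<in> sets borel" "A = {0..T} \<inter> A'"
      unfolding sets(1) sets_restrict_space by auto
    have "emeasure (distr m borel (\<lambda>x. x)) A' = emeasure m A"
      if "sets m = sets (restrict_space borel {0..T})" for m :: "real measure"
      using id[OF that] A' sp[OF that] by (subst emeasure_distr) (auto intro!: arg_cong[where f = "emeasure m"])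
    then show "emeasure \<mu> A = emeasure \<mu>' A" using D[of A'] sets by simp
  qed
qed

text \<open>This justifies the definite description in \<open>variation_measure\<close>.\<close>

lemma has_variation_measure_unique:
  assumes "has_variation_measure p T Ps x \<mu>" "has_variation_measure p T Ps x \<mu>'"
  shows "\<mu> = \<mu>'"
proof (rule finite_measure_eqI_continuous[of _ _ T])
  fix f :: "real \<Rightarrow> real" assume f: "continuous_on {0..T} f"
  have "(\<lambda>n. \<integral>s. f s \<partial>energy_measure p T (Ps n) x) \<longlonglongrightarrow> (\<integral>s. f s \<partial>m)" if "has_variation_measure p T Ps x m" for m
    using that f unfolding has_variation_measure_def weak_limit_on_def by blast
  from LIMSEQ_unique[OF this[OF assms(1)] this[OF assms(2)]]
  show "(\<integral>s. f s \<partial>\<mu>) = (\<integral>s. f s \<partial>\<mu>')" .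
qed (use assms in \<open>auto simp: has_variation_measure_def\<close>)

text \<open>Through this identity the dyadic statement is an instance of the uniform convergence,
  with shift 0.\<close>

lemma dyadic_partition_eq_shifted_grid:
  assumes T: "0 < T"
  shows "dyadic_partition T m = shifted_grid T (T / 2 ^ m) 0"
proof (rule set_eqI, rule iffI)
  fix u assume "u \<in> dyadic_partition T m"
  then obtain j :: nat where "u = real j * T / 2 ^ m" "j \<in> {0..2 ^ m}"
    unfolding dyadic_partition_def by (elim imageE)
  then have j: "u = real j * T / 2 ^ m" "j \<le> 2 ^ m" by simp_all
  consider "j = 0" | "j = 2 ^ m" | "0 < j" "j < 2 ^ m" using j by linarith
  then show "u \<in> shifted_grid T (T / 2 ^ m) 0"
  proof cases
    case 3
    have "real j < real (2 ^ m)" using 3 by (simp only: of_nat_less_iff)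
    then have "real j * T < 2 ^ m * T" using T by (intro mult_strict_right_mono) simp_all
    then have "0 < u" "u < T" unfolding j(1) using 3 T by (simp_all add: pos_divide_less_eq mult.commute)
    moreover have "u = 0 + of_int (int j) * (T / 2 ^ m)" using j by simp
    ultimately show ?thesis unfolding shifted_grid_def by blast
  qed (use j T in \<open>auto simp: shifted_grid_def\<close>)
next
  fix u assume "u \<in> shifted_grid T (T / 2 ^ m) 0"
  then consider "u = 0" | "u = T" | k :: int where "u = of_int k * (T / 2 ^ m)" "0 < u" "u < T"
    unfolding shifted_grid_def by auto
  then show "u \<in> dyadic_partition T m"
  proof cases
    case 1 then show ?thesis unfolding dyadic_partition_def by (intro image_eqI[where x = 0]) auto
  next
    case 2 then show ?thesis unfolding dyadic_partition_def by (intro image_eqI[where x = "2 ^ m"]) auto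
  next
    case 3
    have k0: "0 < k" using 3 T by (simp add: zero_less_mult_iff zero_less_divide_iff)
    have "of_int k * T < 2 ^ m * T" using 3(3) unfolding 3(1) by (simp add: pos_divide_less_eq mult.commute)
    then have "k < 2 ^ m" using T by simp
    then have "nat k \<le> 2 ^ m" using k0 by (simp add: nat_le_iff)
    then show ?thesis using 3 k0 unfolding dyadic_partition_def by (intro image_eqI[where x = "nat k"]) auto
  qed
qed

text \<open>Stopping at a dyadic point of a coarser level cuts no cell, so the cells that begin
  before it are exactly those that the stopped energy counts. The minimum with T covers indices
  beyond 2^r.\<close>

lemma energy_measure_dyadic:
  assumes T: "0 < T"
  shows "finite_measure (energy_measure p T (dyadic_partition T m) x)"
    and "sets (energy_measure p T (dyadic_partition T m) x) = sets (restrict_space borel {0..T})"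
    and "r \<le> m \<Longrightarrow> measure (energy_measure p T (dyadic_partition T m) x) {s \<in> {0..T}. s < real j * T / 2 ^ r} =
      stopped_energy p (dyadic_partition T m) x (min (real j * T / 2 ^ r) T)"
proof -
  let ?P = "dyadic_partition T m"
  let ?w = "\<lambda>i. \<bar>x (node ?P (Suc i)) - x (node ?P i)\<bar> powr p"
  let ?M = "point_measure {..<card ?P - 1} (\<lambda>i. ennreal (?w i))"
  have card: "card ?P - 1 = 2 ^ m" by (simp add: card_dyadic_partition[OF T])
  have node: "node ?P i = real i * T / 2 ^ m" if "i \<le> 2 ^ m" for i by (rule node_dyadic_partition[OF T that])
  have node_in: "node ?P i \<in> {0..T}" if "i \<le> 2 ^ m" for i
  proof -
    have "real i \<le> real (2 ^ m)" using that by (simp only: of_nat_le_iff)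
    then show ?thesis using T by (simp add: node[OF that] divide_le_eq)
  qed
  have meas: "node ?P \<in> measurable ?M (restrict_space borel {0..T})"
    using node_in by (intro measurable_restrict_space2) (auto simp: card_dyadic_partition[OF T] space_point_measure)
  have em: "emeasure ?M A = ennreal (\<Sum>i\<in>A. ?w i)" if "A \<subseteq> {..<2 ^ m}" for A
    using that by (subst emeasure_point_measure_finite) (auto simp: card_dyadic_partition[OF T])
  have "finite_measure ?M"
    by (rule finite_measureI) (use em[of "{..<2 ^ m}"] in \<open>simp add: space_point_measure card_dyadic_partition[OF T]\<close>)
  then show "finite_measure (energy_measure p T ?P x)"
    unfolding energy_measure_def by (rule finite_measure.finite_measure_distr[OF _ meas])
  show "sets (energy_measure p T ?P x) = sets (restrict_space borel {0..T})"
    by (simp add: energy_measure_def)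
  assume r: "r \<le> m"
  let ?t = "real j * T / 2 ^ r" and ?A = "{i. i < 2 ^ m \<and> node ?P i < real j * T / 2 ^ r}"
  have S: "{s \<in> {0..T}. s < ?t} \<in> sets (restrict_space borel {0..T})"
    by (rule initial_segment_sets)
  have vim: "node ?P -` {s \<in> {0..T}. s < ?t} \<inter> space ?M = ?A"
    using node_in by (auto simp: space_point_measure card_dyadic_partition[OF T])
  have "emeasure (energy_measure p T ?P x) {s \<in> {0..T}. s < ?t} = ennreal (\<Sum>i\<in>?A. ?w i)"
    unfolding energy_measure_def emeasure_distr[OF meas S] vim by (rule em) auto
  then have "measure (energy_measure p T ?P x) {s \<in> {0..T}. s < ?t} = (\<Sum>i\<in>?A. ?w i)"
    by (simp add: measure_def sum_nonneg)
  also have "\<dots> = (\<Sum>i<2 ^ m. if node ?P i < ?t then ?w i else 0)"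
    by (simp add: sum.If_cases) (rule sum.cong, auto)
  also have "\<dots> = stopped_energy p ?P x (min ?t T)"
    unfolding stopped_energy_def card
  proof (rule sum.cong[OF refl])
    fix i :: nat assume "i \<in> {..<2 ^ m}"
    then have i: "i < 2 ^ m" by simp
    note n = node[of i] node[of "Suc i"] node_in[of i] node_in[of "Suc i"]
    show "(if node ?P i < ?t then ?w i else 0) =
        \<bar>x (min (node ?P (Suc i)) (min ?t T)) - x (min (node ?P i) (min ?t T))\<bar> powr p"
    proof (cases "node ?P i < ?t")
      case True
      \<comment> \<open>The point of level r has index j 2^(m - r) at level m, so the successor of a
        node before it cannot pass it.\<close>
      have pow: "(2::real) ^ m = 2 ^ (m - r) * 2 ^ r" using r by (simp add: power_add[symmetric])
      have "real i < real (j * 2 ^ (m - r))"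
        using True n(1) i T unfolding pow by (simp add: field_simps)
      then have "Suc i \<le> j * 2 ^ (m - r)" by (simp only: of_nat_less_iff Suc_le_eq)
      then have le: "real (Suc i) \<le> real (j * 2 ^ (m - r))" by (simp only: of_nat_le_iff)
      have "node ?P (Suc i) = real (Suc i) * T / 2 ^ m" using i by (intro n(2)) simp
      also have "\<dots> \<le> real (j * 2 ^ (m - r)) * T / 2 ^ m"
        using T by (intro divide_right_mono mult_right_mono le) auto
      also have "\<dots> = ?t" unfolding pow by simp
      finally have "node ?P (Suc i) \<le> ?t" .
      then have "min (node ?P (Suc i)) (min ?t T) = node ?P (Suc i)" "min (node ?P i) (min ?t T) = node ?P i"
        using True n(3,4) i by auto
      then show ?thesis using True by simp
    next
      case False
      have "node ?P i \<le> node ?P (Suc i)" using n(1,2) i T by (simp add: divide_right_mono)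
      then have "min (node ?P (Suc i)) (min ?t T) = min ?t T" "min (node ?P i) (min ?t T) = min ?t T"
        using False n(3,4) i by auto
      then show ?thesis using False by simp
    qed
  qed
  finally show "measure (energy_measure p T ?P x) {s \<in> {0..T}. s < ?t} = stopped_energy p ?P x (min ?t T)" .
qed

text \<open>The limit is c times Lebesgue measure on [0, T]. For a dyadic end point of level r the
  energies are masses of initial segments from level m = r on, which is all that a limit
  sees.\<close>

lemma variation_measure_of_linear_energy:
  assumes T: "0 < T" and c: "0 \<le> c"
    and lim: "\<And>t. t \<in> {0..T} \<Longrightarrow> (\<lambda>m. stopped_energy p (dyadic_partition T m) x t) \<longlonglongrightarrow> c * t"
  shows "\<exists>\<mu>. has_variation_measure p T (dyadic_partition T) x \<mu>"
    and "t \<in> {0..T} \<Longrightarrow> variation p T (dyadic_partition T) x t = c * t"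
proof -
  let ?\<mu> = "density (restrict_space lborel {0..T}) (\<lambda>_. ennreal c)"
  have sets: "sets ?\<mu> = sets (restrict_space borel {0..T})"
    by (simp add: sets_restrict_space)
  have em: "emeasure ?\<mu> A = ennreal c * emeasure lborel A" if "A \<in> sets borel" "A \<subseteq> {0..T}" for A
  proof -
    have "A \<in> sets (restrict_space lborel {0..T})"
      using that by (simp add: sets_restrict_space_iff)
    then show ?thesis using that by (simp add: emeasure_density_const emeasure_restrict_space)
  qed
  have fin: "finite_measure ?\<mu>"
    by (rule finite_measureI) (use T in \<open>auto simp: space_restrict_space em ennreal_mult_eq_top_iff\<close>)
  have seg: "measure ?\<mu> {s \<in> {0..T}. s < t} = c * min t T" if t: "0 \<le> t" for t
  proof (cases "t \<le> T")
    case True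
    then have "{s \<in> {0..T}. s < t} = {0..<t}" by auto
    then show ?thesis using True t T c by (simp add: measure_def em ennreal_mult[symmetric] subset_eq)
  next
    case False
    then have "{s \<in> {0..T}. s < t} = {0..T}" by auto
    then show ?thesis using False t T c by (simp add: measure_def em ennreal_mult[symmetric])
  qed
  have var: "has_variation_measure p T (dyadic_partition T) x ?\<mu>"
    unfolding has_variation_measure_def
  proof (intro conjI ballI sets fin)
    show "emeasure ?\<mu> {t} = 0" if "t \<in> {0..T}" for t using that by (subst em) auto
    show "weak_limit_on T (\<lambda>m. energy_measure p T (dyadic_partition T m) x) ?\<mu>"
    proof (rule weak_limit_on_of_initial_segments[OF T energy_measure_dyadic(1)[OF T] fin energy_measure_dyadic(2)[OF T] sets])
      fix j r
      let ?t = "real j * T / 2 ^ r"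
      have t: "0 \<le> ?t" using T by simp
      have "(\<lambda>m. stopped_energy p (dyadic_partition T m) x (min ?t T)) \<longlonglongrightarrow> c * min ?t T"
        using t T by (intro lim) auto
      then have "(\<lambda>m. stopped_energy p (dyadic_partition T m) x (min ?t T)) \<longlonglongrightarrow> measure ?\<mu> {s \<in> {0..T}. s < ?t}"
        by (simp only: seg[OF t])
      moreover have "\<forall>\<^sub>F m in sequentially. stopped_energy p (dyadic_partition T m) x (min ?t T) =
          measure (energy_measure p T (dyadic_partition T m) x) {s \<in> {0..T}. s < ?t}"
        using eventually_ge_at_top[of r] by eventually_elim (simp only: energy_measure_dyadic(3)[OF T])
      ultimately show "(\<lambda>m. measure (energy_measure p T (dyadic_partition T m) x) {s \<in> {0..T}. s < ?t})
          \<longlonglongrightarrow> measure ?\<mu> {s \<in> {0..T}. s < ?t}"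
        by (rule Lim_transform_eventually)
    qed
  qed
  then show "\<exists>\<mu>. has_variation_measure p T (dyadic_partition T) x \<mu>" by blast
  have "variation_measure p T (dyadic_partition T) x = ?\<mu>"
    unfolding variation_measure_def by (rule the_equality[of "has_variation_measure p T (dyadic_partition T) x", OF var]) (rule has_variation_measure_unique[OF _ var])
  then show "variation p T (dyadic_partition T) x t = c * t" if "t \<in> {0..T}"
    using that c unfolding variation_def by (simp add: measure_def em ennreal_mult[symmetric] subset_eq)
qed

theorem theorem6p5:
  fixes M :: "'a measure" and B :: "real \<Rightarrow> 'a \<Rightarrow> real" and T H p :: real
  assumes "prob_space M"
    and "0 < T" and "0 < H" and "H < 1"
    and "fractional_brownian_motion_on M T H B"
    and "p = 1 / H"
  shows "(\<exists>\<Omega>\<in>sets M. measure M \<Omega> = 1 \<and>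
            (\<forall>\<omega>\<in>\<Omega>. (grid_deviation p T (\<lambda>t. B t \<omega>) (\<lambda>t. normal_abs_moment p * t) \<longlongrightarrow> 0) (at_right 0)))
       \<and> (AE \<omega> in M. (\<lambda>t. B t \<omega>) \<in> rough_paths p T)
       \<and> (AE \<omega> in M.
            (\<exists>\<mu>. has_variation_measure p T (dyadic_partition T) (\<lambda>t. B t \<omega>) \<mu>) \<and>
            (\<forall>t\<in>{0..T}. variation p T (dyadic_partition T) (\<lambda>t. B t \<omega>) t = normal_abs_moment p * t))"
proof -
  interpret prob_space M by fact
  interpret fbm M B T H by unfold_locales fact+
  let ?m = "normal_abs_moment p"
  have m: "0 < ?m" using assms by (intro normal_abs_moment_pos) simp
  define U where "U \<omega> \<longleftrightarrow> (\<forall>e>0. \<exists>N0. \<forall>N\<ge>N0. 1 \<le> N \<longrightarrow> (\<forall>l a t. T / (real N + 1) < l \<and> l \<le> T / real N \<and> 0 \<le> a \<and> a < l \<and> t \<in> {0..T} \<longrightarrow>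
     \<bar>stopped_energy p (shifted_grid T l a) (\<lambda>s. B s \<omega>) t - ?m * t\<bar> \<le> e))" for \<omega>
  have unif: "AE \<omega> in M. U \<omega>"
    using stopped_energy_uniform unfolding assms(6) U_def .
  \<comment> \<open>The event \<open>U\<close> involves uncountably many parameters, and its
    measurability is not established. The event of probability one is the complement of a measurable
    null set that contains the exceptional paths.\<close>
  then obtain Z where Z: "{\<omega> \<in> space M. \<not> U \<omega>} \<subseteq> Z" "emeasure M Z = 0" "Z \<in> sets M"
    by (rule AE_E)
  let ?\<Omega> = "space M - Z"
  have grid: "(grid_deviation p T (\<lambda>t. B t \<omega>) (\<lambda>t. ?m * t) \<longlongrightarrow> 0) (at_right 0)" if "U \<omega>" for \<omega>
    using assms(2) that unfolding U_def by (intro grid_deviation_tendsto_0) auto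
  have rough: "(\<lambda>t. B t \<omega>) \<in> rough_paths p T" if "\<omega> \<in> space M" "U \<omega>" for \<omega>
    unfolding rough_paths_def using cont[OF that(1)] grid[OF that(2)] m assms(2)
    by (auto intro!: exI[of _ "\<lambda>t. ?m * t"] continuous_intros mono_onI mult_left_mono)
  have energy: "(\<lambda>n. stopped_energy p (dyadic_partition T n) (\<lambda>s. B s \<omega>) t) \<longlonglongrightarrow> ?m * t"
    if U: "U \<omega>" and t: "t \<in> {0..T}" for \<omega> t
  proof (rule LIMSEQ_I)
    fix e :: real assume e: "0 < e"
    then obtain N0 where N0: "\<And>N l a t. \<lbrakk>N0 \<le> N; 1 \<le> N; T / (real N + 1) < l; l \<le> T / real N; 0 \<le> a; a < l; t \<in> {0..T}\<rbrakk> \<Longrightarrow>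
       \<bar>stopped_energy p (shifted_grid T l a) (\<lambda>s. B s \<omega>) t - ?m * t\<bar> \<le> e / 2"
      using U[unfolded U_def] half_gt_zero[OF e] by metis
    show "\<exists>n0. \<forall>n\<ge>n0. norm (stopped_energy p (dyadic_partition T n) (\<lambda>s. B s \<omega>) t - ?m * t) < e"
    proof (intro exI[of _ N0] allI impI)
      fix n assume n: "N0 \<le> n"
      have "n < 2 ^ n" by (rule less_exp)
      then have "N0 \<le> 2 ^ n" using n by linarith
      \<comment> \<open>The dyadic step is the upper end of the window with N = 2^n.\<close>
      moreover have "T / (2 ^ n + 1) < T / 2 ^ n"
        using assms(2) by (intro divide_strict_left_mono) (auto simp: add_pos_pos)
      ultimately have "\<bar>stopped_energy p (shifted_grid T (T / 2 ^ n) 0) (\<lambda>s. B s \<omega>) t - ?m * t\<bar> \<le> e / 2"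
        using assms(2) t by (intro N0[of "2 ^ n"]) auto
      then show "norm (stopped_energy p (dyadic_partition T n) (\<lambda>s. B s \<omega>) t - ?m * t) < e"
        using e by (simp add: dyadic_partition_eq_shifted_grid[OF assms(2)])
    qed
  qed
  show ?thesis
  proof (intro conjI)
    have "measure M Z = 0" using Z(2) by (simp add: measure_def)
    then have "measure M ?\<Omega> = 1" by (simp add: prob_compl[OF Z(3)])
    then show "\<exists>\<Omega>\<in>sets M. measure M \<Omega> = 1 \<and>
            (\<forall>\<omega>\<in>\<Omega>. (grid_deviation p T (\<lambda>t. B t \<omega>) (\<lambda>t. ?m * t) \<longlongrightarrow> 0) (at_right 0))"
      using Z(1,3) by (intro bexI[of _ ?\<Omega>] conjI ballI grid) auto
    show "AE \<omega> in M. (\<lambda>t. B t \<omega>) \<in> rough_paths p T"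
      using unif by (rule AE_mp) (intro AE_I2 impI rough)
    show "AE \<omega> in M. (\<exists>\<mu>. has_variation_measure p T (dyadic_partition T) (\<lambda>t. B t \<omega>) \<mu>) \<and>
            (\<forall>t\<in>{0..T}. variation p T (dyadic_partition T) (\<lambda>t. B t \<omega>) t = ?m * t)"
      using unif
    proof (rule AE_mp, intro AE_I2 impI)
      fix \<omega> assume "U \<omega>"
      note variation_measure_of_linear_energy[OF assms(2) less_imp_le[OF m] energy[OF this]]
      then show "(\<exists>\<mu>. has_variation_measure p T (dyadic_partition T) (\<lambda>t. B t \<omega>) \<mu>) \<and>
            (\<forall>t\<in>{0..T}. variation p T (dyadic_partition T) (\<lambda>t. B t \<omega>) t = ?m * t)"
        by blast
    qed
  qed
qed

end
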